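(* Let $m+1\ge 3$ and let $(\Sigma_t)_{t\in[0,1]}$ be an isometric deformation of a compact hypersurface in $\mathbf{R}^{m+1}$. Then the integral of the mean curvature $\int_{\Sigma_t} H_t\,dA$ is independent of $t$.
   Context: A smooth compact oriented hypersurface (without boundary) is understood. An isometric deformation is a smooth one-parameter family of immersions $\phi_t:\Sigma\to\mathbf{R}^{m+1}$, $t\in[0,1]$, $\Sigma_t=\phi_t(\Sigma)$, such that the induced metric on $\Sigma$ does not depend on $t$. With $n$ the oriented unit normal, the shape operator is $BX=-D_Xn$ and the mean curvature is $H=\mathrm{tr}(B)$ (sum of principal curvatures); $dA$ is the area element of the induced metric. *)

theory Defs
  imports "HOL-Analysis.Analysis"
begin

text \<open>Smooth maps between Euclidean spaces. \<open>Ck_on\<close> is meaningful on open sets only;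
  on an arbitrary set, such as a product with the closed interval \<open>{0..1}\<close>, a map is smooth
  if near each point it is the restriction of a smooth map defined on an open set.\<close>

fun Ck_on :: "nat \<Rightarrow> 'e::euclidean_space set \<Rightarrow> ('e \<Rightarrow> 'f::real_normed_vector) \<Rightarrow> bool" where
  "Ck_on 0 W f \<longleftrightarrow> continuous_on W f"
| "Ck_on (Suc k) W f \<longleftrightarrow> (\<forall>x\<in>W. f differentiable (at x)) \<and>
     (\<forall>v. Ck_on k W (\<lambda>x. frechet_derivative f (at x) v))"

definition smooth_on :: "'e::euclidean_space set \<Rightarrow> ('e \<Rightarrow> 'f::real_normed_vector) \<Rightarrow> bool" where
  "smooth_on D f \<longleftrightarrow>
     (\<forall>p\<in>D. \<exists>W g. open W \<and> p \<in> W \<and> (\<forall>k. Ck_on k W g) \<and> (\<forall>x\<in>D \<inter> W. g x = f x))"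

text \<open>A chart \<open>(U, x)\<close> consists of its domain and its coordinate map; the values of \<open>x\<close>
  outside \<open>U\<close> are irrelevant. Manifolds have no boundary, since the image of a chart is an open
  subset of \<open>real ^ 'm\<close>.\<close>

type_synonym ('a, 'm) chart = "'a set \<times> ('a \<Rightarrow> real ^ 'm)"

definition oriented_smooth_atlas ::
    "'a::topological_space set \<Rightarrow> ('a, 'm::finite) chart set \<Rightarrow> bool" where
  "oriented_smooth_atlas S \<A> \<longleftrightarrow>
     (\<Union>(U, x)\<in>\<A>. U) = S \<and>
     (\<forall>(U, x)\<in>\<A>. openin (top_of_set S) U \<and> open (x ` U) \<and>
        homeomorphism U (x ` U) x (inv_into U x)) \<and>
     (\<forall>(U, x)\<in>\<A>. \<forall>(V, y)\<in>\<A>.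
        smooth_on (x ` (U \<inter> V)) (y \<circ> inv_into U x) \<and>
        (\<forall>u\<in>x ` (U \<inter> V). det (matrix (frechet_derivative (y \<circ> inv_into U x) (at u))) > 0))"

text \<open>Local geometry of a parametrised hypersurface \<open>\<psi>\<close>. The ambient space is
  \<open>real ^ 'm option\<close>, whose dimension is \<open>CARD('m) + 1\<close>.\<close>

definition first_form ::
    "(real ^ 'm::finite \<Rightarrow> real ^ 'm option) \<Rightarrow> real ^ 'm \<Rightarrow> real ^ 'm \<Rightarrow> real ^ 'm \<Rightarrow> real" where
  "first_form \<psi> u v w = frechet_derivative \<psi> (at u) v \<bullet> frechet_derivative \<psi> (at u) w"

definition area_density :: "(real ^ 'm::finite \<Rightarrow> real ^ 'm option) \<Rightarrow> real ^ 'm \<Rightarrow> real" where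
  "area_density \<psi> u = sqrt (det (\<chi> i j. first_form \<psi> u (axis i 1) (axis j 1)))"

text \<open>The matrix whose column \<open>Some j\<close> is the \<open>j\<close>-th coordinate tangent vector and whose
  column \<open>None\<close> is \<open>\<nu>\<close>. Rows and columns have the same index type, so the sign of its
  determinant does not depend on an ordering of the indices.\<close>

definition frame_matrix ::
    "(real ^ 'm::finite \<Rightarrow> real ^ 'm option) \<Rightarrow> real ^ 'm \<Rightarrow> real ^ 'm option
       \<Rightarrow> real ^ 'm option ^ 'm option" where
  "frame_matrix \<psi> u \<nu> =
     (\<chi> r c. (case c of None \<Rightarrow> \<nu> | Some j \<Rightarrow> frechet_derivative \<psi> (at u) (axis j 1)) $ r)"

definition oriented_unit_normal ::
    "(real ^ 'm::finite \<Rightarrow> real ^ 'm option) \<Rightarrow> real ^ 'm \<Rightarrow> real ^ 'm option" where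
  "oriented_unit_normal \<psi> u =
     (THE \<nu>. norm \<nu> = 1 \<and> (\<forall>v. \<nu> \<bullet> frechet_derivative \<psi> (at u) v = 0) \<and>
        det (frame_matrix \<psi> u \<nu>) > 0)"

text \<open>The shape operator \<open>B X = - D\<^sub>X n\<close>, with the tangent hyperplane identified with
  \<open>real ^ 'm\<close> by the derivative of \<open>\<psi>\<close>.\<close>

definition shape_operator ::
    "(real ^ 'm::finite \<Rightarrow> real ^ 'm option) \<Rightarrow> real ^ 'm \<Rightarrow> real ^ 'm \<Rightarrow> real ^ 'm" where
  "shape_operator \<psi> u =
     (THE B. linear B \<and>
        (\<forall>v. frechet_derivative \<psi> (at u) (B v)
              = - frechet_derivative (oriented_unit_normal \<psi>) (at u) v))"

text \<open>Immersions of a manifold. The choice of the chart in \<open>mean_curvature\<close> is immaterial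
  for an oriented atlas.\<close>

definition immersion ::
    "('a, 'm::finite) chart set \<Rightarrow> ('a \<Rightarrow> real ^ 'm option) \<Rightarrow> bool" where
  "immersion \<A> f \<longleftrightarrow>
     (\<forall>(U, x)\<in>\<A>. smooth_on (x ` U) (f \<circ> inv_into U x) \<and>
        (\<forall>u\<in>x ` U. inj (frechet_derivative (f \<circ> inv_into U x) (at u))))"

definition mean_curvature ::
    "('a, 'm::finite) chart set \<Rightarrow> ('a \<Rightarrow> real ^ 'm option) \<Rightarrow> 'a \<Rightarrow> real" where
  "mean_curvature \<A> f p =
     (let (U, x) = (SOME c. c \<in> \<A> \<and> p \<in> fst c)
      in trace (matrix (shape_operator (f \<circ> inv_into U x) (x p))))"

text \<open>The Borel measure on \<open>S\<close> given in every chart by \<open>sqrt (det g) du\<close>, where \<open>g\<close> is the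
  metric induced by \<open>f\<close>; it exists and is unique when \<open>S\<close> is compact and \<open>f\<close> is an immersion.\<close>

definition area_measure ::
    "'a::topological_space set \<Rightarrow> ('a, 'm::finite) chart set \<Rightarrow> ('a \<Rightarrow> real ^ 'm option)
       \<Rightarrow> 'a measure" where
  "area_measure S \<A> f =
     (THE M. sets M = sets (restrict_space borel S) \<and>
        (\<forall>(U, x)\<in>\<A>. \<forall>E\<in>sets M. E \<subseteq> U \<longrightarrow>
           emeasure M E = (\<integral>\<^sup>+u\<in>x ` E. ennreal (area_density (f \<circ> inv_into U x) u) \<partial>lborel)))"

definition isometric_deformation ::
    "('a, 'm::finite) chart set \<Rightarrow> (real \<Rightarrow> 'a \<Rightarrow> real ^ 'm option) \<Rightarrow> bool" where
  "isometric_deformation \<A> \<phi> \<longleftrightarrow>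
     (\<forall>(U, x)\<in>\<A>. smooth_on ({0..1} \<times> x ` U) (\<lambda>(t, u). \<phi> t (inv_into U x u))) \<and>
     (\<forall>t\<in>{0..1}. immersion \<A> (\<phi> t)) \<and>
     (\<forall>s\<in>{0..1}. \<forall>t\<in>{0..1}. \<forall>(U, x)\<in>\<A>. \<forall>u\<in>x ` U.
        first_form (\<phi> s \<circ> inv_into U x) u = first_form (\<phi> t \<circ> inv_into U x) u)"

end

theory Submission
  imports Defs
begin

text \<open>
  Let \<open>f\<close> and \<open>f'\<close> be two immersions with the same induced metric and \<open>\<chi> = f' - f\<close>. Since
  \<open>\<Delta> f = H n\<close> for the common Laplacian, integrating \<open>div (\<nabla>\<chi> \<bullet> n) = \<Delta>\<chi> \<bullet> n + \<nabla>\<chi> \<bullet> \<nabla>n\<close> gives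
  \<^emph>\<open>exactly\<close> \<open>\<integral> (H' - H) = \<integral> H' (1 - n' \<bullet> n) - \<integral> \<nabla>\<chi> \<bullet> \<nabla>n\<close>. Both terms on the right are quadratic
  in \<open>d\<chi>\<close>: the first because \<open>1 - n' \<bullet> n = \<bar>n' - n\<bar>\<^sup>2 / 2\<close>, the second because \<open>\<nabla>n\<close> is tangential and self-adjoint, while the symmetric part of
  \<open>d\<chi> \<bullet> df\<close> equals \<open>- (d\<chi> \<bullet> d\<chi>) / 2\<close> by isometry. Along the deformation the total mean curvature thus
  changes by at most \<open>C (t - s)\<^sup>2\<close>, hence is constant. No time derivative of \<open>n\<close> or \<open>H\<close>
  is needed, only the Lipschitz dependence of \<open>df\<close> on time. The divergence theorem is
  applied after localising with a \<open>C\<^sup>1\<close> partition of unity \<open>\<rho>\<^sub>i\<close>; the terms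
  \<open>\<nabla>\<rho>\<^sub>i \<bullet> (\<nabla>\<chi> \<bullet> n)\<close> do not depend on the chart and sum to zero.
\<close>

section \<open>Calculus of \<open>C\<^sup>1\<close> maps\<close>

text \<open>The estimate is asymmetric on purpose: \<open>s\<close> stays fixed and only
  \<open>t\<close> varies, so every constant may depend on \<open>s\<close>, and a quadratic bound
  at each single \<open>s\<close> already forces the derivative of the integral to vanish. All
  geometric coefficients are taken at time \<open>s\<close>; of the immersion at time
  \<open>t\<close> only the size of its second space derivatives and its first-order deviation from
  time \<open>s\<close> must be uniform. The divergence is therefore tested against the normal at
  time \<open>s\<close>, and the normal at time \<open>t\<close> enters undifferentiated. The
  obstacle is the sign of the normal. What the geometry yields is
  \<open>1 - (n' \<bullet> n)^2\<close>, the squared length of the tangential part of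
  \<open>n'\<close>, which does not distinguish \<open>n'\<close> from \<open>- n'\<close>. It
  bounds \<open>1 - n' \<bullet> n\<close> only when \<open>n' \<bullet> n \<ge> 0\<close>; for
  nearby times this follows from the continuity of a frame determinant. At the ends of the time
  interval no two-sided time derivative exists; there the local extensions contained in
  \<open>smooth_on\<close> are differentiated instead.\<close>

abbreviation C1_on :: "'e::euclidean_space set \<Rightarrow> ('e \<Rightarrow> 'f::real_normed_vector) \<Rightarrow> bool" where
  "C1_on \<equiv> Ck_on (Suc 0)"

abbreviation Der :: "('e::euclidean_space \<Rightarrow> 'f::real_normed_vector) \<Rightarrow> 'e \<Rightarrow> 'e \<Rightarrow> 'f" where
  "Der f x \<equiv> frechet_derivative f (at x)"

abbreviation pd :: "'m::finite \<Rightarrow> (real ^ 'm \<Rightarrow> 'f::real_normed_vector) \<Rightarrow> real ^ 'm \<Rightarrow> 'f" where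
  "pd i f u \<equiv> Der f u (axis i 1)"

lemma has_derivative_cong_open:
  assumes "open W" "x \<in> W" "\<And>y. y \<in> W \<Longrightarrow> f y = g y"
  shows "(f has_derivative f') (at x) \<longleftrightarrow> (g has_derivative f') (at x)"
  using has_derivative_transform_within_open[of f f' x UNIV W g]
    has_derivative_transform_within_open[of g f' x UNIV W f] assms by auto

lemma frechet_derivative_cong_open:
  assumes "open W" "x \<in> W" "\<And>y. y \<in> W \<Longrightarrow> f y = g y"
  shows "Der f x = Der g x"
  using has_derivative_cong_open[OF assms] by (simp add: frechet_derivative_def)

lemma differentiable_cong_open:
  assumes "open W" "x \<in> W" "\<And>y. y \<in> W \<Longrightarrow> f y = g y"
  shows "f differentiable (at x) \<longleftrightarrow> g differentiable (at x)"
  using has_derivative_cong_open[OF assms] by (simp add: differentiable_def)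

lemma frechet_derivative_zero_open:
  assumes "open W" "x \<in> W" "\<And>y. y \<in> W \<Longrightarrow> f y = 0"
  shows "Der f x v = 0"
proof -
  have "Der f x = Der (\<lambda>_. 0) x"
    by (rule frechet_derivative_cong_open[OF assms])
  also have "\<dots> = (\<lambda>_. 0)" by (rule frechet_derivative_at[symmetric]) simp
  finally show ?thesis by simp
qed

lemma Ck_on_cong:
  assumes "open W" "\<And>x. x \<in> W \<Longrightarrow> f x = g x"
  shows "Ck_on k W f \<longleftrightarrow> Ck_on k W g"
  using assms(2)
proof (induction k arbitrary: f g)
  case 0
  then show ?case by (simp cong: continuous_on_cong)
next
  case (Suc k)
  have "Ck_on k W (\<lambda>x. Der f x v)
      = Ck_on k W (\<lambda>x. Der g x v)" for v
    by (rule Suc.IH) (simp add: frechet_derivative_cong_open[OF assms(1) _ Suc.prems])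
  then show ?case
    using differentiable_cong_open[OF assms(1) _ Suc.prems] by auto
qed

lemma Ck_on_subset: "Ck_on k W f \<Longrightarrow> V \<subseteq> W \<Longrightarrow> Ck_on k V f"
  by (induction k arbitrary: f) (auto intro: continuous_on_subset)

lemma Ck_on_local:
  assumes "\<And>x. x \<in> V \<Longrightarrow> \<exists>W. open W \<and> x \<in> W \<and> Ck_on k W f"
  shows "Ck_on k V f"
  using assms
proof (induction k arbitrary: f)
  case 0
  show ?case
    unfolding Ck_on.simps continuous_on_eq_continuous_within
  proof
    fix x assume "x \<in> V"
    with 0 obtain W where "open W" "x \<in> W" "continuous_on W f" by auto
    then show "continuous (at x within V) f"
      using continuous_at_imp_continuous_at_within continuous_on_eq_continuous_at by blast
  qed
next
  case (Suc k)
  have "f differentiable (at x)" if "x \<in> V" for x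
    using Suc.prems[OF that] by auto
  moreover have "Ck_on k V (\<lambda>x. Der f x v)" for v
    by (rule Suc.IH) (use Suc.prems in fastforce)
  ultimately show ?case by simp
qed

text \<open>Near each point of an open set the local extension agrees with the map itself, hence has
  the same derivatives there.\<close>

lemma smooth_on_imp_Ck_on:
  assumes "open V" "smooth_on V f"
  shows "Ck_on k V f"
proof (rule Ck_on_local)
  fix x assume "x \<in> V"
  then obtain W g where g: "open W" "x \<in> W" "Ck_on k W g" "\<forall>x\<in>V \<inter> W. g x = f x"
    using assms(2) unfolding smooth_on_def by meson
  have "Ck_on k (V \<inter> W) g" using g(3) by (rule Ck_on_subset) simp
  then have "Ck_on k (V \<inter> W) f"
    by (subst Ck_on_cong[of _ f g]) (use g assms in auto)
  then show "\<exists>W. open W \<and> x \<in> W \<and> Ck_on k W f"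
    using g assms \<open>x \<in> V\<close> by (intro exI[of _ "V \<inter> W"]) auto
qed

lemma C1_onI:
  assumes "\<And>x. x \<in> W \<Longrightarrow> (f has_derivative f' x) (at x)"
    and "\<And>v. continuous_on W (\<lambda>x. f' x v)"
  shows "C1_on W f"
proof -
  have "Der f x = f' x" if "x \<in> W" for x
    using assms(1)[OF that] by (simp add: frechet_derivative_at[symmetric])
  then have "continuous_on W (\<lambda>x. Der f x v)" for v
    using assms(2)[of v] by (simp cong: continuous_on_cong)
  moreover have "f differentiable (at x)" if "x \<in> W" for x
    using assms(1)[OF that] by (auto simp: differentiable_def)
  ultimately show ?thesis by simp
qed

lemma C1_on_has_derivative:
  assumes "C1_on W f" "x \<in> W"
  shows "(f has_derivative Der f x) (at x)"
  using assms by (simp add: frechet_derivative_works[symmetric])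

lemma C1_on_continuous_derivative:
  "C1_on W f \<Longrightarrow> continuous_on W (\<lambda>x. Der f x v)"
  by simp

lemma C1_on_imp_continuous_on: "C1_on W f \<Longrightarrow> continuous_on W f"
  by (auto intro!: continuous_at_imp_continuous_on differentiable_imp_continuous_within)

lemma Ck_on_Suc_imp: "Ck_on (Suc k) W f \<Longrightarrow> Ck_on k W f"
proof (induction k arbitrary: f)
  case 0
  then show ?case using C1_on_imp_continuous_on[of W f] by (simp only: Ck_on.simps(1))
next
  case (Suc k)
  then show ?case by (subst Ck_on.simps(2), subst (asm) (2) Ck_on.simps(2)) auto
qed

lemma C2_onD:
  assumes "Ck_on (Suc (Suc 0)) W f"
  shows "C1_on W f" "C1_on W (\<lambda>x. Der f x v)"
  using assms Ck_on_Suc_imp by (blast, auto)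

declare Ck_on.simps(2) [simp del]

lemma C1_on_const: "C1_on W (\<lambda>x. c)"
  by (rule C1_onI[where f' = "\<lambda>x v. 0"]) auto

lemma C1_on_bilinear:
  assumes "bounded_bilinear pr" "C1_on W f" "C1_on W g"
  shows "C1_on W (\<lambda>x. pr (f x) (g x))"
  by (rule C1_onI[OF bounded_bilinear.FDERIV[OF assms(1)
        C1_on_has_derivative[OF assms(2)] C1_on_has_derivative[OF assms(3)]]], assumption+)
    (intro continuous_on_add bounded_bilinear.continuous_on[OF assms(1)]
      C1_on_imp_continuous_on[OF assms(2)] C1_on_imp_continuous_on[OF assms(3)]
      C1_on_continuous_derivative assms(2,3))

lemmas C1_on_mult = C1_on_bilinear[OF bounded_bilinear_mult]
lemmas C1_on_scaleR = C1_on_bilinear[OF bounded_bilinear_scaleR]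
lemmas C1_on_inner = C1_on_bilinear[OF bounded_bilinear_inner]

lemma C1_on_linear:
  assumes "bounded_linear h" "C1_on W f"
  shows "C1_on W (\<lambda>x. h (f x))"
  by (rule C1_onI[OF bounded_linear.has_derivative[OF assms(1) C1_on_has_derivative[OF assms(2)]]], assumption)
    (intro bounded_linear.continuous_on[OF assms(1)] C1_on_continuous_derivative assms(2))

lemma C1_on_add:
  assumes "C1_on W f" "C1_on W g"
  shows "C1_on W (\<lambda>x. f x + g x)"
  by (rule C1_onI[OF has_derivative_add[OF
        C1_on_has_derivative[OF assms(1)] C1_on_has_derivative[OF assms(2)]]], assumption+)
    (intro continuous_on_add C1_on_continuous_derivative assms)

lemma C1_on_minus: "C1_on W f \<Longrightarrow> C1_on W (\<lambda>x. - f x)"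
  by (rule C1_on_linear[OF bounded_linear_minus[OF bounded_linear_ident]])

lemma C1_on_diff: "C1_on W f \<Longrightarrow> C1_on W g \<Longrightarrow> C1_on W (\<lambda>x. f x - g x)"
  using C1_on_add[OF _ C1_on_minus, of W f g] by simp

lemma C1_on_sum:
  assumes "\<And>i. i \<in> I \<Longrightarrow> C1_on W (f i)"
  shows "C1_on W (\<lambda>x. \<Sum>i\<in>I. f i x)"
  using assms by (induction I rule: infinite_finite_induct)
    (simp_all add: C1_on_const C1_on_add)

lemma C1_on_prod:
  fixes f :: "'i \<Rightarrow> 'e::euclidean_space \<Rightarrow> real"
  assumes "\<And>i. i \<in> I \<Longrightarrow> C1_on W (f i)"
  shows "C1_on W (\<lambda>x. \<Prod>i\<in>I. f i x)"
  using assms by (induction I rule: infinite_finite_induct)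
    (simp_all add: C1_on_const C1_on_mult)

lemma C1_on_vec_nth: "C1_on W f \<Longrightarrow> C1_on W (\<lambda>x. f x $ i)"
  by (rule C1_on_linear[OF bounded_linear_vec_nth])

lemma C1_on_vec:
  fixes f :: "'e::euclidean_space \<Rightarrow> 'i::finite \<Rightarrow> real"
  assumes "\<And>i. C1_on W (\<lambda>x. f x i)"
  shows "C1_on W (\<lambda>x. \<chi> i. f x i)"
proof -
  have "(\<chi> i. f x i) = (\<Sum>i\<in>UNIV. f x i *\<^sub>R axis i 1)" for x
    by (simp add: vec_eq_iff axis_def if_distrib cong: if_cong)
  then show ?thesis
    by (simp only:) (intro C1_on_sum C1_on_scaleR C1_on_const assms)
qed

lemma C1_on_det:
  fixes M :: "'e::euclidean_space \<Rightarrow> real ^ 'n::finite ^ 'n"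
  assumes "\<And>i j. C1_on W (\<lambda>x. M x $ i $ j)"
  shows "C1_on W (\<lambda>x. det (M x))"
  unfolding det_def by (intro C1_on_sum C1_on_mult C1_on_const C1_on_prod assms)

text \<open>\<open>C1_on\<close> gives continuity of the derivative only in a fixed direction,
  whereas here the direction \<open>Der f x v\<close> moves with \<open>x\<close>. Expanding it in
  the basis leaves finitely many fixed directions with continuous coefficients.\<close>

lemma C1_on_compose:
  fixes g :: "'f::euclidean_space \<Rightarrow> 'g::real_normed_vector"
  assumes f: "C1_on W f" and g: "C1_on V g" and sub: "f ` W \<subseteq> V"
  shows "C1_on W (\<lambda>x. g (f x))"
proof (rule C1_onI)
  fix x assume x: "x \<in> W"
  show "((\<lambda>x. g (f x)) has_derivative
      (\<lambda>v. \<Sum>b\<in>Basis. (Der f x v \<bullet> b) *\<^sub>R Der g (f x) b)) (at x)"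
  proof -
    have dg: "(g has_derivative Der g (f x)) (at (f x))"
      by (rule C1_on_has_derivative[OF g]) (use x sub in auto)
    have lin: "Der g (f x) w
        = (\<Sum>b\<in>Basis. (w \<bullet> b) *\<^sub>R Der g (f x) b)" for w
    proof -
      have "Der g (f x) w
          = Der g (f x) (\<Sum>b\<in>Basis. (w \<bullet> b) *\<^sub>R b)"
        by (simp add: euclidean_representation)
      then show ?thesis
        using has_derivative_linear[OF dg] by (simp add: linear_sum linear_cmul)
    qed
    show ?thesis
      by (rule has_derivative_eq_rhs[OF has_derivative_compose[OF C1_on_has_derivative[OF f x] dg]])
        (rule ext, rule lin)
  qed
next
  fix v
  show "continuous_on W (\<lambda>x. \<Sum>b\<in>Basis. (Der f x v \<bullet> b)
      *\<^sub>R Der g (f x) b)"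
    by (intro continuous_intros C1_on_continuous_derivative[OF f]
        continuous_on_compose2[OF C1_on_continuous_derivative[OF g] C1_on_imp_continuous_on[OF f] sub])
qed

lemma C1_on_inverse:
  fixes f :: "'e::euclidean_space \<Rightarrow> real"
  assumes "C1_on W f" "\<And>x. x \<in> W \<Longrightarrow> f x \<noteq> 0"
  shows "C1_on W (\<lambda>x. inverse (f x))"
proof (rule C1_on_compose[OF assms(1), of "- {0}"])
  show "C1_on (- {0}) (inverse :: real \<Rightarrow> real)"
  proof (rule C1_onI)
    fix x :: real assume "x \<in> - {0}"
    then show "(inverse has_derivative (\<lambda>h. - (inverse x * h * inverse x))) (at x)"
      by (intro has_derivative_inverse') auto
  next
    fix v :: real
    show "continuous_on (- {0}) (\<lambda>x. - (inverse x * v * inverse x))"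
      by (intro continuous_intros) auto
  qed
qed (use assms(2) in auto)

lemma C1_on_divide:
  fixes f g :: "'e::euclidean_space \<Rightarrow> real"
  assumes "C1_on W f" "C1_on W g" "\<And>x. x \<in> W \<Longrightarrow> g x \<noteq> 0"
  shows "C1_on W (\<lambda>x. f x / g x)"
  unfolding divide_inverse by (intro C1_on_mult C1_on_inverse assms)

lemma C1_on_sqrt:
  fixes f :: "'e::euclidean_space \<Rightarrow> real"
  assumes "C1_on W f" "\<And>x. x \<in> W \<Longrightarrow> f x > 0"
  shows "C1_on W (\<lambda>x. sqrt (f x))"
proof (rule C1_on_compose[OF assms(1), of "{0<..}"])
  show "C1_on {0<..} sqrt"
  proof (rule C1_onI)
    fix x :: real assume "x \<in> {0<..}"
    then show "(sqrt has_derivative (*) (inverse (sqrt x) / 2)) (at x)"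
      using DERIV_real_sqrt[of x] by (simp add: has_field_derivative_def)
  next
    fix v :: real
    show "continuous_on {0<..} (\<lambda>x. inverse (sqrt x) / 2 * v)"
      by (intro continuous_intros) auto
  qed
qed (use assms(2) in auto)

lemma C1_on_line:
  fixes f :: "'e::euclidean_space \<Rightarrow> real"
  assumes "C1_on W f" "z + s *\<^sub>R v \<in> W"
  shows "((\<lambda>s. f (z + s *\<^sub>R v)) has_real_derivative Der f (z + s *\<^sub>R v) v) (at s)"
proof -
  note d = C1_on_has_derivative[OF assms]
  have "((\<lambda>s. z + s *\<^sub>R v) has_derivative (\<lambda>r. r *\<^sub>R v)) (at s)"
    by (auto intro!: derivative_eq_intros)
  note has_derivative_compose[OF this d]
  moreover have "(\<lambda>r. Der f (z + s *\<^sub>R v) (r *\<^sub>R v))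
      = (*) (Der f (z + s *\<^sub>R v) v)"
    using linear_cmul[OF has_derivative_linear[OF d]] by (simp add: fun_eq_iff)
  ultimately show ?thesis by (simp add: has_field_derivative_def)
qed

section \<open>Symmetry of second derivatives\<close>

lemma second_difference_mvt:
  fixes f :: "'e::euclidean_space \<Rightarrow> real"
  assumes f: "Ck_on (Suc (Suc 0)) W f" and h: "h > 0"
    and sub: "\<And>s t. \<lbrakk>0 \<le> s; s \<le> h; 0 \<le> t; t \<le> h\<rbrakk> \<Longrightarrow> x + s *\<^sub>R v + t *\<^sub>R w \<in> W"
  shows "\<exists>s t. 0 < s \<and> s < h \<and> 0 < t \<and> t < h \<and>
    f (x + h *\<^sub>R v + h *\<^sub>R w) - f (x + h *\<^sub>R v) - f (x + h *\<^sub>R w) + f x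
     = h * h * Der (\<lambda>y. Der f y v) (x + s *\<^sub>R v + t *\<^sub>R w) w"
proof -
  let ?d = "\<lambda>y. Der f y v"
  let ?g = "\<lambda>s. f (x + s *\<^sub>R v + h *\<^sub>R w) - f (x + s *\<^sub>R v)"
  note C = C2_onD[OF f]
  have "((\<lambda>s. f ((x + h *\<^sub>R w) + s *\<^sub>R v) - f (x + s *\<^sub>R v)) has_real_derivative
      (?d ((x + h *\<^sub>R w) + s *\<^sub>R v) - ?d (x + s *\<^sub>R v))) (at s)" if "0 \<le> s" "s \<le> h" for s
    by (intro DERIV_diff C1_on_line[OF C(1)]) (use sub[OF that, of h] sub[OF that, of 0] h in \<open>auto simp: algebra_simps\<close>)
  then have dg: "(?g has_real_derivative (?d (x + s *\<^sub>R v + h *\<^sub>R w) - ?d (x + s *\<^sub>R v))) (at s)"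
    if "0 \<le> s" "s \<le> h" for s
    using that by (simp only: add.assoc add.commute[of "h *\<^sub>R w"])
  \<comment> \<open>The mean value theorem is applied to the difference of \<open>f\<close> along
    two parallel edges, and below to the resulting increment of the derivative along
    \<open>v\<close>.\<close>
  obtain s where s: "0 < s" "s < h" and
    1: "?g h - ?g 0 = (h - 0) * (?d (x + s *\<^sub>R v + h *\<^sub>R w) - ?d (x + s *\<^sub>R v))"
    using MVT2[OF h dg] by blast
  have dd: "((\<lambda>t. ?d (x + s *\<^sub>R v + t *\<^sub>R w)) has_real_derivative
      Der ?d (x + s *\<^sub>R v + t *\<^sub>R w) w) (at t)" if "0 \<le> t" "t \<le> h" for t
    by (rule C1_on_line[OF C(2)]) (use sub that s in simp)
  obtain t where t: "0 < t" "t < h" and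
    2: "?d (x + s *\<^sub>R v + h *\<^sub>R w) - ?d (x + s *\<^sub>R v + 0 *\<^sub>R w)
       = (h - 0) * Der ?d (x + s *\<^sub>R v + t *\<^sub>R w) w"
    using MVT2[OF h dd] by blast
  show ?thesis
    using s t 1 2 by (intro exI[of _ s] exI[of _ t]) (simp add: algebra_simps)
qed

text \<open>The second difference over a small parallelogram does not change when \<open>v\<close>
  and \<open>w\<close> are exchanged, and it is \<open>h * h\<close> times either mixed derivative
  at some point of the parallelogram. Continuity at \<open>x\<close> then brings the two values
  within \<open>e\<close> of each other.\<close>

lemma second_derivative_symmetric_real:
  fixes f :: "'e::euclidean_space \<Rightarrow> real"
  assumes W: "open W" and f: "Ck_on (Suc (Suc 0)) W f" and x: "x \<in> W"
  shows "Der (\<lambda>y. Der f y v) x w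
       = Der (\<lambda>y. Der f y w) x v"
    (is "?a x = ?b x")
proof -
  have cont: "continuous (at x) (\<lambda>x. Der (\<lambda>y. Der f y v) x w)" for v w
    using C1_on_continuous_derivative[OF C2_onD(2)[OF f]] W x
    by (simp add: continuous_on_eq_continuous_at)
  have "\<bar>?a x - ?b x\<bar> \<le> e" if e: "e > 0" for e
  proof -
    obtain d1 where d1: "d1 > 0" "\<And>y. dist y x < d1 \<Longrightarrow> \<bar>?a y - ?a x\<bar> < e/2"
      using cont[of v w] e unfolding continuous_at_eps_delta dist_real_def
      by (metis half_gt_zero)
    obtain d2 where d2: "d2 > 0" "\<And>y. dist y x < d2 \<Longrightarrow> \<bar>?b y - ?b x\<bar> < e/2"
      using cont[of w v] e unfolding continuous_at_eps_delta dist_real_def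
      by (metis half_gt_zero)
    obtain d3 where d3: "d3 > 0" "ball x d3 \<subseteq> W" using W x openE by blast
    define d where "d = min d1 (min d2 d3)"
    have d: "d > 0" "d \<le> d1" "d \<le> d2" "d \<le> d3" using d1 d2 d3 by (auto simp: d_def)
    \<comment> \<open>The parallelogram scaled by this factor lies within distance \<open>d\<close>
      of \<open>x\<close>; the \<open>+ 1\<close> covers \<open>v = w = 0\<close>.\<close>
    define h where "h = d / (norm v + norm w + 1)"
    have nn: "norm v + norm w + 1 > 0" by (smt (verit) norm_ge_zero)
    have h: "h > 0" using d nn by (simp add: h_def)
    have hd: "h * (norm v + norm w) < d"
    proof -
      have "h * (norm v + norm w) < h * (norm v + norm w + 1)" using h by simp
      also have "\<dots> = d" using nn by (simp add: h_def)
      finally show ?thesis .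
    qed
    have near: "dist (x + s *\<^sub>R v + t *\<^sub>R w) x < d" if "0 \<le> s" "s \<le> h" "0 \<le> t" "t \<le> h"
      "h * (norm v + norm w) < d" for s t v w
    proof -
      have "dist (x + s *\<^sub>R v + t *\<^sub>R w) x = norm (s *\<^sub>R v + t *\<^sub>R w)"
        by (simp add: dist_norm algebra_simps)
      also have "\<dots> \<le> s * norm v + t * norm w" using that norm_triangle_ineq[of "s *\<^sub>R v" "t *\<^sub>R w"] by simp
      also have "\<dots> \<le> h * norm v + h * norm w" using that by (intro add_mono mult_right_mono) auto
      finally show ?thesis using that by (simp add: algebra_simps)
    qed
    have sub: "x + s *\<^sub>R v + t *\<^sub>R w \<in> W" if "0 \<le> s" "s \<le> h" "0 \<le> t" "t \<le> h"
      "h * (norm v + norm w) < d" for s t v w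
      using near[OF that] d d3 by (auto simp: dist_commute subset_iff)
    obtain s t where st: "0 < s" "s < h" "0 < t" "t < h"
      "f (x + h *\<^sub>R v + h *\<^sub>R w) - f (x + h *\<^sub>R v) - f (x + h *\<^sub>R w) + f x
        = h * h * ?a (x + s *\<^sub>R v + t *\<^sub>R w)"
      using second_difference_mvt[OF f h, of x v w] sub[of _ _ v w] hd by blast
    obtain s' t' where st': "0 < s'" "s' < h" "0 < t'" "t' < h"
      "f (x + h *\<^sub>R w + h *\<^sub>R v) - f (x + h *\<^sub>R w) - f (x + h *\<^sub>R v) + f x
        = h * h * ?b (x + s' *\<^sub>R w + t' *\<^sub>R v)"
      using second_difference_mvt[OF f h, of x w v] sub[of _ _ w v] hd by (metis add.commute)
    have comm: "x + h *\<^sub>R w + h *\<^sub>R v = x + h *\<^sub>R v + h *\<^sub>R w" by simp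
    have "h * h * ?a (x + s *\<^sub>R v + t *\<^sub>R w) = h * h * ?b (x + s' *\<^sub>R w + t' *\<^sub>R v)"
      using st(5) st'(5)[unfolded comm] by linarith
    then have eq: "?a (x + s *\<^sub>R v + t *\<^sub>R w) = ?b (x + s' *\<^sub>R w + t' *\<^sub>R v)" using h by simp
    have "\<bar>?a (x + s *\<^sub>R v + t *\<^sub>R w) - ?a x\<bar> < e/2"
      by (rule d1(2)) (use near[of s t v w] hd st d in auto)
    moreover have "\<bar>?b (x + s' *\<^sub>R w + t' *\<^sub>R v) - ?b x\<bar> < e/2"
      by (rule d2(2)) (use near[of s' t' w v] st' d hd in \<open>auto simp: add_ac\<close>)
    ultimately show ?thesis using eq by linarith
  qed
  then show ?thesis using field_le_epsilon[of "\<bar>?a x - ?b x\<bar>" 0] by simp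
qed

lemma frechet_derivative_inner_const:
  assumes "f differentiable (at x)"
  shows "Der (\<lambda>y. f y \<bullet> b) x v = Der f x v \<bullet> b"
  using has_derivative_inner_left[OF assms[unfolded frechet_derivative_works], of b]
  by (simp add: frechet_derivative_at[symmetric])

lemma second_derivative_symmetric:
  fixes f :: "'e::euclidean_space \<Rightarrow> 'f::euclidean_space"
  assumes W: "open W" and f: "Ck_on (Suc (Suc 0)) W f" and x: "x \<in> W"
  shows "Der (\<lambda>y. Der f y v) x w
       = Der (\<lambda>y. Der f y w) x v"
proof (rule euclidean_eqI)
  fix b :: 'f assume "b \<in> Basis"
  have 1: "Der (\<lambda>y. f y \<bullet> b) y v = Der f y v \<bullet> b"
    if "y \<in> W" for y v
    by (rule frechet_derivative_inner_const) (use C2_onD(1)[OF f] that in \<open>simp add: Ck_on.simps(2)\<close>)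
  have 2: "Der (\<lambda>y. Der (\<lambda>y. f y \<bullet> b) y v) x w
      = Der (\<lambda>y. Der f y v) x w \<bullet> b" for v w
  proof -
    have "Der (\<lambda>y. Der (\<lambda>y. f y \<bullet> b) y v) x
       = Der (\<lambda>y. Der f y v \<bullet> b) x"
      by (rule frechet_derivative_cong_open[OF W x 1])
    then show ?thesis
      using frechet_derivative_inner_const[of "\<lambda>y. Der f y v" x b w]
        C2_onD(2)[OF f] x by (simp add: Ck_on.simps(2))
  qed
  have "C1_on W (\<lambda>y. Der (\<lambda>y. f y \<bullet> b) y v)" for v
    by (subst Ck_on_cong[OF W 1]) (assumption, intro C1_on_inner C1_on_const C2_onD[OF f])
  then have "Ck_on (Suc (Suc 0)) W (\<lambda>y. f y \<bullet> b)"
    using C1_on_inner[OF C2_onD(1)[OF f] C1_on_const, of b] by (simp add: Ck_on.simps(2))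
  from second_derivative_symmetric_real[OF W this x]
  show "Der (\<lambda>y. Der f y v) x w \<bullet> b =
      Der (\<lambda>y. Der f y w) x v \<bullet> b"
    by (simp only: 2)
qed

section \<open>Linear algebra of hypersurface frames\<close>

lemma linear_vec_sum:
  fixes f :: "real ^ 'm::finite \<Rightarrow> 'b::real_vector"
  assumes "linear f"
  shows "f v = (\<Sum>i\<in>UNIV. v $ i *\<^sub>R f (axis i 1))"
proof -
  have "f v = f (\<Sum>i\<in>UNIV. v $ i *\<^sub>R axis i 1)"
    by (simp add: basis_expansion scalar_mult_eq_scaleR[symmetric])
  then show ?thesis using assms by (simp add: linear_sum linear_cmul)
qed

section \<open>Gram matrices and positivity of determinants\<close>

definition gram :: "(real ^ 'm::finite \<Rightarrow> real ^ 'n::finite) \<Rightarrow> real ^ 'm ^ 'm" where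
  "gram f = (\<chi> i j. f (axis i 1) \<bullet> f (axis j 1))"

lemma gram_mult:
  assumes "linear f"
  shows "gram f *v a = (\<chi> i. f (axis i 1) \<bullet> f a)"
  by (simp add: linear_vec_sum[OF assms, of a] gram_def matrix_vector_mult_def vec_eq_iff
      inner_sum_right mult.commute)

lemma gram_inner:
  assumes "linear f"
  shows "(gram f *v a) \<bullet> b = f a \<bullet> f b"
proof -
  have "f a \<bullet> f b = (\<Sum>i\<in>UNIV. b $ i * (f a \<bullet> f (axis i 1)))"
    by (simp add: linear_vec_sum[OF assms, of b] inner_sum_right)
  then show ?thesis
    by (simp add: gram_mult[OF assms] inner_vec_def inner_commute mult.commute)
qed

lemma gram_sym: "gram f $ i $ j = gram f $ j $ i"
  by (simp add: gram_def inner_commute)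

lemma det_eq_0_kernel:
  fixes M :: "real ^ 'm::finite ^ 'm"
  assumes "det M = 0"
  shows "\<exists>x. x \<noteq> 0 \<and> M *v x = 0"
  using assms invertible_det_nz[of M] invertible_left_inverse[of M] matrix_left_invertible_ker[of M]
  by blast

text \<open>The segment from the identity to \<open>M\<close> consists of positive definite
  matrices, whose kernels are trivial. So the determinant has no zero on it and keeps the sign it
  has at the identity.\<close>

lemma det_pos_definite:
  fixes M :: "real ^ 'm::finite ^ 'm"
  assumes "\<And>x. x \<noteq> 0 \<Longrightarrow> (M *v x) \<bullet> x > 0"
  shows "det M > 0"
proof (rule ccontr)
  assume neg: "\<not> det M > 0"
  define h where "h s = (1 - s) *\<^sub>R mat 1 + s *\<^sub>R M" for s :: real
  have "continuous_on {0..1} (\<lambda>s. det (h s))"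
    unfolding h_def det_def by (intro continuous_intros) 
  moreover have "det (h 0) > 0" "det (h 1) \<le> 0" using neg by (simp_all add: h_def)
  ultimately obtain s where s: "s \<in> {0..1}" "det (h s) = 0"
    using IVT2'[of "\<lambda>s. det (h s)" 1 0 0] by auto
  obtain x where x: "x \<noteq> 0" "h s *v x = 0"
    using s(2) by (metis det_eq_0_kernel)
  have "0 = (h s *v x) \<bullet> x" using x by simp
  also have "\<dots> = (1 - s) * (x \<bullet> x) + s * ((M *v x) \<bullet> x)"
    by (simp add: h_def matrix_vector_mult_add_rdistrib scaleR_matrix_vector_assoc[symmetric] inner_add_left)
  also have "\<dots> > 0"
  proof (cases "s = 0")
    case False
    then have "s * ((M *v x) \<bullet> x) > 0" using s assms[OF x(1)] by simp
    moreover have "(1 - s) * (x \<bullet> x) \<ge> 0" using s by simp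
    ultimately show ?thesis by linarith
  qed (use x in auto)
  finally show False by simp
qed

lemma det_gram_pos:
  assumes "linear f" "inj f"
  shows "det (gram f) > 0"
proof (rule det_pos_definite)
  fix x :: "real ^ 'a" assume "x \<noteq> 0"
  then have "f x \<noteq> 0" using assms linear_injective_0 by blast
  then show "(gram f *v x) \<bullet> x > 0" by (simp add: gram_inner[OF assms(1)])
qed

section \<open>Oriented normals of a linear frame\<close>

definition frame :: "(real ^ 'm::finite \<Rightarrow> real ^ 'm option) \<Rightarrow> real ^ 'm option \<Rightarrow> real ^ 'm option ^ 'm option" where
  "frame f v = (\<chi> r c. (case c of None \<Rightarrow> v | Some j \<Rightarrow> f (axis j 1)) $ r)"

lemma frame_matrix_eq: "frame_matrix \<psi> u v = frame (Der \<psi> u) v"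
  by (simp add: frame_matrix_def frame_def)

text \<open>The generalised cross product of the images of the axes, i.e. the vector that represents
  the linear functional \<open>v \<mapsto> det (frame f v)\<close>. It is polynomial in
  \<open>f\<close>, which makes the regularity of the normal visible.\<close>

definition normal_vec :: "(real ^ 'm::finite \<Rightarrow> real ^ 'm option) \<Rightarrow> real ^ 'm option" where
  "normal_vec f = (\<chi> r. det (frame f (axis r 1)))"

lemma det_frame_linear: "linear (\<lambda>v. det (frame f v))"
proof -
  have tr: "det (frame f v) = det (\<chi> c. if c = None then v else (case c of None \<Rightarrow> v | Some j \<Rightarrow> f (axis j 1)))" for v
  proof -
    have "transpose (frame f v) = (\<chi> c. if c = None then v else (case c of None \<Rightarrow> v | Some j \<Rightarrow> f (axis j 1)))"
      by (auto simp: transpose_def frame_def vec_eq_iff split: option.splits)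
    then show ?thesis by (metis det_transpose)
  qed
  \<comment> \<open>The value of the second branch at \<open>None\<close> is never read, so it may
    be set to \<open>0\<close>. That branch then no longer depends on \<open>v\<close>, and
    multilinearity in the row \<open>None\<close> applies.\<close>
  have tr': "det (frame f v) = det (\<chi> c. if c = None then v else (case c of None \<Rightarrow> 0 | Some j \<Rightarrow> f (axis j 1)))" for v
    unfolding tr by (rule arg_cong[where f=det]) (auto simp: vec_eq_iff split: option.splits)
  show ?thesis
    unfolding tr'
    using det_row_add[of None "\<lambda>_. _" "\<lambda>_. _" "\<lambda>c. case c of None \<Rightarrow> 0 | Some j \<Rightarrow> f (axis j 1)"]
      det_row_mul[where k = None and a = "\<lambda>_. _" and b = "\<lambda>c. case c of None \<Rightarrow> 0 | Some j \<Rightarrow> f (axis j 1)", unfolded scalar_mult_eq_scaleR]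
    by (intro linearI) simp_all
qed

lemma det_frame: "det (frame f v) = normal_vec f \<bullet> v"
  by (subst linear_vec_sum[OF det_frame_linear]) (simp add: normal_vec_def inner_vec_def mult.commute)

lemma normal_vec_orth:
  assumes "linear f"
  shows "normal_vec f \<bullet> f v = 0"
proof -
  have "det (frame f (f (axis j 1))) = 0" for j
    by (rule det_identical_columns[of None "Some j"]) (auto simp: frame_def column_def)
  then have "normal_vec f \<bullet> f (axis j 1) = 0" for j by (simp add: det_frame)
  then show ?thesis by (subst linear_vec_sum[OF assms]) (simp add: inner_sum_right)
qed

lemma frame_mult:
  assumes "linear f"
  shows "frame f v *v z = z $ None *\<^sub>R v + f (\<chi> j. z $ Some j)"
proof -
  have "(\<Sum>c\<in>UNIV. (case c of None \<Rightarrow> v | Some j \<Rightarrow> f (axis j 1)) $ r * z $ c)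
      = v $ r * z $ None + (\<Sum>j\<in>UNIV. f (axis j 1) $ r * z $ Some j)" for r
    by (simp add: UNIV_option_conv sum.reindex)
  then show ?thesis
    by (subst linear_vec_sum[OF assms]) (simp add: vec_eq_iff matrix_vector_mult_def frame_def mult.commute)
qed

text \<open>A kernel vector is a linear relation between \<open>v\<close> and the images of the
  axes. Its coefficient at \<open>v\<close> must vanish because \<open>v\<close> is not in the
  range, and the rest vanishes by injectivity.\<close>

lemma det_frame_nonzero:
  assumes "linear f" "inj f" "v \<notin> range f"
  shows "det (frame f v) \<noteq> 0"
proof
  assume "det (frame f v) = 0"
  then obtain z where z: "z \<noteq> 0" "frame f v *v z = 0"
    by (metis det_eq_0_kernel)
  let ?z = "\<chi> j. z $ Some j"
  have e: "z $ None *\<^sub>R v + f ?z = 0" using z frame_mult[OF assms(1)] by metis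
  have "z $ None = 0"
  proof (rule ccontr)
    assume n: "z $ None \<noteq> 0"
    have "f ((- 1 / z $ None) *\<^sub>R ?z) = (- 1 / z $ None) *\<^sub>R f ?z"
      by (rule linear_cmul[OF assms(1)])
    also have "f ?z = - (z $ None *\<^sub>R v)" using e by (metis add.inverse_unique)
    also have "(- 1 / z $ None) *\<^sub>R - (z $ None *\<^sub>R v) = v" using n by simp
    finally have "v \<in> range f" by (metis rangeI)
    then show False using assms(3) by blast
  qed
  then have "f ?z = 0" using e by simp
  then have "?z = 0" using linear_injective_0[OF assms(1)] assms(2) by blast
  then have "z $ Some j = 0" for j by (simp add: vec_eq_iff)
  then have "z $ c = 0" for c using \<open>z $ None = 0\<close> by (cases c) auto
  then have "z = 0" by (simp add: vec_eq_iff)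
  then show False using z by simp
qed

text \<open>The range has dimension at most \<open>CARD('m)\<close> in a space of one dimension
  more, so some \<open>v\<close> lies outside it, and at this \<open>v\<close> the functional
  represented by \<open>normal_vec f\<close> is nonzero.\<close>

lemma normal_vec_nonzero:
  fixes f :: "real ^ 'm::finite \<Rightarrow> real ^ 'm option"
  assumes "linear f" "inj f"
  shows "normal_vec f \<noteq> 0"
proof -
  have "dim (range f) \<le> DIM(real ^ 'm)"
    using dim_image_le[OF assms(1), of UNIV] by simp
  then have "dim (range f) < DIM(real ^ 'm option)" by (simp add: card_UNIV_option)
  then have "range f \<noteq> UNIV" by auto
  then obtain v where "v \<notin> range f" by auto
  from det_frame_nonzero[OF assms this] show ?thesis by (auto simp: det_frame)
qed

definition unit_normal :: "(real ^ 'm::finite \<Rightarrow> real ^ 'm option) \<Rightarrow> real ^ 'm option" where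
  "unit_normal f = inverse (norm (normal_vec f)) *\<^sub>R normal_vec f"

lemma unit_normal_props:
  assumes "linear f" "inj f"
  shows "norm (unit_normal f) = 1" "unit_normal f \<bullet> f v = 0" "f v \<bullet> unit_normal f = 0"
    "unit_normal f \<bullet> unit_normal f = 1" "det (frame f (unit_normal f)) > 0"
proof -
  let ?N = "normal_vec f"
  have N: "norm ?N \<noteq> 0" using normal_vec_nonzero[OF assms] by simp
  then show n: "norm (unit_normal f) = 1" by (simp add: unit_normal_def)
  then show "unit_normal f \<bullet> unit_normal f = 1" by (simp add: norm_eq_1)
  show "unit_normal f \<bullet> f v = 0" using normal_vec_orth[OF assms(1)] by (simp add: unit_normal_def)
  then show "f v \<bullet> unit_normal f = 0" by (simp add: inner_commute)
  have "det (frame f (unit_normal f)) = inverse (norm ?N) * (?N \<bullet> ?N)"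
    by (simp add: det_frame unit_normal_def)
  also have "\<dots> > 0" using N by simp
  finally show "det (frame f (unit_normal f)) > 0" .
qed

lemma frame_decomp:
  assumes "linear f" "inj f"
  shows "\<exists>z. v = (v \<bullet> unit_normal f) *\<^sub>R unit_normal f + f z"
proof -
  note n = unit_normal_props[OF assms]
  have "invertible (frame f (unit_normal f))" using n(5) by (simp add: invertible_det_nz)
  then obtain y where y: "frame f (unit_normal f) *v y = v"
    by (metis invertible_def matrix_vector_mul_assoc matrix_vector_mul_lid)
  then have v: "v = y $ None *\<^sub>R unit_normal f + f (\<chi> j. y $ Some j)"
    by (simp add: frame_mult[OF assms(1)])
  have "v \<bullet> unit_normal f = y $ None"
    by (subst v) (simp add: inner_add_left n)
  with v show ?thesis by metis
qed

text \<open>The tangential component \<open>f z\<close> of \<open>\<nu>\<close> has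
  \<open>f z \<bullet> f z = \<nu> \<bullet> f z = 0\<close>.\<close>

lemma orth_unit_eq_normal:
  assumes "linear f" "inj f" "\<And>v. \<nu> \<bullet> f v = 0"
  shows "\<nu> = (\<nu> \<bullet> unit_normal f) *\<^sub>R unit_normal f"
proof -
  note n = unit_normal_props[OF assms(1,2)]
  obtain z where z: "\<nu> = (\<nu> \<bullet> unit_normal f) *\<^sub>R unit_normal f + f z"
    using frame_decomp[OF assms(1,2)] by blast
  have "\<nu> \<bullet> f z = f z \<bullet> f z"
    by (subst z) (simp add: inner_add_left n)
  then have "f z = 0" using assms(3) by simp
  with z show ?thesis by simp
qed

text \<open>Orthogonality leaves a multiple of the unit normal; the norm fixes the absolute value of
  the factor, and linearity of the determinant in the column of \<open>\<nu>\<close> fixes its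
  sign.\<close>

lemma unit_normal_unique:
  assumes "linear f" "inj f" "norm \<nu> = 1" "\<And>v. \<nu> \<bullet> f v = 0" "det (frame f \<nu>) > 0"
  shows "\<nu> = unit_normal f"
proof -
  let ?c = "\<nu> \<bullet> unit_normal f"
  have nu: "\<nu> = ?c *\<^sub>R unit_normal f" using orth_unit_eq_normal[OF assms(1,2,4)] .
  have "det (frame f \<nu>) = ?c * det (frame f (unit_normal f))"
    by (subst nu) (simp add: det_frame)
  then have "?c > 0" using assms(5) unit_normal_props(5)[OF assms(1,2)]
    by (simp add: zero_less_mult_iff)
  moreover have "\<bar>?c\<bar> = 1"
    using assms(3) unit_normal_props(1)[OF assms(1,2)] by (metis mult.right_neutral norm_scaleR nu)
  ultimately show ?thesis using nu by simp
qed

text \<open>Trades the description by \<open>THE\<close> for a formula in the first derivatives,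
  which can be differentiated.\<close>

lemma oriented_unit_normal_eq:
  assumes "linear (Der \<psi> u)" "inj (Der \<psi> u)"
  shows "oriented_unit_normal \<psi> u = unit_normal (Der \<psi> u)"
  unfolding oriented_unit_normal_def frame_matrix_eq
proof (rule the_equality)
  show "\<nu> = unit_normal (Der \<psi> u)"
    if "norm \<nu> = 1 \<and> (\<forall>v. \<nu> \<bullet> Der \<psi> u v = 0)
      \<and> det (frame (Der \<psi> u) \<nu>) > 0" for \<nu>
    by (rule unit_normal_unique[OF assms]) (use that in auto)
qed (use unit_normal_props[OF assms] in auto)

text \<open>Cramer's rule makes the smooth dependence of the inverse on the matrix visible; when
  \<open>det M = 0\<close> the value is junk.\<close>

definition cramer_inverse :: "real ^ 'm::finite ^ 'm \<Rightarrow> real ^ 'm ^ 'm" where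
  "cramer_inverse M = (\<chi> k j. det (\<chi> i l. if l = k then axis j 1 $ i else M $ i $ l) / det M)"

lemma cramer_inverse_right:
  assumes "det M \<noteq> 0"
  shows "M ** cramer_inverse M = mat 1"
proof -
  have "M *v (\<chi> k. det (\<chi> i l. if l = k then axis j 1 $ i else M $ i $ l) / det M) = axis j 1" for j
    using cramer[OF assms] by blast
  moreover have "column j (cramer_inverse M) = (\<chi> k. det (\<chi> i l. if l = k then axis j 1 $ i else M $ i $ l) / det M)" for j
    by (simp add: cramer_inverse_def column_def)
  ultimately have "M *v column j (cramer_inverse M) = axis j 1" for j by simp
  then have "(M *v column j (cramer_inverse M)) $ i = axis j 1 $ i" for i j by simp
  then show ?thesis
    by (simp add: vec_eq_iff matrix_matrix_mult_def matrix_vector_mult_def column_def mat_def axis_def cong: if_cong)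
qed

lemma cramer_inverse_left: "det M \<noteq> 0 \<Longrightarrow> cramer_inverse M ** M = mat 1"
  using cramer_inverse_right matrix_left_right_inverse by blast

section \<open>Local geometry of a hypersurface patch\<close>

lemma has_derivative_det_at_id:
  fixes Y :: "'e::real_normed_vector \<Rightarrow> real ^ 'n::finite ^ 'n"
  assumes d: "\<And>i j. ((\<lambda>u. Y u $ i $ j) has_derivative Y' i j) (at u)" and Y: "Y u = mat 1"
  shows "((\<lambda>u. det (Y u)) has_derivative (\<lambda>v. \<Sum>i\<in>UNIV. Y' i i v)) (at u)"
proof -
  let ?D = "\<lambda>p v. of_int (sign p) * (\<Sum>i\<in>UNIV. Y' i (p i) v * (\<Prod>j\<in>UNIV - {i}. Y u $ j $ p j))"
  have "((\<lambda>u. det (Y u)) has_derivative (\<lambda>v. \<Sum>p\<in>{p. p permutes UNIV}. ?D p v)) (at u)"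
    unfolding det_def
    by (intro has_derivative_sum has_derivative_mult_right has_derivative_prod d)
  moreover have "(\<Sum>p\<in>{p. p permutes UNIV}. ?D p v) = (\<Sum>i\<in>UNIV. Y' i i v)" for v
  proof -
    \<comment> \<open>A permutation other than the identity moves at least two indices.
      Differentiating one factor of its product leaves another off-diagonal entry of the identity
      matrix, which is \<open>0\<close>.\<close>
    have "?D p v = 0" if p: "p permutes UNIV" "p \<noteq> id" for p
    proof -
      have "(\<Prod>j\<in>UNIV - {i}. Y u $ j $ p j) = 0" for i
      proof -
        have "\<exists>j. j \<noteq> i \<and> p j \<noteq> j"
        proof (rule ccontr)
          assume "\<not> ?thesis"
          then have fixp: "p j = j" if "j \<noteq> i" for j using that by blast
          then have "p i = i" using permutes_inj[OF p(1)] by (metis injD)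
          with fixp have "p x = id x" for x by (cases "x = i") auto
          then have "p = id" by (rule ext)
          with p show False by simp
        qed
        then obtain j where j: "j \<noteq> i" "p j \<noteq> j" by blast
        then have "Y u $ j $ p j = 0" by (simp add: Y mat_def)
        then show ?thesis using j by (intro prod_zero) auto
      qed
      then show ?thesis by (simp only: mult_zero_right sum.neutral_const)
    qed
    then have "(\<Sum>p\<in>{p. p permutes UNIV}. ?D p v) = (\<Sum>p\<in>{id}. ?D p v)"
      by (intro sum.mono_neutral_right) (auto simp: permutes_id)
    then show ?thesis by (simp add: Y mat_def)
  qed
  ultimately show ?thesis by simp
qed

text \<open>Multiplying by the inverse of \<open>M u\<close> moves the base point to the identity
  matrix, where only the trace survives; the factor \<open>det (M u)\<close> restores the original
  determinant by multiplicativity.\<close>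

lemma jacobi_formula:
  fixes M :: "real ^ 'm::finite \<Rightarrow> real ^ 'n::finite ^ 'n"
  assumes d: "\<And>i j. ((\<lambda>u. M u $ i $ j) has_derivative M' i j) (at u)" and nz: "det (M u) \<noteq> 0"
  shows "((\<lambda>u. det (M u)) has_derivative
    (\<lambda>v. det (M u) * (\<Sum>i\<in>UNIV. \<Sum>j\<in>UNIV. cramer_inverse (M u) $ i $ j * M' j i v))) (at u)"
proof -
  let ?N = "cramer_inverse (M u)"
  have "((\<lambda>y. (?N ** M y) $ i $ k) has_derivative (\<lambda>v. \<Sum>j\<in>UNIV. ?N $ i $ j * M' j k v)) (at u)" for i k
    unfolding matrix_matrix_mult_def vec_lambda_beta
    by (intro has_derivative_sum has_derivative_mult_right d)
  then have "((\<lambda>y. det (?N ** M y)) has_derivative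
      (\<lambda>v. \<Sum>i\<in>UNIV. \<Sum>j\<in>UNIV. ?N $ i $ j * M' j i v)) (at u)"
    by (rule has_derivative_det_at_id) (rule cramer_inverse_left[OF nz])
  then have "((\<lambda>y. det (M u) * det (?N ** M y)) has_derivative
      (\<lambda>v. det (M u) * (\<Sum>i\<in>UNIV. \<Sum>j\<in>UNIV. ?N $ i $ j * M' j i v))) (at u)"
    by (rule has_derivative_mult_right)
  moreover have "det (M u) * det (?N ** M y) = det (M y)" for y
  proof -
    have "det (M u) * det ?N = 1"
      using cramer_inverse_right[OF nz] by (metis det_mul det_I)
    then show ?thesis by (simp add: det_mul)
  qed
  ultimately show ?thesis by simp
qed

abbreviation metric :: "(real ^ 'm::finite \<Rightarrow> real ^ 'm option) \<Rightarrow> real ^ 'm \<Rightarrow> real ^ 'm ^ 'm" where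
  "metric \<psi> u \<equiv> gram (Der \<psi> u)"

abbreviation inv_metric :: "(real ^ 'm::finite \<Rightarrow> real ^ 'm option) \<Rightarrow> real ^ 'm \<Rightarrow> real ^ 'm ^ 'm" where
  "inv_metric \<psi> u \<equiv> cramer_inverse (metric \<psi> u)"

abbreviation nrm :: "(real ^ 'm::finite \<Rightarrow> real ^ 'm option) \<Rightarrow> real ^ 'm \<Rightarrow> real ^ 'm option" where
  "nrm \<psi> u \<equiv> unit_normal (Der \<psi> u)"

definition mean_curv :: "(real ^ 'm::finite \<Rightarrow> real ^ 'm option) \<Rightarrow> real ^ 'm \<Rightarrow> real" where
  "mean_curv \<psi> u = trace (matrix (shape_operator \<psi> u))"

lemma area_density_eq: "area_density \<psi> u = sqrt (det (metric \<psi> u))"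
  by (simp add: area_density_def first_form_def gram_def)

text \<open>The contravariant components of \<open>d\<xi>\<close>, weighted by the area density of \<open>\<psi>\<close>: its
  coordinate divergence is the Laplace-Beltrami operator.\<close>

definition flux :: "(real ^ 'm::finite \<Rightarrow> real ^ 'm option) \<Rightarrow> (real ^ 'm \<Rightarrow> real ^ 'm option)
    \<Rightarrow> 'm \<Rightarrow> real ^ 'm \<Rightarrow> real ^ 'm option" where
  "flux \<psi> \<xi> i u = (\<Sum>j\<in>UNIV. (area_density \<psi> u * inv_metric \<psi> u $ i $ j) *\<^sub>R pd j \<xi> u)"

text \<open>Two derivatives of the parametrisation make the normal and the weighted gradient
  \<open>flux\<close> of class C^1, which is the regularity that the divergence theorem asks
  for.\<close>

locale patch =
  fixes \<Omega> :: "(real ^ 'm::finite) set" and \<psi> :: "real ^ 'm \<Rightarrow> real ^ 'm option"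
  assumes open_dom: "open \<Omega>" and C2: "Ck_on (Suc (Suc 0)) \<Omega> \<psi>"
    and inj: "\<And>u. u \<in> \<Omega> \<Longrightarrow> inj (Der \<psi> u)"
begin

lemma C1_psi: "C1_on \<Omega> \<psi>" and C1_dpsi: "C1_on \<Omega> (\<lambda>u. Der \<psi> u v)"
  using C2_onD[OF C2] by auto

lemma lin: "u \<in> \<Omega> \<Longrightarrow> linear (Der \<psi> u)"
  using C1_on_has_derivative[OF C1_psi] has_derivative_linear by blast

lemma C1_metric: "C1_on \<Omega> (\<lambda>u. metric \<psi> u $ i $ j)"
  unfolding gram_def vec_lambda_beta by (intro C1_on_inner C1_dpsi)

lemma det_pos: "u \<in> \<Omega> \<Longrightarrow> det (metric \<psi> u) > 0"
  by (intro det_gram_pos lin inj)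

lemma area_pos: "u \<in> \<Omega> \<Longrightarrow> area_density \<psi> u > 0"
  by (simp add: area_density_eq det_pos)

lemma C1_area: "C1_on \<Omega> (area_density \<psi>)"
  unfolding area_density_eq[abs_def] by (intro C1_on_sqrt C1_on_det C1_metric det_pos)

lemma C1_inv_metric: "C1_on \<Omega> (\<lambda>u. inv_metric \<psi> u $ i $ j)"
proof -
  have "C1_on \<Omega> (\<lambda>u. if l = i then axis j 1 $ k else metric \<psi> u $ k $ l)" for k l
    by (cases "l = i") (simp_all add: C1_on_const C1_metric)
  then show ?thesis
    unfolding cramer_inverse_def vec_lambda_beta
    by (intro C1_on_divide C1_on_det) (simp_all add: C1_metric det_pos less_imp_neq[symmetric])
qed

lemma inv_metric_mult:
  assumes "u \<in> \<Omega>"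
  shows "metric \<psi> u ** inv_metric \<psi> u = mat 1" "inv_metric \<psi> u ** metric \<psi> u = mat 1"
proof -
  have "det (metric \<psi> u) \<noteq> 0" using det_pos[OF assms] by simp
  then show "metric \<psi> u ** inv_metric \<psi> u = mat 1" "inv_metric \<psi> u ** metric \<psi> u = mat 1"
    by (rule cramer_inverse_right, rule cramer_inverse_left)
qed

lemma inv_metric_sym:
  assumes "u \<in> \<Omega>"
  shows "inv_metric \<psi> u $ i $ j = inv_metric \<psi> u $ j $ i"
proof -
  let ?g = "metric \<psi> u" and ?h = "inv_metric \<psi> u"
  have "transpose ?g = ?g"
    by (simp only: transpose_def vec_eq_iff vec_lambda_beta) (intro allI gram_sym)
  then have "transpose ?h ** ?g = mat 1"
    using matrix_transpose_mul[of ?g ?h] inv_metric_mult(1)[OF assms] by (simp add: transpose_mat)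
  then have "(transpose ?h ** ?g) ** ?h = ?h" by simp
  then have "transpose ?h = ?h"
    by (simp add: matrix_mul_assoc[symmetric] inv_metric_mult(1)[OF assms])
  then have "transpose ?h $ j $ i = ?h $ j $ i" by simp
  then show ?thesis by (simp add: transpose_def)
qed

lemma C1_normal: "C1_on \<Omega> (nrm \<psi>)"
proof -
  have N: "C1_on \<Omega> (\<lambda>u. normal_vec (Der \<psi> u))"
  proof -
    have "C1_on \<Omega> (\<lambda>u. (case c of None \<Rightarrow> axis k 1 | Some j \<Rightarrow> pd j \<psi> u) $ r)" for r c k
      by (cases c) (simp_all add: C1_on_const C1_on_vec_nth C1_dpsi)
    then show ?thesis
      unfolding normal_vec_def frame_def by (intro C1_on_vec C1_on_det) simp
  qed
  have "C1_on \<Omega> (\<lambda>u. sqrt (normal_vec (Der \<psi> u) \<bullet> normal_vec (Der \<psi> u)))"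
    by (intro C1_on_sqrt C1_on_inner N) (simp add: normal_vec_nonzero lin inj)
  then have "C1_on \<Omega> (\<lambda>u. norm (normal_vec (Der \<psi> u)))"
    by (simp add: norm_eq_sqrt_inner)
  then show ?thesis
    unfolding unit_normal_def
    by (intro C1_on_scaleR C1_on_inverse N) (simp_all add: normal_vec_nonzero lin inj)
qed

lemmas normal = unit_normal_props[OF lin inj]

abbreviation "dnormal u \<equiv> Der (nrm \<psi>) u"

lemma second_sym:
  "u \<in> \<Omega> \<Longrightarrow> Der (\<lambda>y. Der \<psi> y v) u w
     = Der (\<lambda>y. Der \<psi> y w) u v"
  by (rule second_derivative_symmetric[OF open_dom C2])

lemma has_derivative_const_on:
  fixes h :: "real ^ 'm \<Rightarrow> real"
  assumes "u \<in> \<Omega>" "\<And>y. y \<in> \<Omega> \<Longrightarrow> h y = c" "(h has_derivative h') (at u)"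
  shows "h' v = 0"
proof -
  have "((\<lambda>y. c) has_derivative h') (at u)"
    using has_derivative_transform_within_open[OF assms(3) open_dom assms(1)] assms(2) by auto
  then have "h' = (\<lambda>v. 0)" using has_derivative_unique has_derivative_const by blast
  then show ?thesis by simp
qed

section \<open>Shape operator and mean curvature of a patch\<close>

lemma dnormal_orth:
  assumes u: "u \<in> \<Omega>"
  shows "dnormal u w \<bullet> nrm \<psi> u = 0"
proof -
  note d = C1_on_has_derivative[OF C1_normal u]
  have "nrm \<psi> u \<bullet> dnormal u w + dnormal u w \<bullet> nrm \<psi> u = 0"
    by (rule has_derivative_const_on[OF u _ has_derivative_inner[OF d d], where c = 1])
      (rule normal(4))
  then show ?thesis by (simp add: inner_commute)
qed

text \<open>The derivative in direction \<open>w\<close> of the relation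
  \<open>nrm \<psi> y \<bullet> Der \<psi> y v = 0\<close>.\<close>

lemma dnormal_second:
  assumes u: "u \<in> \<Omega>"
  shows "dnormal u w \<bullet> Der \<psi> u v
     = - (nrm \<psi> u \<bullet> Der (\<lambda>y. Der \<psi> y v) u w)"
proof -
  note d = C1_on_has_derivative[OF C1_normal u] C1_on_has_derivative[OF C1_dpsi u, of v]
  have "nrm \<psi> u \<bullet> Der (\<lambda>y. Der \<psi> y v) u w
      + dnormal u w \<bullet> Der \<psi> u v = 0"
    by (rule has_derivative_const_on[OF u _ has_derivative_inner[OF d], where c = 0])
      (rule normal(2))
  then show ?thesis by simp
qed

text \<open>A tangential \<open>w\<close> is \<open>Der \<psi> u z\<close>; its products with the
  coordinate tangent vectors form \<open>metric \<psi> u *v z\<close>, from which the inverse metric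
  recovers \<open>z\<close>.\<close>

lemma tangent_coords:
  assumes u: "u \<in> \<Omega>" and w: "w \<bullet> nrm \<psi> u = 0"
  shows "Der \<psi> u (inv_metric \<psi> u *v (\<chi> j. pd j \<psi> u \<bullet> w)) = w"
proof -
  obtain z where z: "w = Der \<psi> u z"
    using frame_decomp[OF lin[OF u] inj[OF u], of w] w by auto
  have "(\<chi> j. pd j \<psi> u \<bullet> w) = metric \<psi> u *v z"
    by (simp add: z gram_mult[OF lin[OF u]])
  then show ?thesis
    by (simp add: z matrix_vector_mul_assoc inv_metric_mult[OF u])
qed

lemma oriented_unit_normal_nrm: "u \<in> \<Omega> \<Longrightarrow> oriented_unit_normal \<psi> u = nrm \<psi> u"
  by (rule oriented_unit_normal_eq[OF lin inj])

lemma doriented_unit_normal: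
  "u \<in> \<Omega> \<Longrightarrow> Der (oriented_unit_normal \<psi>) u = dnormal u"
  by (rule frechet_derivative_cong_open[OF open_dom _ oriented_unit_normal_nrm])

lemma linear_dnormal: "u \<in> \<Omega> \<Longrightarrow> linear (dnormal u)"
  using C1_on_has_derivative[OF C1_normal] has_derivative_linear by blast

lemma shape_operator_eqI:
  assumes u: "u \<in> \<Omega>" and "linear B" "\<And>v. Der \<psi> u (B v) = - dnormal u v"
  shows "shape_operator \<psi> u = B"
  unfolding shape_operator_def doriented_unit_normal[OF u]
proof (rule the_equality)
  show "B' = B" if "linear B' \<and> (\<forall>v. Der \<psi> u (B' v) = - dnormal u v)" for B'
    using that assms(3) inj[OF u] by (metis ext injD)
qed (use assms in auto)

text \<open>The derivative of the normal is tangential, so \<open>tangent_coords\<close> gives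
  explicit coordinates for its preimage, and injectivity makes this the operator described by
  \<open>THE\<close>.\<close>

lemma shape_operator_props:
  assumes u: "u \<in> \<Omega>"
  shows "shape_operator \<psi> u v = inv_metric \<psi> u *v (\<chi> j. pd j \<psi> u \<bullet> - dnormal u v)"
    "linear (shape_operator \<psi> u)"
    "Der \<psi> u (shape_operator \<psi> u v) = - dnormal u v"
proof -
  let ?B = "\<lambda>v. inv_metric \<psi> u *v (\<chi> j. pd j \<psi> u \<bullet> - dnormal u v)"
  have "linear (\<lambda>v. \<chi> j. pd j \<psi> u \<bullet> - dnormal u v)"
    using linear_dnormal[OF u]
    by (intro linearI) (simp_all add: linear_add linear_cmul vec_eq_iff inner_add_right inner_diff_right)
  then have l: "linear ?B"
    using linear_compose[OF _ matrix_vector_mul_linear] by (simp add: o_def)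
  have e: "Der \<psi> u (?B v) = - dnormal u v" for v
    by (rule tangent_coords[OF u]) (simp add: dnormal_orth[OF u])
  have "shape_operator \<psi> u = ?B" by (rule shape_operator_eqI[OF u l e])
  with l e show "shape_operator \<psi> u v = ?B v" "linear (shape_operator \<psi> u)"
    "Der \<psi> u (shape_operator \<psi> u v) = - dnormal u v" by auto
qed

lemma mean_curv_dnormal:
  assumes u: "u \<in> \<Omega>"
  shows "mean_curv \<psi> u
    = - (\<Sum>i\<in>UNIV. \<Sum>j\<in>UNIV. inv_metric \<psi> u $ i $ j * (pd j \<psi> u \<bullet> dnormal u (axis i 1)))"
  by (simp add: mean_curv_def trace_def matrix_def shape_operator_props(1)[OF u]
      matrix_vector_mult_def sum_negf)

text \<open>This form involves no derivative of the normal: for the moving immersion it bounds the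
  mean curvature by second derivatives of the parametrisation.\<close>

lemma mean_curv_second:
  assumes u: "u \<in> \<Omega>"
  shows "mean_curv \<psi> u
    = (\<Sum>i\<in>UNIV. \<Sum>j\<in>UNIV. inv_metric \<psi> u $ i $ j * (nrm \<psi> u \<bullet> pd i (pd j \<psi>) u))"
  by (simp add: mean_curv_dnormal[OF u] inner_commute[of _ "dnormal u _"] dnormal_second[OF u] sum_negf)

section \<open>The Laplacian of the position vector\<close>

lemma flux_C1:
  assumes "Ck_on (Suc (Suc 0)) \<Omega> \<xi>"
  shows "C1_on \<Omega> (flux \<psi> \<xi> i)"
  unfolding flux_def[abs_def]
  by (intro C1_on_sum C1_on_scaleR C1_on_mult C1_area C1_inv_metric C2_onD(2)[OF assms])

text \<open>Up to the factor \<open>area_density \<psi> u\<close>, the vectors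
  \<open>flux \<psi> \<psi> i u\<close> are the tangent basis dual to the coordinate one.\<close>

lemma flux_tangent:
  assumes u: "u \<in> \<Omega>"
  shows "flux \<psi> \<psi> i u \<bullet> pd k \<psi> u = (if i = k then area_density \<psi> u else 0)"
proof -
  have "flux \<psi> \<psi> i u \<bullet> pd k \<psi> u = area_density \<psi> u * (inv_metric \<psi> u ** metric \<psi> u) $ i $ k"
    by (simp add: flux_def inner_sum_left matrix_matrix_mult_def gram_def sum_distrib_left mult_ac)
  then show ?thesis by (simp add: inv_metric_mult[OF u] mat_def)
qed

lemma flux_normal: "u \<in> \<Omega> \<Longrightarrow> flux \<psi> \<psi> i u \<bullet> nrm \<psi> u = 0"
  by (simp add: flux_def inner_sum_left normal)

text \<open>Jacobi's formula for the determinant of the metric. The derivative of each metric entry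
  has two terms, which contribute equally because the inverse metric is symmetric; the resulting
  \<open>2\<close> cancels the \<open>1 / 2\<close> from the square root. Commuting second
  derivatives gives the form that matches the product rule in
  \<open>laplace_beltrami\<close>.\<close>

lemma area_derivative:
  assumes u: "u \<in> \<Omega>"
  shows "pd k (area_density \<psi>) u = (\<Sum>i\<in>UNIV. flux \<psi> \<psi> i u \<bullet> pd i (pd k \<psi>) u)"
proof -
  let ?A = "area_density \<psi> u" and ?g = "inv_metric \<psi> u" and ?e = "axis k 1 :: real ^ 'm"
  have dg: "((\<lambda>u. metric \<psi> u $ i $ j) has_derivative
     (\<lambda>v. pd i \<psi> u \<bullet> Der (pd j \<psi>) u v
        + Der (pd i \<psi>) u v \<bullet> pd j \<psi> u)) (at u)" for i j
    unfolding gram_def vec_lambda_beta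
    by (intro has_derivative_inner C1_on_has_derivative[OF C1_dpsi u])
  let ?J = "\<lambda>v. \<Sum>i\<in>UNIV. \<Sum>j\<in>UNIV. ?g $ i $ j * (pd j \<psi> u \<bullet> Der (pd i \<psi>) u v
        + Der (pd j \<psi>) u v \<bullet> pd i \<psi> u)"
  have "((\<lambda>u. det (metric \<psi> u)) has_derivative (\<lambda>v. det (metric \<psi> u) * ?J v)) (at u)"
    by (rule jacobi_formula[OF dg]) (use det_pos[OF u] in simp)
  moreover have "(sqrt has_derivative (*) (inverse ?A / 2)) (at (det (metric \<psi> u)))"
    using DERIV_real_sqrt[OF det_pos[OF u]] by (simp add: has_field_derivative_def area_density_eq)
  ultimately have "((\<lambda>u. sqrt (det (metric \<psi> u))) has_derivative
      (\<lambda>v. inverse ?A / 2 * (det (metric \<psi> u) * ?J v))) (at u)"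
    by (rule has_derivative_compose)
  then have "(area_density \<psi> has_derivative (\<lambda>v. inverse ?A / 2 * (det (metric \<psi> u) * ?J v))) (at u)"
    by (simp add: area_density_eq[abs_def])
  then have "pd k (area_density \<psi>) u = inverse ?A / 2 * (det (metric \<psi> u) * ?J ?e)"
    by (simp add: frechet_derivative_at[symmetric])
  also have "det (metric \<psi> u) = ?A * ?A"
    using det_pos[OF u] by (simp add: area_density_eq)
  also have "inverse ?A / 2 * (?A * ?A * ?J ?e) = ?A * (?J ?e / 2)"
    using area_pos[OF u] by simp
  also have "?J ?e = 2 * (\<Sum>i\<in>UNIV. \<Sum>j\<in>UNIV. ?g $ i $ j * (pd j \<psi> u \<bullet> pd k (pd i \<psi>) u))"
  proof -
    have "(\<Sum>i\<in>UNIV. \<Sum>j\<in>UNIV. ?g $ i $ j * (pd k (pd j \<psi>) u \<bullet> pd i \<psi> u))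
        = (\<Sum>i\<in>UNIV. \<Sum>j\<in>UNIV. ?g $ i $ j * (pd j \<psi> u \<bullet> pd k (pd i \<psi>) u))"
      by (subst sum.swap) (simp add: inv_metric_sym[OF u] inner_commute)
    then show ?thesis by (simp add: distrib_left sum.distrib)
  qed
  also have "?A * (2 * (\<Sum>i\<in>UNIV. \<Sum>j\<in>UNIV. ?g $ i $ j * (pd j \<psi> u \<bullet> pd k (pd i \<psi>) u)) / 2)
      = (\<Sum>i\<in>UNIV. flux \<psi> \<psi> i u \<bullet> pd i (pd k \<psi>) u)"
    by (simp add: second_sym[OF u, of "axis k 1"] flux_def inner_sum_left sum_distrib_left mult_ac)
  finally show ?thesis .
qed

text \<open>Tangential and normal components of the divergence are read off by differentiating
  \<open>flux_tangent\<close> and \<open>flux_normal\<close> and summing over \<open>i\<close>;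
  Christoffel symbols never appear.\<close>

theorem laplace_beltrami:
  assumes u: "u \<in> \<Omega>"
  shows "(\<Sum>i\<in>UNIV. pd i (flux \<psi> \<psi> i) u) = (area_density \<psi> u * mean_curv \<psi> u) *\<^sub>R nrm \<psi> u"
proof -
  let ?L = "\<Sum>i\<in>UNIV. pd i (flux \<psi> \<psi> i) u"
  note df = C1_on_has_derivative[OF flux_C1[OF C2] u]
  have "pd k (area_density \<psi>) u = (\<Sum>i\<in>UNIV. flux \<psi> \<psi> i u \<bullet> pd i (pd k \<psi>) u) + ?L \<bullet> pd k \<psi> u" for k
  proof -
    have "pd i (\<lambda>y. if i = k then area_density \<psi> y else 0) u
        = flux \<psi> \<psi> i u \<bullet> pd i (pd k \<psi>) u + pd i (flux \<psi> \<psi> i) u \<bullet> pd k \<psi> u" for i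
    proof -
      have "Der (\<lambda>y. if i = k then area_density \<psi> y else 0) u
          = Der (\<lambda>y. flux \<psi> \<psi> i y \<bullet> pd k \<psi> y) u"
        by (rule frechet_derivative_cong_open[OF open_dom u]) (simp add: flux_tangent)
      also have "\<dots> = (\<lambda>v. flux \<psi> \<psi> i u \<bullet> Der (pd k \<psi>) u v
          + Der (flux \<psi> \<psi> i) u v \<bullet> pd k \<psi> u)"
        by (rule frechet_derivative_at[symmetric])
          (rule has_derivative_inner[OF df C1_on_has_derivative[OF C1_dpsi u]])
      finally show ?thesis by simp
    qed
    then have "(\<Sum>i\<in>UNIV. pd i (\<lambda>y. if i = k then area_density \<psi> y else 0) u)
        = (\<Sum>i\<in>UNIV. flux \<psi> \<psi> i u \<bullet> pd i (pd k \<psi>) u) + ?L \<bullet> pd k \<psi> u"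
      by (simp add: sum.distrib inner_sum_left)
    moreover have "pd i (\<lambda>y. if i = k then area_density \<psi> y else 0) u
        = (if i = k then pd k (area_density \<psi>) u else 0)" for i
      by simp
    ultimately show ?thesis by simp
  qed
  \<comment> \<open>By \<open>area_derivative\<close> the first sum is already the whole derivative
    of the area density, so nothing is left for the tangential part of the divergence.\<close>
  then have "?L \<bullet> pd k \<psi> u = 0" for k using area_derivative[OF u] by simp
  then have "?L \<bullet> Der \<psi> u v = 0" for v
    by (subst linear_vec_sum[OF lin[OF u]]) (simp add: inner_sum_right)
  then have "?L = (?L \<bullet> nrm \<psi> u) *\<^sub>R nrm \<psi> u"
    by (rule orth_unit_eq_normal[OF lin[OF u] inj[OF u]])
  moreover have "?L \<bullet> nrm \<psi> u = area_density \<psi> u * mean_curv \<psi> u"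
  proof -
    have "flux \<psi> \<psi> i u \<bullet> dnormal u (axis i 1) + pd i (flux \<psi> \<psi> i) u \<bullet> nrm \<psi> u = 0" for i
      by (rule has_derivative_const_on[OF u _ has_derivative_inner[OF df C1_on_has_derivative[OF C1_normal u]]])
        (rule flux_normal)
    then have "pd i (flux \<psi> \<psi> i) u \<bullet> nrm \<psi> u = - (flux \<psi> \<psi> i u \<bullet> dnormal u (axis i 1))" for i
      by (metis add.commute eq_neg_iff_add_eq_0)
    then have "?L \<bullet> nrm \<psi> u = - (\<Sum>i\<in>UNIV. flux \<psi> \<psi> i u \<bullet> dnormal u (axis i 1))"
      by (simp add: inner_sum_left sum_negf)
    also have "\<dots> = area_density \<psi> u * mean_curv \<psi> u"
      by (simp add: mean_curv_dnormal[OF u] flux_def inner_sum_left sum_distrib_left mult.assoc)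
    finally show ?thesis .
  qed
  ultimately show ?thesis by simp
qed

end

section \<open>Variation of the mean curvature between isometric patches\<close>

context patch
begin

definition second_form :: "real ^ 'm \<Rightarrow> real ^ 'm ^ 'm" where
  "second_form u = (\<chi> k i. - (pd k \<psi> u \<bullet> dnormal u (axis i 1)))"

text \<open>The second fundamental form with both indices raised, weighted by the area
  density.\<close>

definition raised_form :: "real ^ 'm \<Rightarrow> real ^ 'm ^ 'm" where
  "raised_form u = area_density \<psi> u *\<^sub>R (inv_metric \<psi> u ** second_form u ** inv_metric \<psi> u)"

text \<open>By \<open>dnormal_second\<close> the entries are normal components of second
  derivatives, which commute.\<close>

lemma second_form_sym:
  assumes "u \<in> \<Omega>"
  shows "transpose (second_form u) = second_form u"
proof -
  have "pd k \<psi> u \<bullet> dnormal u (axis i 1) = pd i \<psi> u \<bullet> dnormal u (axis k 1)" for i k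
    using dnormal_second[OF assms] second_sym[OF assms, of "axis k 1" "axis i 1"]
    by (simp add: inner_commute)
  then show ?thesis by (simp add: transpose_def second_form_def vec_eq_iff)
qed

lemma raised_form_sym:
  assumes u: "u \<in> \<Omega>"
  shows "raised_form u $ i $ j = raised_form u $ j $ i"
proof -
  have "transpose (inv_metric \<psi> u) = inv_metric \<psi> u"
    by (simp only: transpose_def vec_eq_iff vec_lambda_beta) (intro allI inv_metric_sym[OF u])
  then have "transpose (inv_metric \<psi> u ** second_form u ** inv_metric \<psi> u)
      = inv_metric \<psi> u ** second_form u ** inv_metric \<psi> u"
    by (simp add: matrix_transpose_mul second_form_sym[OF u] matrix_mul_assoc)
  then have "transpose (inv_metric \<psi> u ** second_form u ** inv_metric \<psi> u) $ j $ i
      = (inv_metric \<psi> u ** second_form u ** inv_metric \<psi> u) $ j $ i" by simp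
  then show ?thesis by (simp add: raised_form_def transpose_def)
qed

text \<open>Weingarten's equations: the derivative of the normal is tangential, and its components
  are the second form with one index raised.\<close>

lemma dnormal_coords:
  assumes u: "u \<in> \<Omega>"
  shows "dnormal u (axis i 1) = - (\<Sum>l\<in>UNIV. (inv_metric \<psi> u ** second_form u) $ l $ i *\<^sub>R pd l \<psi> u)"
proof -
  have "inv_metric \<psi> u *v (\<chi> j. pd j \<psi> u \<bullet> - dnormal u (axis i 1))
      = (\<chi> l. (inv_metric \<psi> u ** second_form u) $ l $ i)"
    by (simp add: matrix_vector_mult_def matrix_matrix_mult_def second_form_def)
  then have "- dnormal u (axis i 1)
      = Der \<psi> u (\<chi> l. (inv_metric \<psi> u ** second_form u) $ l $ i)"
    using tangent_coords[OF u, of "- dnormal u (axis i 1)"] dnormal_orth[OF u] by simp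
  then show ?thesis
    by (subst (asm) linear_vec_sum[OF lin[OF u]]) (simp add: minus_equation_iff[of "dnormal _ _"])
qed

lemma continuous_raised_form: "continuous_on \<Omega> (\<lambda>u. raised_form u $ i $ j)"
proof -
  note c = C1_on_imp_continuous_on
  show ?thesis
    unfolding raised_form_def matrix_matrix_mult_def second_form_def vec_lambda_beta
      vector_scaleR_component
    by (intro continuous_intros c[OF C1_area] c[OF C1_inv_metric] c[OF C1_dpsi]
        C1_on_continuous_derivative[OF C1_normal])
qed

end

locale isometric_pair = patch \<Omega> \<psi> + Q: patch \<Omega> \<psi>'
  for \<Omega> :: "(real ^ 'm::finite) set" and \<psi> \<psi>' :: "real ^ 'm \<Rightarrow> real ^ 'm option" +
  assumes metric_eq: "\<And>u. u \<in> \<Omega> \<Longrightarrow> metric \<psi>' u = metric \<psi> u"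
begin

lemma area_eq: "u \<in> \<Omega> \<Longrightarrow> area_density \<psi>' u = area_density \<psi> u"
  by (simp add: area_density_eq metric_eq)

text \<open>Isometry identifies the two Laplacians. The divergence of
  \<open>flux \<psi> \<psi>'\<close> can therefore be evaluated by the Laplace formula for
  \<open>\<psi>'\<close>, which brings in the mean curvature and the normal of
  \<open>\<psi>'\<close>.\<close>

lemma flux_eq: "u \<in> \<Omega> \<Longrightarrow> flux \<psi>' \<xi> i u = flux \<psi> \<xi> i u"
  by (simp add: flux_def area_eq metric_eq)

definition shift :: "'m \<Rightarrow> real ^ 'm \<Rightarrow> real ^ 'm option" where
  "shift j u = pd j \<psi>' u - pd j \<psi> u"

definition flux_shift :: "'m \<Rightarrow> real ^ 'm \<Rightarrow> real ^ 'm option" where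
  "flux_shift i u = flux \<psi> \<psi>' i u - flux \<psi> \<psi> i u"

lemma flux_shift_eq:
  "flux_shift i u = (\<Sum>j\<in>UNIV. (area_density \<psi> u * inv_metric \<psi> u $ i $ j) *\<^sub>R shift j u)"
  by (simp add: flux_shift_def flux_def shift_def sum_subtractf scaleR_diff_right)

lemma C1_flux_shift: "C1_on \<Omega> (flux_shift i)"
  unfolding flux_shift_def[abs_def] by (intro C1_on_diff flux_C1 C2 Q.C2)

text \<open>Polarisation of \<open>\<psi>'\<^sub>j \<bullet> \<psi>'\<^sub>l = \<psi>\<^sub>j \<bullet> \<psi>\<^sub>l\<close>: the symmetric part of the
  first-order variation is of second order.\<close>

lemma shift_polarised:
  assumes "u \<in> \<Omega>"
  shows "shift j u \<bullet> pd l \<psi> u + shift l u \<bullet> pd j \<psi> u = - (shift j u \<bullet> shift l u)"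
proof -
  have "metric \<psi>' u $ j $ l = metric \<psi> u $ j $ l" using metric_eq[OF assms] by simp
  then have "pd j \<psi>' u \<bullet> pd l \<psi>' u = pd j \<psi> u \<bullet> pd l \<psi> u" by (simp add: gram_def)
  then show ?thesis
    by (simp add: shift_def inner_diff_left inner_diff_right inner_commute)
qed

lemma flux_shift_dnormal:
  assumes u: "u \<in> \<Omega>"
  shows "(\<Sum>i\<in>UNIV. flux_shift i u \<bullet> dnormal u (axis i 1))
    = (\<Sum>l\<in>UNIV. \<Sum>j\<in>UNIV. raised_form u $ l $ j * (shift j u \<bullet> shift l u)) / 2"
proof -
  let ?g = "inv_metric \<psi> u" and ?A = "area_density \<psi> u" and ?K = "raised_form u"
  have K: "?K $ l $ j = (\<Sum>i\<in>UNIV. ?A * ?g $ i $ j * (?g ** second_form u) $ l $ i)" for l j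
    by (simp add: raised_form_def matrix_matrix_mult_def[of "?g ** second_form u"] sum_distrib_left mult_ac)
  have "(\<Sum>i\<in>UNIV. flux_shift i u \<bullet> dnormal u (axis i 1))
      = - (\<Sum>i\<in>UNIV. \<Sum>j\<in>UNIV. \<Sum>l\<in>UNIV. ?A * ?g $ i $ j * (?g ** second_form u) $ l $ i * (shift j u \<bullet> pd l \<psi> u))"
    by (simp add: flux_shift_eq dnormal_coords[OF u] inner_sum_left inner_sum_right sum_negf
        sum_distrib_left mult_ac) (rule sum.cong[OF refl], rule sum.swap)
  also have "(\<Sum>i\<in>UNIV. \<Sum>j\<in>UNIV. \<Sum>l\<in>UNIV. ?A * ?g $ i $ j * (?g ** second_form u) $ l $ i * (shift j u \<bullet> pd l \<psi> u))
      = (\<Sum>j\<in>UNIV. \<Sum>l\<in>UNIV. \<Sum>i\<in>UNIV. ?A * ?g $ i $ j * (?g ** second_form u) $ l $ i * (shift j u \<bullet> pd l \<psi> u))"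
    by (subst sum.swap, rule sum.cong[OF refl], rule sum.swap)
  also have "\<dots> = (\<Sum>l\<in>UNIV. \<Sum>j\<in>UNIV. ?K $ l $ j * (shift j u \<bullet> pd l \<psi> u))"
    by (subst sum.swap) (simp add: K sum_distrib_right)
  finally have 1: "(\<Sum>i\<in>UNIV. flux_shift i u \<bullet> dnormal u (axis i 1))
      = - (\<Sum>l\<in>UNIV. \<Sum>j\<in>UNIV. ?K $ l $ j * (shift j u \<bullet> pd l \<psi> u))" (is "?L = - ?S") .
  \<comment> \<open>The indices are renamed and the symmetry of \<open>?K\<close> is used. Adding
    both forms of \<open>?S\<close> produces the polarised expression, which accounts for the
    division by \<open>2\<close>.\<close>
  have "?S = (\<Sum>l\<in>UNIV. \<Sum>j\<in>UNIV. ?K $ l $ j * (shift l u \<bullet> pd j \<psi> u))"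
    by (subst sum.swap) (intro sum.cong refl arg_cong2[where f="(*)"] raised_form_sym[OF u])
  then have "?S + ?S = (\<Sum>l\<in>UNIV. \<Sum>j\<in>UNIV. ?K $ l $ j * (shift j u \<bullet> pd l \<psi> u + shift l u \<bullet> pd j \<psi> u))"
    by (simp add: distrib_left sum.distrib)
  also have "\<dots> = - (\<Sum>l\<in>UNIV. \<Sum>j\<in>UNIV. ?K $ l $ j * (shift j u \<bullet> shift l u))"
    by (simp add: shift_polarised[OF u] sum_negf)
  finally show ?thesis using 1 by linarith
qed

text \<open>\<open>\<tau>\<close> is the part of \<open>nrm \<psi>' u\<close> tangential to
  \<open>\<psi>\<close>. Since \<open>nrm \<psi>' u\<close> is orthogonal to
  \<open>pd j \<psi>' u\<close>, its products with \<open>pd j \<psi> u\<close> reduce to products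
  with \<open>shift j u\<close>, so the squared length of \<open>\<tau>\<close> is quadratic in the
  shift.\<close>

lemma normal_tilt:
  assumes u: "u \<in> \<Omega>"
  shows "1 - (nrm \<psi>' u \<bullet> nrm \<psi> u)\<^sup>2
    = (\<Sum>j\<in>UNIV. \<Sum>k\<in>UNIV. inv_metric \<psi> u $ j $ k * (shift k u \<bullet> nrm \<psi>' u) * (shift j u \<bullet> nrm \<psi>' u))"
proof -
  let ?n = "nrm \<psi> u" and ?n' = "nrm \<psi>' u"
  let ?c = "?n' \<bullet> ?n"
  define \<tau> where "\<tau> = ?n' - ?c *\<^sub>R ?n"
  have tn: "\<tau> \<bullet> ?n = 0" by (simp add: \<tau>_def inner_diff_left normal[OF u u])
  have tp: "pd j \<psi> u \<bullet> \<tau> = - (shift j u \<bullet> ?n')" for j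
    by (simp add: \<tau>_def shift_def inner_diff_left inner_diff_right normal[OF u u] Q.normal[OF u u])
  have "\<tau> \<bullet> \<tau> = \<tau> \<bullet> Der \<psi> u (inv_metric \<psi> u *v (\<chi> j. pd j \<psi> u \<bullet> \<tau>))"
    by (simp only: tangent_coords[OF u tn])
  also have "\<dots> = (\<Sum>j\<in>UNIV. (inv_metric \<psi> u *v (\<chi> j. pd j \<psi> u \<bullet> \<tau>)) $ j * (pd j \<psi> u \<bullet> \<tau>))"
    by (subst linear_vec_sum[OF lin[OF u]]) (simp add: inner_sum_right inner_commute)
  also have "\<dots> = (\<Sum>j\<in>UNIV. \<Sum>k\<in>UNIV. inv_metric \<psi> u $ j $ k * (shift k u \<bullet> ?n') * (shift j u \<bullet> ?n'))"
    by (simp add: tp matrix_vector_mult_def sum_distrib_right sum_negf)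
  finally have "\<tau> \<bullet> \<tau> = \<dots>" .
  moreover have "\<tau> \<bullet> \<tau> = 1 - ?c\<^sup>2"
    by (simp add: \<tau>_def inner_diff_left inner_diff_right normal[OF u u] Q.normal[OF u u]
        inner_commute power2_eq_square)
  ultimately show ?thesis by simp
qed

definition remainder :: "real ^ 'm \<Rightarrow> real" where
  "remainder u = area_density \<psi> u * mean_curv \<psi>' u * (1 - nrm \<psi>' u \<bullet> nrm \<psi> u)
    - (\<Sum>l\<in>UNIV. \<Sum>j\<in>UNIV. raised_form u $ l $ j * (shift j u \<bullet> shift l u)) / 2"

text \<open>Product rule for the localised field, where the divergence of \<open>flux_shift\<close>
  is the difference of two Laplacians. With area density \<open>A\<close> and \<open>c\<close> the
  product of the two normals, its normal component is \<open>A * (H' * c - H)\<close>; writing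
  \<open>c = 1 - (1 - c)\<close> splits off \<open>H' - H\<close> and leaves the first term of
  \<open>remainder\<close>.\<close>

theorem mean_curv_variation:
  assumes u: "u \<in> \<Omega>" and \<rho>: "\<rho> differentiable (at u)"
  shows "\<rho> u * (area_density \<psi> u * (mean_curv \<psi>' u - mean_curv \<psi> u))
    = (\<Sum>i\<in>UNIV. pd i (\<lambda>y. \<rho> y * (flux_shift i y \<bullet> nrm \<psi> y)) u)
      - (\<Sum>i\<in>UNIV. pd i \<rho> u * (flux_shift i u \<bullet> nrm \<psi> u)) + \<rho> u * remainder u"
proof -
  let ?n = "nrm \<psi> u" and ?A = "area_density \<psi> u"
  have f: "flux \<psi> \<psi>' i y = flux \<psi>' \<psi>' i y" if "y \<in> \<Omega>" for i y using flux_eq[OF that] by simp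
  have "pd i (flux_shift i) u = pd i (flux \<psi>' \<psi>' i) u - pd i (flux \<psi> \<psi> i) u" for i
  proof -
    have "Der (flux_shift i) u
        = Der (\<lambda>y. flux \<psi>' \<psi>' i y - flux \<psi> \<psi> i y) u"
      by (rule frechet_derivative_cong_open[OF open_dom u]) (simp add: flux_shift_def f)
    also have "\<dots> = (\<lambda>v. Der (flux \<psi>' \<psi>' i) u v - Der (flux \<psi> \<psi> i) u v)"
      by (rule frechet_derivative_at[symmetric], rule has_derivative_diff)
        (rule C1_on_has_derivative[OF Q.flux_C1[OF Q.C2] u], rule C1_on_has_derivative[OF flux_C1[OF C2] u])
    finally show ?thesis by simp
  qed
  then have div: "(\<Sum>i\<in>UNIV. pd i (flux_shift i) u)
      = (?A * mean_curv \<psi>' u) *\<^sub>R nrm \<psi>' u - (?A * mean_curv \<psi> u) *\<^sub>R ?n"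
    by (simp add: sum_subtractf laplace_beltrami[OF u] Q.laplace_beltrami[OF u] area_eq[OF u])
  have "pd i (\<lambda>y. \<rho> y * (flux_shift i y \<bullet> nrm \<psi> y)) u
      = \<rho> u * (flux_shift i u \<bullet> dnormal u (axis i 1)) + \<rho> u * (pd i (flux_shift i) u \<bullet> ?n)
        + pd i \<rho> u * (flux_shift i u \<bullet> ?n)" for i
  proof -
    have "((\<lambda>y. \<rho> y * (flux_shift i y \<bullet> nrm \<psi> y)) has_derivative
       (\<lambda>v. \<rho> u * (flux_shift i u \<bullet> dnormal u v + Der (flux_shift i) u v \<bullet> ?n)
          + Der \<rho> u v * (flux_shift i u \<bullet> ?n))) (at u)"
      by (intro has_derivative_mult has_derivative_inner \<rho>[unfolded frechet_derivative_works]
          C1_on_has_derivative[OF C1_flux_shift u] C1_on_has_derivative[OF C1_normal u])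
    then show ?thesis by (simp add: frechet_derivative_at[symmetric] distrib_left)
  qed
  then have "(\<Sum>i\<in>UNIV. pd i (\<lambda>y. \<rho> y * (flux_shift i y \<bullet> nrm \<psi> y)) u)
      = \<rho> u * (\<Sum>i\<in>UNIV. flux_shift i u \<bullet> dnormal u (axis i 1))
        + \<rho> u * ((\<Sum>i\<in>UNIV. pd i (flux_shift i) u) \<bullet> ?n)
        + (\<Sum>i\<in>UNIV. pd i \<rho> u * (flux_shift i u \<bullet> ?n))"
    by (simp add: sum.distrib sum_distrib_left inner_sum_left)
  then show ?thesis
    unfolding flux_shift_dnormal[OF u] div remainder_def
    by (simp add: inner_diff_left normal[OF u u] algebra_simps)
qed

text \<open>Every double sum over the index type contributes \<open>CARD('m)\<close> twice. The
  factors of the first product bound the area density, \<open>mean_curv \<psi>' u\<close> and, up to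
  \<open>D\<^sup>2\<close>, the defect of the two normals; the other summand bounds the term with
  \<open>raised_form\<close>, its factor \<open>1 / 2\<close> being dropped.\<close>

lemma remainder_bound:
  fixes C D G :: real
  assumes u: "u \<in> \<Omega>" and A: "area_density \<psi> u \<le> G"
    and g: "\<And>i j. \<bar>inv_metric \<psi> u $ i $ j\<bar> \<le> G" and K: "\<And>i j. \<bar>raised_form u $ i $ j\<bar> \<le> G"
    and sec: "\<And>i j. norm (pd i (pd j \<psi>') u) \<le> C"
    and D: "\<And>j. norm (shift j u) \<le> D" and pos: "nrm \<psi>' u \<bullet> nrm \<psi> u \<ge> 0"
  shows "\<bar>remainder u\<bar> \<le> (G * (CARD('m) * (CARD('m) * (G * C))) * (CARD('m) * (CARD('m) * G))
     + CARD('m) * (CARD('m) * G)) * D\<^sup>2"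
proof -
  let ?m = "real CARD('m)"
  have s: "\<bar>\<Sum>i\<in>UNIV. \<Sum>j\<in>UNIV. f i j\<bar> \<le> ?m * (?m * B)" if "\<And>i j. \<bar>f i j\<bar> \<le> B" for f :: "'m \<Rightarrow> 'm \<Rightarrow> real" and B
  proof -
    have "\<bar>\<Sum>i\<in>UNIV. \<Sum>j\<in>UNIV. f i j\<bar> \<le> (\<Sum>i\<in>UNIV. \<Sum>j\<in>UNIV. \<bar>f i j\<bar>)"
      by (intro order_trans[OF sum_abs] sum_mono sum_abs)
    also have "\<dots> \<le> (\<Sum>i\<in>(UNIV :: 'm set). \<Sum>j\<in>(UNIV :: 'm set). B)" by (intro sum_mono that)
    finally show ?thesis by simp
  qed
  have G0: "G \<ge> 0" using A area_pos[OF u] by linarith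
  have D0: "D \<ge> 0" using order_trans[OF norm_ge_zero D] .
  have C0: "C \<ge> 0" using order_trans[OF norm_ge_zero sec] .
  note n' = Q.normal(1)[OF u u]
  have H: "\<bar>mean_curv \<psi>' u\<bar> \<le> ?m * (?m * (G * C))"
    unfolding Q.mean_curv_second[OF u]
  proof (rule s)
    fix i j
    have "\<bar>nrm \<psi>' u \<bullet> pd i (pd j \<psi>') u\<bar> \<le> norm (nrm \<psi>' u) * norm (pd i (pd j \<psi>') u)"
      by (rule Cauchy_Schwarz_ineq2)
    also have "\<dots> \<le> C" using sec n' by simp
    finally show "\<bar>inv_metric \<psi>' u $ i $ j * (nrm \<psi>' u \<bullet> pd i (pd j \<psi>') u)\<bar> \<le> G * C"
      unfolding abs_mult metric_eq[OF u] by (intro mult_mono g G0) auto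
  qed
  let ?c = "nrm \<psi>' u \<bullet> nrm \<psi> u"
  have shn: "\<bar>shift j u \<bullet> nrm \<psi>' u\<bar> \<le> D" for j
    using Cauchy_Schwarz_ineq2[of "shift j u" "nrm \<psi>' u"] D[of j] n' by simp
  have "\<bar>1 - ?c\<^sup>2\<bar> \<le> ?m * (?m * (G * D\<^sup>2))"
    unfolding normal_tilt[OF u]
  proof (rule s)
    fix j k
    show "\<bar>inv_metric \<psi> u $ j $ k * (shift k u \<bullet> nrm \<psi>' u) * (shift j u \<bullet> nrm \<psi>' u)\<bar> \<le> G * D\<^sup>2"
      unfolding abs_mult power2_eq_square mult.assoc[symmetric]
      by (intro mult_mono g shn mult_nonneg_nonneg G0 D0) auto
  qed
  moreover have c1: "?c \<le> 1"
    using norm_cauchy_schwarz[of "nrm \<psi>' u" "nrm \<psi> u"] normal(1)[OF u u] n' by simp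
  \<comment> \<open>For \<open>0 \<le> ?c \<le> 1\<close> the sign-blind quantity
    \<open>1 - ?c\<^sup>2\<close> dominates \<open>1 - ?c\<close>; here the relative orientation of
    the two normals enters.\<close>
  moreover have "?c\<^sup>2 \<le> ?c" using pos c1 by (simp add: power2_eq_square mult_left_le)
  ultimately have c: "\<bar>1 - ?c\<bar> \<le> ?m * (?m * G) * D\<^sup>2" by (simp add: mult.assoc)
  have "\<bar>\<Sum>l\<in>UNIV. \<Sum>j\<in>UNIV. raised_form u $ l $ j * (shift j u \<bullet> shift l u)\<bar> \<le> ?m * (?m * (G * D\<^sup>2))"
  proof (rule s)
    fix l j
    have "\<bar>shift j u \<bullet> shift l u\<bar> \<le> norm (shift j u) * norm (shift l u)" by (rule Cauchy_Schwarz_ineq2)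
    also have "\<dots> \<le> D\<^sup>2" unfolding power2_eq_square by (intro mult_mono D D0) auto
    finally show "\<bar>raised_form u $ l $ j * (shift j u \<bullet> shift l u)\<bar> \<le> G * D\<^sup>2"
      unfolding abs_mult by (intro mult_mono K G0) auto
  qed
  moreover have "\<bar>area_density \<psi> u * mean_curv \<psi>' u * (1 - ?c)\<bar>
      \<le> G * (?m * (?m * (G * C))) * (?m * (?m * G) * D\<^sup>2)"
    unfolding abs_mult using A area_pos[OF u]
    by (intro mult_mono H c mult_nonneg_nonneg G0 C0) auto
  ultimately have "\<bar>remainder u\<bar> \<le> G * (?m * (?m * (G * C))) * (?m * (?m * G) * D\<^sup>2) + ?m * (?m * (G * D\<^sup>2)) / 2"
    unfolding remainder_def by linarith
  also have "\<dots> \<le> G * (?m * (?m * (G * C))) * (?m * (?m * G) * D\<^sup>2) + ?m * (?m * (G * D\<^sup>2))"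
    using G0 by simp
  finally show ?thesis by (simp add: algebra_simps)
qed

end

section \<open>Integration\<close>

lemma compact_support_integrable:
  fixes f :: "'e::euclidean_space \<Rightarrow> real"
  assumes "continuous_on UNIV f" "compact K" "\<And>u. u \<notin> K \<Longrightarrow> f u = 0"
  shows "integrable lborel f"
proof -
  have "integrable lborel (\<lambda>u. indicator K u *\<^sub>R f u)"
    by (rule borel_integrable_compact[OF assms(2)]) (rule continuous_on_subset[OF assms(1)], simp)
  moreover have "(\<lambda>u. indicator K u *\<^sub>R f u) = f"
  proof
    show "indicator K u *\<^sub>R f u = f u" for u using assms(3) by (cases "u \<in> K") auto
  qed
  ultimately show ?thesis by simp
qed

lemma compact_support_bounded:
  fixes f :: "'e::euclidean_space \<Rightarrow> real"
  assumes "continuous_on UNIV f" "compact K" "\<And>u. u \<notin> K \<Longrightarrow> f u = 0"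
  obtains B where "B \<ge> 0" "\<And>u. \<bar>f u\<bar> \<le> B"
proof -
  have "compact (f ` K)" using assms by (intro compact_continuous_image) (auto intro: continuous_on_subset)
  then obtain B where B: "\<And>y. y \<in> f ` K \<Longrightarrow> norm y \<le> B" using compact_imp_bounded bounded_iff by metis
  have "\<bar>f u\<bar> \<le> max B 0" for u
    using B[of "f u"] assms(3)[of u] by (cases "u \<in> K") (auto simp: max_def)
  then show ?thesis by (intro that[of "max B 0"]) auto
qed

text \<open>The difference quotients of \<open>F\<close> in direction \<open>v\<close> have integral
  \<open>0\<close> by translation invariance, and dominated convergence passes to the derivative.
  Used in each coordinate direction, this is the divergence theorem for compactly supported
  fields.\<close>

lemma integral_derivative_eq_0:
  fixes F :: "'e::euclidean_space \<Rightarrow> real"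
  assumes F: "C1_on UNIV F" and K: "compact K" and supp: "\<And>u. u \<notin> K \<Longrightarrow> F u = 0"
  shows "integrable lborel (\<lambda>u. Der F u v)"
    "(\<integral>u. Der F u v \<partial>lborel) = 0"
proof -
  let ?d = "\<lambda>u. Der F u v"
  have dsupp: "?d u = 0" if "u \<notin> K" for u
    by (rule frechet_derivative_zero_open[of "- K"]) (use K supp that compact_imp_closed in auto)
  have dcont: "continuous_on UNIV ?d" by (rule C1_on_continuous_derivative[OF F])
  show int: "integrable lborel ?d" by (rule compact_support_integrable[OF dcont K dsupp])
  obtain B where B: "B \<ge> 0" "\<And>u. \<bar>?d u\<bar> \<le> B" using compact_support_bounded[OF dcont K dsupp] by blast
  have intF: "integrable lborel F"
    by (rule compact_support_integrable[OF C1_on_imp_continuous_on[OF F] K supp])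
  define h :: "nat \<Rightarrow> real" where "h n = 1 / real (Suc n)" for n
  have h: "0 < h n" "h n \<le> 1" for n by (simp_all add: h_def)
  have hlim: "h \<longlonglongrightarrow> 0" unfolding h_def by (rule LIMSEQ_Suc[OF lim_1_over_n])
  define q where "q n u = (F (h n *\<^sub>R v + u) - F u) / h n" for n u
  have line: "((\<lambda>t. F (t *\<^sub>R v + u)) has_real_derivative ?d (t *\<^sub>R v + u)) (at t)" for t u
    using C1_on_line[OF F UNIV_I] by (simp add: add.commute[of _ u])
  have qlim: "(\<lambda>n. q n u) \<longlonglongrightarrow> ?d u" for u
  proof -
    have "((\<lambda>r. (F ((0 + r) *\<^sub>R v + u) - F (0 *\<^sub>R v + u)) / r) \<longlongrightarrow> ?d (0 *\<^sub>R v + u)) (at 0)"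
      using line[of u 0] unfolding DERIV_def .
    moreover have "filterlim h (at 0) sequentially"
      using hlim h by (auto simp: filterlim_at intro!: always_eventually less_imp_neq[symmetric])
    ultimately show ?thesis
      using filterlim_compose[of _ _ "at 0" h sequentially] by (fastforce simp: q_def)
  qed
  \<comment> \<open>All points that reach \<open>K\<close> after a translation by \<open>t\<close>
    times \<open>v\<close> with \<open>t\<close> in \<open>{0..1}\<close>. As
    \<open>h n \<le> 1\<close>, every difference quotient vanishes off this compact set; on it the
    mean value theorem bounds them by \<open>B\<close>.\<close>
  define K' where "K' = (\<lambda>(k, t). k - t *\<^sub>R v) ` (K \<times> {0..1})"
  have K': "compact K'"
    unfolding K'_def using K
    by (intro compact_continuous_image compact_Times) (auto intro!: continuous_intros simp: case_prod_unfold)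
  have qb: "norm (q n u) \<le> indicator K' u *\<^sub>R B" for n u
  proof (cases "u \<in> K'")
    case True
    obtain t where "F (h n *\<^sub>R v + u) - F (0 *\<^sub>R v + u) = (h n - 0) * ?d (t *\<^sub>R v + u)"
      using MVT2[of 0 "h n" "\<lambda>t. F (t *\<^sub>R v + u)" "\<lambda>t. ?d (t *\<^sub>R v + u)"] h(1) line by blast
    then have "q n u = ?d (t *\<^sub>R v + u)" using h(1)[of n] by (simp add: q_def)
    then show ?thesis using True B by simp
  next
    case False
    have "t *\<^sub>R v + u \<notin> K" if "0 \<le> t" "t \<le> 1" for t
    proof
      assume "t *\<^sub>R v + u \<in> K"
      then have "(\<lambda>(k, t). k - t *\<^sub>R v) (t *\<^sub>R v + u, t) \<in> K'"
        unfolding K'_def using that by (intro imageI) auto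
      then show False using False by simp
    qed
    from this[of "h n"] this[of 0] show ?thesis using supp h[of n] False by (simp add: q_def less_imp_le)
  qed
  have shift: "integrable lborel (\<lambda>u. F (c + u))" "(\<integral>u. F (c + u) \<partial>lborel) = (\<integral>u. F u \<partial>lborel)" for c
  proof -
    have [measurable]: "F \<in> borel_measurable borel"
      using C1_on_imp_continuous_on[OF F] by (rule borel_measurable_continuous_onI)
    have "integrable (distr lborel borel ((+) c)) F" using intF by (simp add: lborel_distr_plus)
    then show "integrable lborel (\<lambda>u. F (c + u))" by (subst (asm) integrable_distr_eq) auto
    have "(\<integral>u. F u \<partial>lborel) = (\<integral>u. F u \<partial>distr lborel borel ((+) c))" by (simp add: lborel_distr_plus)
    also have "\<dots> = (\<integral>u. F (c + u) \<partial>lborel)" by (rule integral_distr) auto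
    finally show "(\<integral>u. F (c + u) \<partial>lborel) = (\<integral>u. F u \<partial>lborel)" by simp
  qed
  have q0: "(\<integral>u. q n u \<partial>lborel) = 0" for n
    unfolding q_def by (simp add: shift intF)
  have "(\<lambda>n. \<integral>u. q n u \<partial>lborel) \<longlonglongrightarrow> (\<integral>u. ?d u \<partial>lborel)"
  proof (rule integral_dominated_convergence[where w = "\<lambda>u. indicator K' u *\<^sub>R B"])
    show "integrable lborel (\<lambda>u. indicator K' u *\<^sub>R B)"
      by (rule borel_integrable_compact[OF K']) auto
    show "?d \<in> borel_measurable lborel" using borel_measurable_integrable[OF int] .
    show "q n \<in> borel_measurable lborel" for n
      unfolding q_def using shift(1) intF by (intro borel_measurable_divide borel_measurable_diff) auto
  qed (use qlim qb in auto)
  then show "(\<integral>u. ?d u \<partial>lborel) = 0" by (simp add: q0 LIMSEQ_const_iff)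
qed

section \<open>Change of variables for arbitrary finite index types\<close>

text \<open>The change of variables theorem of the library needs an index type of class
  \<open>wellorder\<close>; every finite type has a copy in that class.\<close>

typedef 'a ordcopy = "UNIV :: 'a set" by auto

instance ordcopy :: (finite) finite
proof
  have "(UNIV :: 'a ordcopy set) = Abs_ordcopy ` UNIV"
    using type_definition.Abs_image[OF type_definition_ordcopy] by (rule sym)
  then show "finite (UNIV :: 'a ordcopy set)" using finite_imageI[OF finite[of "UNIV :: 'a set"], of Abs_ordcopy] by (simp only:)
qed

definition ordcopy_enum :: "'a::finite ordcopy \<Rightarrow> nat" where
  "ordcopy_enum = (SOME f. inj f)"

lemma inj_ordcopy_enum: "inj (ordcopy_enum :: 'a::finite ordcopy \<Rightarrow> nat)"
proof -
  obtain f :: "'a ordcopy \<Rightarrow> nat" where "inj f"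
    using finite_imp_inj_to_nat_seg[OF finite[of "UNIV :: 'a ordcopy set"]] by blast
  then show ?thesis unfolding ordcopy_enum_def by (rule someI[of inj])
qed

instantiation ordcopy :: (finite) wellorder
begin

definition "x \<le> y \<longleftrightarrow> ordcopy_enum x \<le> ordcopy_enum y"
definition "x < y \<longleftrightarrow> ordcopy_enum x < ordcopy_enum y"

instance
proof
  fix P :: "'a ordcopy \<Rightarrow> bool" and a
  assume step: "\<And>x. (\<And>y. y < x \<Longrightarrow> P y) \<Longrightarrow> P x"
  show "P a"
    by (induction a rule: measure_induct_rule[where f = ordcopy_enum]) (auto intro: step simp: less_ordcopy_def)
qed (auto simp: less_eq_ordcopy_def less_ordcopy_def dest: injD[OF inj_ordcopy_enum])

end

definition reindex :: "('k::finite \<Rightarrow> 'n::finite) \<Rightarrow> real ^ 'n \<Rightarrow> real ^ 'k" where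
  "reindex r v = (\<chi> k. v $ r k)"

lemma linear_reindex: "linear (reindex r)"
  by (intro linearI) (simp_all add: reindex_def vec_eq_iff)

lemma reindex_reindex: "(\<And>k. r (q k) = k) \<Longrightarrow> reindex q (reindex r v) = v"
  by (simp add: reindex_def vec_eq_iff)

text \<open>Renaming coordinates turns boxes into boxes with the same side lengths.\<close>

lemma lborel_reindex:
  fixes r :: "'k::finite \<Rightarrow> 'n::finite"
  assumes r: "bij r"
  shows "distr lborel borel (reindex r) = lborel"
proof (rule lborel_eqI[symmetric])
  let ?q = "inv r"
  have rq: "r (?q i) = i" "?q (r k) = k" for i k using r by (simp_all add: bij_is_surj surj_f_inv_f bij_is_inj inv_f_f)
  have [measurable]: "reindex r \<in> borel_measurable borel"
    using linear_reindex
    by (intro borel_measurable_continuous_onI linear_continuous_on) (simp add: linear_conv_bounded_linear)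
  have B: "(\<Prod>b\<in>(Basis :: (real ^ 'x::finite) set). w \<bullet> b) = (\<Prod>i\<in>UNIV. w $ i)" for w :: "real ^ 'x"
  proof -
    have B: "(Basis :: (real ^ 'x) set) = (\<lambda>i. axis i 1) ` UNIV" by (auto simp: Basis_vec_def)
    have "inj (\<lambda>i :: 'x. axis i (1 :: real))" by (simp add: inj_on_def axis_eq_axis)
    from prod.reindex[OF this, of "\<lambda>b. w \<bullet> b"] show ?thesis
      by (simp add: B cart_eq_inner_axis)
  qed
  fix l u :: "real ^ 'k" assume le: "\<And>b. b \<in> Basis \<Longrightarrow> l \<bullet> b \<le> u \<bullet> b"
  have le': "l $ k \<le> u $ k" for k
    using le[of "axis k 1"] by (simp add: inner_axis)
  have "reindex r -` box l u = box (reindex ?q l) (reindex ?q u)"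
  proof -
    have "(\<forall>k. P k (r k)) \<longleftrightarrow> (\<forall>i. P (?q i) i)" for P by (metis rq)
    then have "(\<forall>k. l $ k < x $ r k \<and> x $ r k < u $ k)
        \<longleftrightarrow> (\<forall>i. l $ ?q i < x $ i \<and> x $ i < u $ ?q i)" for x :: "real ^ 'n" .
    then show ?thesis by (simp add: set_eq_iff mem_box_cart reindex_def)
  qed
  then have "emeasure (distr lborel borel (reindex r)) (box l u) = emeasure lborel (box (reindex ?q l) (reindex ?q u))"
    by (simp add: emeasure_distr)
  also have "\<dots> = (\<Prod>b\<in>Basis. (reindex ?q u - reindex ?q l) \<bullet> b)"
    by (rule emeasure_lborel_box) (auto simp: Basis_vec_def inner_axis reindex_def le')
  also have "\<dots> = (\<Prod>i\<in>UNIV. (u - l) $ ?q i)" by (simp add: B reindex_def)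
  also have "\<dots> = (\<Prod>k\<in>UNIV. (u - l) $ k)"
    using r by (intro arg_cong[where f = ennreal] prod.reindex_bij_betw bij_imp_bij_inv)
  finally show "emeasure (distr lborel borel (reindex r)) (box l u) = (\<Prod>b\<in>Basis. (u - l) \<bullet> b)"
    by (simp only: B)
qed simp

text \<open>Conjugation with \<open>r\<close> is a sign-preserving bijection between the
  permutations of the two index types, and it matches the Leibniz terms.\<close>

lemma det_reindex:
  fixes r :: "'k::finite \<Rightarrow> 'n::finite" and M :: "real ^ 'n ^ 'n"
  assumes r: "bij r"
  shows "det (\<chi> k l. M $ r k $ r l) = det M"
proof -
  let ?f = "map_permutation UNIV r" and ?g = "map_permutation UNIV (inv r)"
  have q: "bij (inv r)" using r by (rule bij_imp_bij_inv)
  have rq: "r (inv r i) = i" "inv r (r k) = k" for i k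
    using r by (simp_all add: bij_is_surj surj_f_inv_f bij_is_inj inv_f_f)
  have "(\<Sum>p\<in>{p. p permutes UNIV}. of_int (sign p) * (\<Prod>k\<in>UNIV. M $ r k $ r (p k)))
      = (\<Sum>p\<in>{p. p permutes UNIV}. of_int (sign p) * (\<Prod>i\<in>UNIV. M $ i $ p i))"
  proof (rule sum.reindex_bij_witness[where j = ?f and i = ?g])
    fix p :: "'k \<Rightarrow> 'k" assume "p \<in> {p. p permutes UNIV}"
    then have p: "p permutes UNIV" by simp
    show "?g (?f p) = p"
      by (rule map_permutation_compose_inv[OF _ p]) (use r rq in auto)
    show "?f p \<in> {p. p permutes UNIV}"
      using map_permutation_permutes[OF _ p] r by blast
    have ap: "?f p (r k) = r (p k)" for k
      using r by (intro map_permutation_apply) (auto simp: bij_is_inj)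
    have "(\<Prod>i\<in>UNIV. M $ i $ ?f p i) = (\<Prod>k\<in>UNIV. M $ r k $ ?f p (r k))"
      using r by (intro prod.reindex_bij_betw[symmetric])
    also have "\<dots> = (\<Prod>k\<in>UNIV. M $ r k $ r (p k))" by (simp add: ap)
    finally show "of_int (sign (?f p)) * (\<Prod>i\<in>UNIV. M $ i $ ?f p i) = of_int (sign p) * (\<Prod>k\<in>UNIV. M $ r k $ r (p k))"
      using sign_map_permutation[OF bij_is_inj[OF r] p] by simp
  next
    fix p :: "'n \<Rightarrow> 'n" assume "p \<in> {p. p permutes UNIV}"
    then have p: "p permutes UNIV" by simp
    show "?f (?g p) = p"
      by (rule map_permutation_compose_inv[OF _ p]) (use q rq in auto)
    show "?g p \<in> {p. p permutes UNIV}"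
      using map_permutation_permutes[OF _ p] q by blast
  qed
  then show ?thesis by (simp add: det_def)
qed

text \<open>Mediates between extended nonnegative integrals, by which area is defined, and absolute
  integrability, in which the change of variables theorem is phrased.\<close>

lemma nn_integral_eq_ennreal_iff:
  fixes f :: "'e::euclidean_space \<Rightarrow> real"
  assumes S: "S \<in> sets borel" and f: "f \<in> borel_measurable borel" "\<And>x. f x \<ge> 0" and r: "r \<ge> 0"
  shows "(\<integral>\<^sup>+x\<in>S. ennreal (f x) \<partial>lborel) = ennreal r \<longleftrightarrow> f absolutely_integrable_on S \<and> integral S f = r"
proof
  have e: "(\<integral>\<^sup>+x\<in>S. ennreal (f x) \<partial>lborel) = (\<integral>\<^sup>+x. ennreal (indicator S x * f x) \<partial>lborel)"
    by (intro nn_integral_cong) (auto simp: indicator_def)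
  assume "(\<integral>\<^sup>+x\<in>S. ennreal (f x) \<partial>lborel) = ennreal r"
  then have "((\<lambda>x. indicator S x * f x) has_integral r) UNIV"
    using S f r unfolding e by (intro nn_integral_has_integral) (auto intro!: borel_measurable_times borel_measurable_indicator)
  then have "((\<lambda>x. if x \<in> S then f x else 0) has_integral r) UNIV"
    by (rule has_integral_eq[rotated]) auto
  then have I: "(f has_integral r) S" by (simp add: has_integral_restrict_UNIV)
  then show "f absolutely_integrable_on S \<and> integral S f = r"
    using f(2) by (auto simp: integral_unique intro!: nonnegative_absolutely_integrable_1)
next
  assume "f absolutely_integrable_on S \<and> integral S f = r"
  then have "(f has_integral r) S"
    using set_lebesgue_integral_eq_integral(1) integrable_integral by blast
  then show "(\<integral>\<^sup>+x\<in>S. ennreal (f x) \<partial>lborel) = ennreal r"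
    by (intro nn_integral_has_integral_lebesgue' f)
qed

text \<open>The integrand on the right is a separate Borel function \<open>h\<close>, because
  \<open>g'\<close> is controlled on \<open>S\<close> only and the product with the Jacobian may
  fail to be measurable elsewhere.\<close>

lemma nn_integral_change_of_variables_wellorder:
  fixes g :: "real ^ 'n::{finite,wellorder} \<Rightarrow> real ^ 'n::_" and f h :: "real ^ 'n::_ \<Rightarrow> real"
  assumes S: "S \<in> sets borel" "g ` S \<in> sets borel"
    and g: "\<And>x. x \<in> S \<Longrightarrow> (g has_derivative g' x) (at x within S)" "inj_on g S"
    and f: "f \<in> borel_measurable borel" "\<And>x. f x \<ge> 0"
    and h: "h \<in> borel_measurable borel" "\<And>x. h x \<ge> 0"
    and eq: "\<And>x. x \<in> S \<Longrightarrow> h x = \<bar>det (matrix (g' x))\<bar> * f (g x)"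
  shows "(\<integral>\<^sup>+y\<in>g ` S. ennreal (f y) \<partial>lborel) = (\<integral>\<^sup>+x\<in>S. ennreal (h x) \<partial>lborel)" (is "?L = ?R")
proof -
  have iff: "?L = ennreal r \<longleftrightarrow> ?R = ennreal r" if r: "r \<ge> 0" for r
  proof -
    have "(\<lambda>x. \<bar>det (matrix (g' x))\<bar> *\<^sub>R vec (f (g x)) :: real ^ 1) absolutely_integrable_on S \<and>
        integral S (\<lambda>x. \<bar>det (matrix (g' x))\<bar> *\<^sub>R vec (f (g x))) = (vec r :: real ^ 1)
      \<longleftrightarrow> (\<lambda>x. vec (f x) :: real ^ 1) absolutely_integrable_on (g ` S) \<and>
        integral (g ` S) (\<lambda>x. vec (f x)) = (vec r :: real ^ 1)"
      using S by (intro has_absolute_integral_change_of_variables g) (auto simp: sets_completionI_sets)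
    then have "((\<lambda>x. \<bar>det (matrix (g' x))\<bar> * f (g x)) absolutely_integrable_on S \<and>
        integral S (\<lambda>x. \<bar>det (matrix (g' x))\<bar> * f (g x)) = r)
      \<longleftrightarrow> f absolutely_integrable_on (g ` S) \<and> integral (g ` S) f = r"
      by (simp add: absolutely_integrable_on_1_iff integral_on_1_eq)
    moreover have "(\<lambda>x. \<bar>det (matrix (g' x))\<bar> * f (g x)) absolutely_integrable_on S \<longleftrightarrow> h absolutely_integrable_on S"
      by (rule set_integrable_cong) (simp_all add: eq)
    moreover have "integral S (\<lambda>x. \<bar>det (matrix (g' x))\<bar> * f (g x)) = integral S h"
      by (rule integral_cong) (simp add: eq)
    ultimately show ?thesis
      using nn_integral_eq_ennreal_iff[OF S(2) f r] nn_integral_eq_ennreal_iff[OF S(1) h r] by simp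
  qed
  \<comment> \<open>The two sides take the same finite values; if neither is finite, both are
    infinite.\<close>
  show ?thesis
    by (cases ?L rule: ennreal_cases; cases ?R rule: ennreal_cases) (use iff in auto)
qed

lemma nn_integral_change_of_variables:
  fixes g :: "real ^ 'n::finite \<Rightarrow> real ^ 'n" and f h :: "real ^ 'n \<Rightarrow> real"
  assumes S: "S \<in> sets borel" "g ` S \<in> sets borel"
    and g: "\<And>x. x \<in> S \<Longrightarrow> (g has_derivative g' x) (at x)" "inj_on g S"
    and f: "f \<in> borel_measurable borel" "\<And>x. f x \<ge> 0"
    and h: "h \<in> borel_measurable borel" "\<And>x. h x \<ge> 0"
    and eq: "\<And>x. x \<in> S \<Longrightarrow> h x = \<bar>det (matrix (g' x))\<bar> * f (g x)"
  shows "(\<integral>\<^sup>+y\<in>g ` S. ennreal (f y) \<partial>lborel) = (\<integral>\<^sup>+x\<in>S. ennreal (h x) \<partial>lborel)"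
proof -
  define J :: "real ^ 'n \<Rightarrow> real ^ 'n ordcopy" where "J = reindex Rep_ordcopy"
  define I :: "real ^ 'n ordcopy \<Rightarrow> real ^ 'n" where "I = reindex Abs_ordcopy"
  have bij: "bij (Rep_ordcopy :: 'n ordcopy \<Rightarrow> 'n)" "bij (Abs_ordcopy :: 'n \<Rightarrow> 'n ordcopy)"
    by (auto intro!: bijI' simp: Rep_ordcopy_inject Abs_ordcopy_inject)
      (metis Abs_ordcopy_inverse UNIV_I, metis Rep_ordcopy_inverse)
  have JI: "J (I w) = w" "I (J v) = v" for v w
    by (simp_all add: I_def J_def reindex_reindex Abs_ordcopy_inverse Rep_ordcopy_inverse)
  have lin: "linear I" "linear J" by (simp_all add: I_def J_def linear_reindex)
  have bl: "bounded_linear I" "bounded_linear J" using lin by (simp_all add: linear_conv_bounded_linear)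
  have I[measurable]: "I \<in> borel_measurable borel" and J[measurable]: "J \<in> borel_measurable borel"
    by (intro borel_measurable_continuous_onI linear_continuous_on bl)+
  have img: "J ` E = I -` E" for E by (auto simp: JI image_iff) (metis JI(1))
  have imgm: "J ` E \<in> sets borel" if "E \<in> sets borel" for E
    using measurable_sets[OF I that] by (simp add: img)
  have trans: "(\<integral>\<^sup>+y\<in>E. ennreal (F y) \<partial>lborel) = (\<integral>\<^sup>+w\<in>J ` E. ennreal (F (I w)) \<partial>lborel)"
    if [measurable]: "E \<in> sets borel" "F \<in> borel_measurable borel" for E and F :: "real ^ 'n \<Rightarrow> real"
  proof -
    have "(\<integral>\<^sup>+y\<in>E. ennreal (F y) \<partial>lborel) = (\<integral>\<^sup>+y\<in>E. ennreal (F y) \<partial>distr lborel borel I)"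
      by (simp add: I_def lborel_reindex[OF bij(2)])
    also have "\<dots> = (\<integral>\<^sup>+w. ennreal (F (I w)) * indicator E (I w) \<partial>lborel)"
      by (rule nn_integral_distr) auto
    also have "\<dots> = (\<integral>\<^sup>+w\<in>J ` E. ennreal (F (I w)) \<partial>lborel)"
      by (intro nn_integral_cong) (auto simp: img indicator_def)
    finally show ?thesis .
  qed
  let ?g = "\<lambda>w. J (g (I w))"
  have gim: "?g ` J ` S = J ` g ` S" by (auto simp: JI image_iff)
  have "(\<integral>\<^sup>+y\<in>?g ` J ` S. ennreal (f (I y)) \<partial>lborel) = (\<integral>\<^sup>+x\<in>J ` S. ennreal (h (I x)) \<partial>lborel)"
  proof (rule nn_integral_change_of_variables_wellorder[where g' = "\<lambda>w v. J (g' (I w) (I v))"])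
    show "J ` S \<in> sets borel" "?g ` J ` S \<in> sets borel" using S imgm gim by auto
    show "(?g has_derivative (\<lambda>v. J (g' (I w) (I v)))) (at w within J ` S)" if "w \<in> J ` S" for w
    proof (rule has_derivative_at_withinI)
      have "I w \<in> S" using that by (auto simp: JI)
      then show "(?g has_derivative (\<lambda>v. J (g' (I w) (I v)))) (at w)"
        by (intro bounded_linear.has_derivative[OF bl(2)]
            has_derivative_compose[OF bounded_linear_imp_has_derivative[OF bl(1)] g(1)])
    qed
    show "inj_on ?g (J ` S)"
      using g(2) by (auto simp: inj_on_def JI) (metis JI(2))
    show "(\<lambda>y. f (I y)) \<in> borel_measurable borel" "(\<lambda>y. h (I y)) \<in> borel_measurable borel"
      using f(1) h(1) by measurable
    show "h (I w) = \<bar>det (matrix (\<lambda>v. J (g' (I w) (I v))))\<bar> * f (I (?g w))" if "w \<in> J ` S" for w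
    proof -
      have "I (axis l 1) = axis (Rep_ordcopy l) 1" for l :: "'n ordcopy"
        by (auto simp: I_def reindex_def vec_eq_iff axis_def Rep_ordcopy_inverse Abs_ordcopy_inverse)
      then have "matrix (\<lambda>v. J (g' (I w) (I v))) = (\<chi> k l. matrix (g' (I w)) $ Rep_ordcopy k $ Rep_ordcopy l)"
        by (simp add: matrix_def J_def reindex_def)
      then show ?thesis using eq[of "I w"] that by (auto simp: det_reindex[OF bij(1)] JI)
    qed
  qed (use f h in auto)
  then show ?thesis
    using trans[OF S(2) f(1)] trans[OF S(1) h(1)] by (simp only: gim)
qed

section \<open>The area measure\<close>

lemma gram_compose:
  fixes g :: "real ^ 'm::finite \<Rightarrow> real ^ 'n::finite" and h :: "real ^ 'm \<Rightarrow> real ^ 'm"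
  assumes "linear g" "linear h"
  shows "gram (g \<circ> h) = transpose (matrix h) ** (gram g ** matrix h)"
proof -
  have "(transpose (matrix h) ** (gram g ** matrix h)) $ i $ j = g (h (axis i 1)) \<bullet> g (h (axis j 1))" for i j
  proof -
    have "(transpose (matrix h) ** (gram g ** matrix h)) $ i $ j
        = h (axis i 1) \<bullet> (gram g *v h (axis j 1))"
      by (simp add: matrix_matrix_mult_def transpose_def matrix_def inner_vec_def
          matrix_vector_mult_def)
    also have "\<dots> = g (h (axis i 1)) \<bullet> g (h (axis j 1))"
      using gram_inner[OF assms(1), of "h (axis j 1)" "h (axis i 1)"] by (metis inner_commute)
    finally show ?thesis .
  qed
  then show ?thesis by (simp add: vec_eq_iff gram_def)
qed

lemma continuous_on_zero_extension:
  fixes h :: "'e::euclidean_space \<Rightarrow> real"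
  assumes "open W" "continuous_on W h" "compact K" "K \<subseteq> W" "\<And>u. u \<notin> K \<Longrightarrow> h u = 0"
  shows "continuous_on UNIV h"
proof -
  have "continuous_on (- K) h"
    using assms(5) by (subst continuous_on_cong[OF refl, of _ _ "\<lambda>_. 0"]) auto
  then have "continuous_on (W \<union> - K) h"
    using assms by (intro continuous_on_open_Un) (auto simp: compact_imp_closed open_Compl)
  moreover have "W \<union> - K = UNIV" using assms(4) by auto
  ultimately show ?thesis by simp
qed

section \<open>Charts of a compact oriented manifold\<close>

locale closed_manifold =
  fixes S :: "'a::t2_space set" and \<A> :: "('a, 'm::finite) chart set"
  assumes compact: "compact S" and atlas: "oriented_smooth_atlas S \<A>"
begin

abbreviation \<BB> :: "'a measure" where "\<BB> \<equiv> restrict_space borel S"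

lemma chart:
  assumes "(U, x) \<in> \<A>"
  shows "U \<subseteq> S" "openin (top_of_set S) U" "open (x ` U)"
    "continuous_on U x" "continuous_on (x ` U) (inv_into U x)" "inj_on x U"
    "\<And>p. p \<in> U \<Longrightarrow> inv_into U x (x p) = p"
    "\<And>u. u \<in> x ` U \<Longrightarrow> x (inv_into U x u) = u"
    "\<And>u. u \<in> x ` U \<Longrightarrow> inv_into U x u \<in> U"
proof -
  have "\<forall>(U, x)\<in>\<A>. openin (top_of_set S) U \<and> open (x ` U) \<and>
      homeomorphism U (x ` U) x (inv_into U x)"
    using atlas unfolding oriented_smooth_atlas_def by (elim conjE)
  from bspec[OF this assms]
  have h: "openin (top_of_set S) U" "open (x ` U)" "homeomorphism U (x ` U) x (inv_into U x)"
    by simp_all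
  show "U \<subseteq> S" using h(1) by (rule openin_imp_subset)
  show "openin (top_of_set S) U" "open (x ` U)" using h by auto
  show "continuous_on U x" "continuous_on (x ` U) (inv_into U x)"
    using h(3) by (auto simp: homeomorphism_def)
  show i: "\<And>p. p \<in> U \<Longrightarrow> inv_into U x (x p) = p" using h(3) by (auto simp: homeomorphism_def)
  show "inj_on x U" by (rule inj_on_inverseI[where g = "inv_into U x"]) (rule i)
  show "\<And>u. u \<in> x ` U \<Longrightarrow> x (inv_into U x u) = u" "\<And>u. u \<in> x ` U \<Longrightarrow> inv_into U x u \<in> U"
    by (auto simp: f_inv_into_f inv_into_into)
qed

lemma charts_cover: "p \<in> S \<Longrightarrow> \<exists>U x. (U, x) \<in> \<A> \<and> p \<in> U"
proof -
  assume "p \<in> S"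
  moreover have "(\<Union>(U, x)\<in>\<A>. U) = S"
    using atlas unfolding oriented_smooth_atlas_def by (elim conjE)
  ultimately have "p \<in> (\<Union>(U, x)\<in>\<A>. U)" by simp
  then show ?thesis by blast
qed

lemma sets_chart: "(U, x) \<in> \<A> \<Longrightarrow> U \<in> sets \<BB>"
proof -
  assume "(U, x) \<in> \<A>"
  then obtain T where "open T" "U = S \<inter> T" using chart(2) unfolding openin_open by blast
  then show ?thesis unfolding sets_restrict_space by (intro image_eqI[of _ _ T]) auto
qed

text \<open>The image of \<open>E\<close> is the preimage of a Borel set under the inverse chart,
  which is continuous on an open set.\<close>

lemma sets_chart_image:
  assumes c: "(U, x) \<in> \<A>" and E: "E \<in> sets \<BB>" "E \<subseteq> U"
  shows "x ` E \<in> sets borel"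
proof -
  obtain B where B: "B \<in> sets borel" "E = S \<inter> B" using E by (auto simp: sets_restrict_space)
  have "inv_into U x \<in> borel_measurable (restrict_space borel (x ` U))"
    by (rule borel_measurable_continuous_on_restrict[OF chart(5)[OF c]])
  then have "inv_into U x -` B \<inter> space (restrict_space borel (x ` U)) \<in> sets (restrict_space borel (x ` U))"
    using B(1) by (rule measurable_sets)
  moreover have "inv_into U x -` B \<inter> space (restrict_space borel (x ` U)) = x ` E"
  proof (rule set_eqI)
    fix u
    have "inv_into U x u \<in> B \<longleftrightarrow> u \<in> x ` E" if "u \<in> x ` U"
    proof
      assume "inv_into U x u \<in> B"
      then have "inv_into U x u \<in> E" using chart(1)[OF c] chart(9)[OF c that] B(2) by blast
      then show "u \<in> x ` E" using chart(8)[OF c that] by (metis imageI)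
    next
      assume "u \<in> x ` E"
      then obtain p where p: "p \<in> E" "u = x p" by blast
      then show "inv_into U x u \<in> B" using chart(7)[OF c, of p] E(2) B(2) by auto
    qed
    then show "u \<in> inv_into U x -` B \<inter> space (restrict_space borel (x ` U)) \<longleftrightarrow> u \<in> x ` E"
      using E(2) by (auto simp: space_restrict_space)
  qed
  ultimately show ?thesis
    using chart(3)[OF c] by (simp add: sets_restrict_space_iff)
qed

lemma open_chart_image:
  assumes c: "(U, x) \<in> \<A>" and T: "open T"
  shows "open (x ` (U \<inter> T))"
proof -
  have "x ` (U \<inter> T) = x ` U \<inter> inv_into U x -` T"
    using chart(7)[OF c] by force
  then show ?thesis
    using continuous_open_preimage[OF chart(5)[OF c] chart(3)[OF c] T] by simp
qed

lemma open_overlap: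
  assumes c: "(U, x) \<in> \<A>" and d: "(V, y) \<in> \<A>"
  shows "open (x ` (U \<inter> V))"
proof -
  obtain T where "open T" "V = S \<inter> T" using chart(2)[OF d] unfolding openin_open by blast
  moreover have "U \<inter> (S \<inter> T) = U \<inter> T" using chart(1)[OF c] by auto
  ultimately show ?thesis using open_chart_image[OF c] by metis
qed

lemma transition:
  assumes c: "(U, x) \<in> \<A>" and d: "(V, y) \<in> \<A>"
  shows "Ck_on k (x ` (U \<inter> V)) (y \<circ> inv_into U x)"
    "\<And>u. u \<in> x ` (U \<inter> V) \<Longrightarrow> det (matrix (Der (y \<circ> inv_into U x) u)) > 0"
proof -
  have "\<forall>(U, x)\<in>\<A>. \<forall>(V, y)\<in>\<A>.
        smooth_on (x ` (U \<inter> V)) (y \<circ> inv_into U x) \<and>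
        (\<forall>u\<in>x ` (U \<inter> V). det (matrix (Der (y \<circ> inv_into U x) u)) > 0)"
    using atlas unfolding oriented_smooth_atlas_def by (elim conjE)
  then have "smooth_on (x ` (U \<inter> V)) (y \<circ> inv_into U x) \<and>
        (\<forall>u\<in>x ` (U \<inter> V). det (matrix (Der (y \<circ> inv_into U x) u)) > 0)"
    using c d by fast
  then show "Ck_on k (x ` (U \<inter> V)) (y \<circ> inv_into U x)"
    "\<And>u. u \<in> x ` (U \<inter> V) \<Longrightarrow> det (matrix (Der (y \<circ> inv_into U x) u)) > 0"
    using smooth_on_imp_Ck_on[OF open_overlap[OF c d]] by auto
qed

lemma immersion_patch:
  assumes "immersion \<A> f" and c: "(U, x) \<in> \<A>"
  shows "patch (x ` U) (f \<circ> inv_into U x)"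
proof
  have "smooth_on (x ` U) (f \<circ> inv_into U x)"
    "\<forall>u\<in>x ` U. inj (Der (f \<circ> inv_into U x) u)"
    using assms by (auto simp: immersion_def)
  then show "Ck_on (Suc (Suc 0)) (x ` U) (f \<circ> inv_into U x)"
    "\<And>u. u \<in> x ` U \<Longrightarrow> inj (Der (f \<circ> inv_into U x) u)"
    using smooth_on_imp_Ck_on chart(3)[OF c] by auto
qed (rule chart(3)[OF c])

lemma chart_change_eq:
  assumes c: "(U, x) \<in> \<A>" and d: "(V, y) \<in> \<A>" and u: "u \<in> x ` (U \<inter> V)"
  shows "(f \<circ> inv_into U x) u = (f \<circ> inv_into V y) ((y \<circ> inv_into U x) u)"
    "(y \<circ> inv_into U x) u \<in> y ` (U \<inter> V)"
    "(x \<circ> inv_into V y) ((y \<circ> inv_into U x) u) = u"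
  using u chart(7)[OF c] chart(7)[OF d] by auto

lemma chart_change_derivative:
  assumes c: "(U, x) \<in> \<A>" and d: "(V, y) \<in> \<A>" and u: "u \<in> x ` (U \<inter> V)"
    and f: "(f \<circ> inv_into V y) differentiable (at ((y \<circ> inv_into U x) u))"
  shows "Der (f \<circ> inv_into U x) u
    = Der (f \<circ> inv_into V y) ((y \<circ> inv_into U x) u)
        \<circ> Der (y \<circ> inv_into U x) u"
proof -
  have "Der (f \<circ> inv_into U x) u
      = Der (\<lambda>u. (f \<circ> inv_into V y) ((y \<circ> inv_into U x) u)) u"
    by (rule frechet_derivative_cong_open[OF open_overlap[OF c d] u])
      (use chart_change_eq(1)[OF c d] in blast)
  also have "\<dots> = (\<lambda>v. Der (f \<circ> inv_into V y) ((y \<circ> inv_into U x) u)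
      (Der (y \<circ> inv_into U x) u v))"
    by (rule frechet_derivative_at[symmetric], rule has_derivative_compose)
      (rule C1_on_has_derivative[OF transition(1)[OF c d] u], rule f[unfolded frechet_derivative_works])
  finally show ?thesis by (simp add: comp_def)
qed

lemma linear_transition:
  assumes c: "(U, x) \<in> \<A>" and d: "(V, y) \<in> \<A>" and u: "u \<in> x ` (U \<inter> V)"
  shows "linear (Der (y \<circ> inv_into U x) u)"
  using C1_on_has_derivative[OF transition(1)[OF c d] u] by (rule has_derivative_linear)

end

section \<open>Area in charts and on the manifold\<close>

locale immersed_manifold = closed_manifold S \<A>
  for S :: "'a::t2_space set" and \<A> :: "('a, 'm::finite) chart set" +
  fixes f :: "'a \<Rightarrow> real ^ 'm option"
  assumes imm: "immersion \<A> f"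
begin

lemmas patch = immersion_patch[OF imm]

text \<open>Chain rule on the overlap: the metric changes by congruence with the Jacobian matrix, so
  after the square root the determinant enters the area density with its absolute value.\<close>

lemma
  assumes c: "(U, x) \<in> \<A>" and d: "(V, y) \<in> \<A>" and u: "u \<in> x ` (U \<inter> V)"
  defines "\<tau> \<equiv> y \<circ> inv_into U x"
  shows df_chart_change: "Der (f \<circ> inv_into U x) u
      = Der (f \<circ> inv_into V y) (\<tau> u) \<circ> Der \<tau> u"
    and metric_chart_change: "metric (f \<circ> inv_into U x) u
      = transpose (matrix (Der \<tau> u))
        ** (metric (f \<circ> inv_into V y) (\<tau> u) ** matrix (Der \<tau> u))"
    and area_chart_change: "area_density (f \<circ> inv_into U x) u
      = \<bar>det (matrix (Der \<tau> u))\<bar> * area_density (f \<circ> inv_into V y) (\<tau> u)"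
proof -
  interpret Q: patch "y ` V" "f \<circ> inv_into V y" by (rule patch[OF d])
  have tu: "\<tau> u \<in> y ` V" using chart_change_eq(2)[OF c d u] by (auto simp: \<tau>_def)
  have "(f \<circ> inv_into V y) differentiable (at (\<tau> u))"
    using C1_on_has_derivative[OF Q.C1_psi tu] by (auto simp: differentiable_def)
  then show df: "Der (f \<circ> inv_into U x) u
      = Der (f \<circ> inv_into V y) (\<tau> u) \<circ> Der \<tau> u"
    unfolding \<tau>_def by (rule chart_change_derivative[OF c d u])
  show m: "metric (f \<circ> inv_into U x) u
      = transpose (matrix (Der \<tau> u))
        ** (metric (f \<circ> inv_into V y) (\<tau> u) ** matrix (Der \<tau> u))"
    unfolding df by (rule gram_compose[OF Q.lin[OF tu]]) (simp add: \<tau>_def linear_transition[OF c d u])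
  show "area_density (f \<circ> inv_into U x) u
      = \<bar>det (matrix (Der \<tau> u))\<bar> * area_density (f \<circ> inv_into V y) (\<tau> u)"
    unfolding area_density_eq m
    by (simp add: det_mul det_transpose real_sqrt_mult mult.assoc[symmetric])
qed

text \<open>Extended by zero because the values of \<open>area_density\<close> off the chart image
  are arbitrary, while the change of variables works with Borel functions on the whole
  space.\<close>

definition chart_density :: "('a, 'm) chart \<Rightarrow> real ^ 'm \<Rightarrow> real" where
  "chart_density c u = (if u \<in> snd c ` fst c then area_density (f \<circ> inv_into (fst c) (snd c)) u else 0)"

lemma chart_density_nonneg: "c \<in> \<A> \<Longrightarrow> chart_density c u \<ge> 0"
  using patch.area_pos[OF patch, of "fst c" "snd c" u] by (simp add: chart_density_def less_imp_le)

lemma chart_density_measurable: "c \<in> \<A> \<Longrightarrow> chart_density c \<in> borel_measurable borel"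
proof -
  assume c: "c \<in> \<A>"
  then interpret patch "snd c ` fst c" "f \<circ> inv_into (fst c) (snd c)" by (intro patch) simp
  show ?thesis
    unfolding chart_density_def
    using C1_on_imp_continuous_on[OF C1_area] open_dom
    by (subst measurable_If_restrict_space_iff)
      (auto intro!: borel_measurable_continuous_on_restrict)
qed

definition chart_measure :: "('a, 'm) chart \<Rightarrow> (real ^ 'm) measure" where
  "chart_measure c = density lborel (\<lambda>u. ennreal (chart_density c u))"

lemma emeasure_chart_measure:
  assumes c: "(U, x) \<in> \<A>" and E: "E \<in> sets \<BB>" "E \<subseteq> U"
  shows "emeasure (chart_measure (U, x)) (x ` E)
    = (\<integral>\<^sup>+u\<in>x ` E. ennreal (area_density (f \<circ> inv_into U x) u) \<partial>lborel)"
proof -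
  have "emeasure (chart_measure (U, x)) (x ` E) = (\<integral>\<^sup>+u\<in>x ` E. ennreal (chart_density (U, x) u) \<partial>lborel)"
    using sets_chart_image[OF assms] chart_density_measurable[OF c]
    by (simp add: chart_measure_def emeasure_density)
  also have "\<dots> = (\<integral>\<^sup>+u\<in>x ` E. ennreal (area_density (f \<circ> inv_into U x) u) \<partial>lborel)"
    using E(2) by (intro nn_integral_cong) (auto simp: chart_density_def indicator_def)
  finally show ?thesis .
qed

text \<open>The Jacobian factor in \<open>area_chart_change\<close> is precisely the one in the
  change of variables formula.\<close>

lemma chart_measure_change:
  assumes c: "(U, x) \<in> \<A>" and d: "(V, y) \<in> \<A>" and E: "E \<in> sets \<BB>" "E \<subseteq> U \<inter> V"
  shows "emeasure (chart_measure (U, x)) (x ` E) = emeasure (chart_measure (V, y)) (y ` E)"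
proof -
  let ?\<tau> = "y \<circ> inv_into U x"
  have img: "?\<tau> ` x ` E = y ` E"
    using E(2) chart(7)[OF c] by (force simp: image_image)
  have "(\<integral>\<^sup>+v\<in>?\<tau> ` x ` E. ennreal (chart_density (V, y) v) \<partial>lborel)
      = (\<integral>\<^sup>+u\<in>x ` E. ennreal (chart_density (U, x) u) \<partial>lborel)"
  proof (rule nn_integral_change_of_variables[where g' = "\<lambda>u. Der ?\<tau> u"])
    show "x ` E \<in> sets borel" "?\<tau> ` x ` E \<in> sets borel"
      unfolding img using sets_chart_image[OF c E(1)] sets_chart_image[OF d E(1)] E(2) by auto
    have sub: "x ` E \<subseteq> x ` (U \<inter> V)" using E(2) by auto
    show "(?\<tau> has_derivative Der ?\<tau> u) (at u)" if "u \<in> x ` E" for u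
      using that sub by (intro C1_on_has_derivative[OF transition(1)[OF c d]]) auto
    show "inj_on ?\<tau> (x ` E)"
      using chart_change_eq(3)[OF c d] sub by (metis inj_on_inverseI inj_on_subset)
    show "chart_density (U, x) u = \<bar>det (matrix (Der ?\<tau> u))\<bar> * chart_density (V, y) (?\<tau> u)"
      if "u \<in> x ` E" for u
    proof -
      have u: "u \<in> x ` (U \<inter> V)" using that sub by auto
      then have "u \<in> x ` U" "?\<tau> u \<in> y ` V" using chart_change_eq(2)[OF c d u] by auto
      then show ?thesis using area_chart_change[OF c d u] by (simp add: chart_density_def)
    qed
  qed (use c d chart_density_nonneg chart_density_measurable in auto)
  then have "(\<integral>\<^sup>+v\<in>y ` E. ennreal (chart_density (V, y) v) \<partial>lborel)
      = (\<integral>\<^sup>+u\<in>x ` E. ennreal (chart_density (U, x) u) \<partial>lborel)"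
    unfolding img .
  then show ?thesis
    using sets_chart_image[OF c E(1)] sets_chart_image[OF d E(1)] E(2)
      chart_density_measurable[OF c] chart_density_measurable[OF d]
    by (simp add: chart_measure_def emeasure_density)
qed

lemma finite_chart_cover:
  obtains n :: nat and c :: "nat \<Rightarrow> ('a, 'm) chart"
  where "\<And>i. i < n \<Longrightarrow> c i \<in> \<A>" "(\<Union>i<n. fst (c i)) = S"
proof -
  have "\<exists>T. open T \<and> fst c = S \<inter> T" if "c \<in> \<A>" for c
    using that chart(2)[of "fst c" "snd c"] unfolding openin_open prod.collapse by blast
  then obtain T where T: "\<And>c. c \<in> \<A> \<Longrightarrow> open (T c) \<and> fst c = S \<inter> T c" by metis
  have "S \<subseteq> (\<Union>c\<in>\<A>. T c)"
  proof
    fix p assume "p \<in> S"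
    then obtain U x where "(U, x) \<in> \<A>" "p \<in> U" using charts_cover by blast
    then show "p \<in> (\<Union>c\<in>\<A>. T c)" using T[of "(U, x)"] by auto
  qed
  then obtain F where F: "F \<subseteq> \<A>" "finite F" "S \<subseteq> (\<Union>c\<in>F. T c)"
    using compactE_image[OF compact, of \<A> T] T by metis
  obtain n :: nat and c where c: "F = c ` {..<n}"
    using finite_imp_nat_seg_image_inj_on[OF F(2)] by (metis lessThan_def)
  show ?thesis
  proof (rule that[of n c])
    show "c i \<in> \<A>" if "i < n" for i using that c F(1) by auto
    have "(\<Union>i<n. fst (c i)) = (\<Union>d\<in>F. fst d)" by (simp add: c)
    also have "\<dots> = S" using F T by blast
    finally show "(\<Union>i<n. fst (c i)) = S" .
  qed
qed

text \<open>The condition under \<open>THE\<close> in \<open>area_measure\<close>, named in order to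
  prove that exactly one measure satisfies it.\<close>

definition is_area_measure :: "'a measure \<Rightarrow> bool" where
  "is_area_measure M \<longleftrightarrow> sets M = sets \<BB> \<and>
    (\<forall>(U, x)\<in>\<A>. \<forall>E\<in>sets M. E \<subseteq> U \<longrightarrow>
       emeasure M E = (\<integral>\<^sup>+u\<in>x ` E. ennreal (area_density (f \<circ> inv_into U x) u) \<partial>lborel))"

lemma is_area_measureD:
  assumes "is_area_measure M"
  shows "sets M = sets \<BB>" "space M = S"
    "\<And>U x E. \<lbrakk>(U, x) \<in> \<A>; E \<in> sets \<BB>; E \<subseteq> U\<rbrakk> \<Longrightarrow> emeasure M E = emeasure (chart_measure (U, x)) (x ` E)"
proof -
  show s: "sets M = sets \<BB>" using assms by (simp add: is_area_measure_def)
  show "space M = S" using sets_eq_imp_space_eq[OF s] by (simp add: space_restrict_space)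
  fix U x E assume a: "(U, x) \<in> \<A>" "E \<in> sets \<BB>" "E \<subseteq> U"
  then show "emeasure M E = emeasure (chart_measure (U, x)) (x ` E)"
    unfolding emeasure_chart_measure[OF a] using assms s by (fastforce simp: is_area_measure_def)
qed

text \<open>A finite chart cover is cut into disjoint Borel pieces, each inside one chart.
  Additivity over the pieces determines the measure, and summing chart measures over them defines
  it; by \<open>chart_measure_change\<close> every other chart sees the same values.\<close>

theorem ex1_area_measure: "\<exists>!M. is_area_measure M"
proof -
  obtain n :: nat and c where c: "\<And>i. i < n \<Longrightarrow> c i \<in> \<A>" "(\<Union>i<n. fst (c i)) = S"
    using finite_chart_cover by blast
  define D where "D i = fst (c i) - (\<Union>j<i. fst (c j))" for i
  have Dsub: "D i \<subseteq> fst (c i)" for i by (auto simp: D_def)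
  have cc: "(fst (c i), snd (c i)) \<in> \<A>" if "i < n" for i using c(1)[OF that] by simp
  have Dm: "D i \<in> sets \<BB>" if "i < n" for i
    unfolding D_def using that by (intro sets.Diff sets.finite_UN sets_chart[OF cc]) auto
  have disj: "disjoint_family_on D {..<n}"
    unfolding disjoint_family_on_def D_def by (force simp: not_less_iff_gr_or_eq dest: linorder_neqE_nat)
  have Dcov: "(\<Union>i<n. D i) = S"
  proof -
    have "\<exists>i<n. p \<in> D i" if "p \<in> S" for p
    proof -
      have "\<exists>i. i < n \<and> p \<in> fst (c i)" using that c(2) by auto
      then obtain i where i: "i < n" "p \<in> fst (c i)" "\<And>j. j < i \<Longrightarrow> \<not> (j < n \<and> p \<in> fst (c j))"
        using exists_least_iff[of "\<lambda>i. i < n \<and> p \<in> fst (c i)"] by blast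
      then have "p \<in> D i" using less_trans unfolding D_def by blast
      with i show ?thesis by blast
    qed
    moreover have "D i \<subseteq> S" if "i < n" for i using Dsub chart(1)[OF cc[OF that]] by blast
    ultimately show ?thesis by blast
  qed
  have Ei: "E \<inter> D i \<in> sets \<BB>" "E \<inter> D i \<subseteq> fst (c i)" "snd (c i) ` (E \<inter> D i) \<in> sets borel"
    if "E \<in> sets \<BB>" "i < n" for E i
    using that Dm Dsub sets_chart_image[OF cc[OF that(2)], of "E \<inter> D i"] by blast+
  define \<mu> where "\<mu> E = (\<Sum>i<n. emeasure (chart_measure (c i)) (snd (c i) ` (E \<inter> D i)))" for E
  let ?M = "measure_of S (sets \<BB>) \<mu>"
  have sp: "space \<BB> = S" by (simp add: space_restrict_space)
  have alg: "sigma_algebra S (sets \<BB>)" using sets.sigma_algebra_axioms[of \<BB>] by (simp only: sp)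
  have ca: "countably_additive (sets \<BB>) \<mu>"
  proof (rule countably_additiveI)
    fix E :: "nat \<Rightarrow> 'a set"
    assume E: "range E \<subseteq> sets \<BB>" "disjoint_family E"
    have 1: "(\<Sum>k. emeasure (chart_measure (c i)) (snd (c i) ` (E k \<inter> D i)))
        = emeasure (chart_measure (c i)) (snd (c i) ` ((\<Union>k. E k) \<inter> D i))" if i: "i < n" for i
    proof -
      have "(\<Sum>k. emeasure (chart_measure (c i)) (snd (c i) ` (E k \<inter> D i)))
          = emeasure (chart_measure (c i)) (\<Union>k. snd (c i) ` (E k \<inter> D i))"
      proof (rule suminf_emeasure)
        show "range (\<lambda>k. snd (c i) ` (E k \<inter> D i)) \<subseteq> sets (chart_measure (c i))"
          using Ei(3)[OF _ i] E(1) by (auto simp: chart_measure_def)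
        show "disjoint_family (\<lambda>k. snd (c i) ` (E k \<inter> D i))"
          using E(2) chart(6)[OF cc[OF i]] Dsub[of i]
          unfolding disjoint_family_on_def inj_on_def by blast
      qed
      also have "(\<Union>k. snd (c i) ` (E k \<inter> D i)) = snd (c i) ` ((\<Union>k. E k) \<inter> D i)" by blast
      finally show ?thesis .
    qed
    have "(\<Sum>k. \<mu> (E k)) = (\<Sum>i<n. \<Sum>k. emeasure (chart_measure (c i)) (snd (c i) ` (E k \<inter> D i)))"
      unfolding \<mu>_def by (rule suminf_sum) auto
    also have "\<dots> = \<mu> (\<Union>k. E k)" unfolding \<mu>_def by (rule sum.cong[OF refl]) (simp add: 1)
    finally show "(\<Sum>k. \<mu> (E k)) = \<mu> (\<Union>k. E k)" .
  qed
  have em: "emeasure ?M E = \<mu> E" if "E \<in> sets \<BB>" for E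
    by (rule emeasure_measure_of_sigma[OF alg _ ca that]) (simp add: positive_def \<mu>_def)
  have sM: "sets ?M = sets \<BB>"
    using sigma_algebra.sets_measure_of_eq[OF alg] by simp
  have M: "is_area_measure ?M"
    unfolding is_area_measure_def
  proof (intro conjI ballI impI, rule sM, clarify)
    fix V y E assume d: "(V, y) \<in> \<A>" and "E \<in> sets ?M" and EV: "E \<subseteq> V"
    then have E: "E \<in> sets \<BB>" by (simp only: sM)
    have "emeasure ?M E = (\<Sum>i<n. emeasure (chart_measure (V, y)) (y ` (E \<inter> D i)))"
      unfolding em[OF E] \<mu>_def
    proof (rule sum.cong[OF refl])
      fix i assume "i \<in> {..<n}"
      then have i: "i < n" by simp
      show "emeasure (chart_measure (c i)) (snd (c i) ` (E \<inter> D i)) = emeasure (chart_measure (V, y)) (y ` (E \<inter> D i))"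
        using chart_measure_change[OF cc[OF i] d Ei(1)[OF E i]] Ei(2)[OF E i] EV by auto
    qed
    also have "\<dots> = emeasure (chart_measure (V, y)) (\<Union>i<n. y ` (E \<inter> D i))"
    proof (rule sum_emeasure)
      show "(\<lambda>i. y ` (E \<inter> D i)) ` {..<n} \<subseteq> sets (chart_measure (V, y))"
        using sets_chart_image[OF d] Ei(1)[OF E] EV by (auto simp: chart_measure_def)
      show "disjoint_family_on (\<lambda>i. y ` (E \<inter> D i)) {..<n}"
        using disj chart(6)[OF d] EV unfolding disjoint_family_on_def inj_on_def by blast
    qed simp
    also have "(\<Union>i<n. y ` (E \<inter> D i)) = y ` E"
      using Dcov EV chart(1)[OF d] by blast
    finally show "emeasure ?M E = (\<integral>\<^sup>+u\<in>y ` E. ennreal (area_density (f \<circ> inv_into V y) u) \<partial>lborel)"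
      using emeasure_chart_measure[OF d E EV] by simp
  qed
  show ?thesis
  proof (rule ex1I[of is_area_measure, OF M])
    fix M' assume M': "is_area_measure M'"
    note D' = is_area_measureD[OF M']
    show "M' = ?M"
    proof (rule measure_eqI)
      show "sets M' = sets ?M" by (simp only: sM D')
      fix E assume "E \<in> sets M'"
      then have E: "E \<in> sets \<BB>" by (simp only: D')
      have "emeasure M' E = emeasure M' (\<Union>i<n. E \<inter> D i)"
        using Dcov sets.sets_into_space[OF E] by (intro arg_cong[where f = "emeasure M'"]) (auto simp: sp)
      also have "\<dots> = (\<Sum>i<n. emeasure M' (E \<inter> D i))"
        using disj Ei(1)[OF E] by (intro sum_emeasure[symmetric]) (auto simp: D'(1) disjoint_family_on_def)
      also have "\<dots> = (\<Sum>i<n. emeasure (chart_measure (c i)) (snd (c i) ` (E \<inter> D i)))"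
        using D'(3)[OF cc Ei(1)[OF E] Ei(2)[OF E]] by (intro sum.cong refl) auto
      finally show "emeasure M' E = emeasure ?M E" by (simp add: em[OF E] \<mu>_def)
    qed
  qed
qed

lemma area_measure: "is_area_measure (area_measure S \<A> f)"
  using theI'[OF ex1_area_measure] unfolding area_measure_def is_area_measure_def .

end

section \<open>Invariance under change of charts\<close>

text \<open>The change of basis that acts by \<open>M\<close> on the tangent columns of a frame and
  fixes the normal column.\<close>

definition option_block :: "real ^ 'm::finite ^ 'm \<Rightarrow> real ^ 'm option ^ 'm option" where
  "option_block M = (\<chi> r c. case r of
     None \<Rightarrow> (case c of None \<Rightarrow> 1 | Some j \<Rightarrow> 0)
   | Some i \<Rightarrow> (case c of None \<Rightarrow> 0 | Some j \<Rightarrow> M $ i $ j))"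

text \<open>A permutation that moves \<open>None\<close> picks a zero entry in that row. The
  remaining ones permute the \<open>Some\<close> indices and correspond, with equal sign, to the
  permutations of \<open>'m\<close>.\<close>

lemma det_option_block:
  fixes M :: "real ^ 'm::finite ^ 'm"
  shows "det (option_block M) = det M"
proof -
  let ?N = "option_block M" and ?S = "range (Some :: 'm \<Rightarrow> 'm option)"
  let ?t = "\<lambda>p. of_int (sign p) * (\<Prod>i\<in>UNIV. ?N $ i $ p i)"
  have "(\<Sum>p\<in>{p. p permutes UNIV}. ?t p) = (\<Sum>p\<in>{p. p permutes ?S}. ?t p)"
  proof (rule sum.mono_neutral_right)
    show "{p. p permutes ?S} \<subseteq> {p. p permutes UNIV}" using permutes_subset by blast
    show "\<forall>p\<in>{p. p permutes UNIV} - {p. p permutes ?S}. ?t p = 0"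
    proof
      fix p assume p: "p \<in> {p. p permutes (UNIV :: 'm option set)} - {p. p permutes ?S}"
      have "p None \<noteq> None"
      proof
        assume "p None = None"
        then have "p x = x" if "x \<notin> ?S" for x using that by (cases x) auto
        moreover have "p permutes UNIV" using p by simp
        ultimately have "p permutes ?S" by (metis DiffD2 permutes_superset)
        with p show False by simp
      qed
      then have "?N $ None $ p None = 0" by (auto simp: option_block_def split: option.split)
      then have "(\<Prod>i\<in>UNIV. ?N $ i $ p i) = 0" by (intro prod_zero) auto
      then show "?t p = 0" by simp
    qed
  qed simp
  also have "\<dots> = (\<Sum>p\<in>{p. p permutes (UNIV :: 'm set)}. of_int (sign p) * (\<Prod>i\<in>UNIV. M $ i $ p i))"
  proof (rule sum.reindex_bij_witness[where i = "map_permutation UNIV Some" and j = "map_permutation ?S the"])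
    fix p :: "'m option \<Rightarrow> 'm option" assume "p \<in> {p. p permutes ?S}"
    then have p: "p permutes ?S" by simp
    have bt: "bij_betw the ?S UNIV" by (auto simp: bij_betw_def inj_on_def image_iff)
    show "map_permutation UNIV Some (map_permutation ?S the p) = p"
      by (rule map_permutation_compose_inv[OF bt p]) auto
    show q: "map_permutation ?S the p \<in> {p. p permutes UNIV}"
      using map_permutation_permutes[OF bt p] by simp
    have ap: "map_permutation ?S the p i = the (p (Some i))" for i
      using map_permutation_apply[of the ?S "Some i" p] bt by (simp add: bij_betw_def)
    have pS: "p (Some i) = Some (the (p (Some i)))" for i
      using permutes_in_image[OF p, of "Some i"] by auto
    have pN: "p None = None" using permutes_not_in[OF p] by auto
    have "(\<Prod>i\<in>UNIV. ?N $ i $ p i) = ?N $ None $ p None * (\<Prod>i\<in>UNIV. ?N $ Some i $ p (Some i))"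
      by (simp add: UNIV_option_conv prod.reindex)
    also have "\<dots> = (\<Prod>i\<in>UNIV. M $ i $ the (p (Some i)))"
    proof -
      have "?N $ Some i $ p (Some i) = M $ i $ the (p (Some i))" for i
        by (subst pS) (simp add: option_block_def)
      then show ?thesis by (simp add: pN option_block_def)
    qed
    finally show "of_int (sign (map_permutation ?S the p)) * (\<Prod>i\<in>UNIV. M $ i $ map_permutation ?S the p i) = ?t p"
      using sign_map_permutation[of the ?S p] bt p by (simp add: ap bij_betw_def)
  next
    fix p :: "'m \<Rightarrow> 'm" assume "p \<in> {p. p permutes UNIV}"
    then have p: "p permutes UNIV" by simp
    have bs: "bij_betw Some (UNIV :: 'm set) ?S" by (simp add: bij_betw_def)
    show "map_permutation ?S the (map_permutation UNIV Some p) = p"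
      by (rule map_permutation_compose_inv[OF bs p]) auto
    show "map_permutation UNIV Some p \<in> {p. p permutes ?S}"
      using map_permutation_permutes[OF bs p] by simp
  qed
  finally show ?thesis by (simp add: det_def)
qed

lemma frame_compose:
  fixes g :: "real ^ 'm::finite \<Rightarrow> real ^ 'm option"
  assumes "linear g"
  shows "frame (g \<circ> h) v = frame g v ** option_block (matrix h)"
proof -
  have "(frame g v ** option_block (matrix h)) $ r $ c = frame (g \<circ> h) v $ r $ c" for r c
  proof (cases c)
    case None
    then show ?thesis
      by (simp add: matrix_matrix_mult_def frame_def option_block_def UNIV_option_conv sum.reindex)
  next
    case (Some j)
    have "g (h (axis j 1)) $ r = (\<Sum>i\<in>UNIV. h (axis j 1) $ i * g (axis i 1) $ r)"
      by (subst linear_vec_sum[OF assms]) simp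
    with Some show ?thesis
      by (simp add: matrix_matrix_mult_def frame_def option_block_def UNIV_option_conv sum.reindex
          matrix_def mult.commute)
  qed
  then show ?thesis by (simp add: vec_eq_iff)
qed

text \<open>The composed map has the same tangent hyperplane, and \<open>det (matrix h) > 0\<close>
  preserves the orientation of the frame; uniqueness of the oriented normal does the rest.\<close>

lemma unit_normal_compose:
  fixes g :: "real ^ 'm::finite \<Rightarrow> real ^ 'm option"
  assumes g: "linear g" "inj g" and h: "linear h" "det (matrix h) > 0"
  shows "unit_normal (g \<circ> h) = unit_normal g"
proof (rule sym, rule unit_normal_unique)
  have "inj h" using h by (metis less_irrefl det_nz_iff_inj)
  then show "linear (g \<circ> h)" "inj (g \<circ> h)" using g h by (auto simp: linear_compose inj_compose)
  show "norm (unit_normal g) = 1" "unit_normal g \<bullet> (g \<circ> h) v = 0" for v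
    using unit_normal_props[OF g] by auto
  show "det (frame (g \<circ> h) (unit_normal g)) > 0"
    using unit_normal_props(5)[OF g] h(2) by (simp add: frame_compose[OF g(1)] det_mul det_option_block)
qed

text \<open>\<open>N *v z\<close> solves the same linear system as
  \<open>cramer_inverse M *v a\<close>. In geometric terms, the inner product of two covectors in
  the inverse metric does not depend on the coordinates: the components change by
  \<open>transpose N\<close> and the metric by congruence with \<open>N\<close>.\<close>

lemma cramer_inverse_congruence:
  fixes M N :: "real ^ 'm::finite ^ 'm"
  assumes M: "det M \<noteq> 0" and N: "det N \<noteq> 0"
  shows "(cramer_inverse (transpose N ** (M ** N)) *v (transpose N *v a)) \<bullet> (transpose N *v b)
    = (cramer_inverse M *v a) \<bullet> b"
proof -
  let ?G = "transpose N ** (M ** N)"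
  have G: "det ?G \<noteq> 0" using M N by (simp add: det_mul det_transpose)
  define z where "z = cramer_inverse ?G *v (transpose N *v a)"
  have "?G *v z = transpose N *v a"
    by (simp add: z_def matrix_vector_mul_assoc cramer_inverse_right[OF G])
  then have eq: "transpose N *v (M *v (N *v z)) = transpose N *v a"
    by (simp add: matrix_vector_mul_assoc matrix_mul_assoc)
  have "inj ((*v) (transpose N))"
    using N by (simp add: inj_matrix_vector_mult invertible_det_nz det_transpose)
  from injD[OF this eq] have "M *v (N *v z) = a" .
  then have "N *v z = cramer_inverse M *v a"
    by (metis cramer_inverse_left[OF M] matrix_vector_mul_assoc matrix_vector_mul_lid)
  moreover have "z \<bullet> (transpose N *v b) = (N *v z) \<bullet> b"
    by (metis dot_lmul_matrix transpose_matrix_vector inner_commute)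
  ultimately show ?thesis by (simp add: z_def)
qed

lemma gradient_compose:
  fixes l :: "real ^ 'm::finite \<Rightarrow> real" and h :: "real ^ 'm \<Rightarrow> real ^ 'm"
  assumes "linear l"
  shows "(\<chi> i. l (h (axis i 1))) = transpose (matrix h) *v (\<chi> i. l (axis i 1))"
proof -
  have "l (h (axis i 1)) = (\<Sum>k\<in>UNIV. h (axis i 1) $ k * l (axis k 1))" for i
    using linear_vec_sum[OF assms, of "h (axis i 1)"] by simp
  then show ?thesis
    by (simp add: vec_eq_iff matrix_vector_mult_def transpose_def matrix_def)
qed

context immersed_manifold
begin

lemma normal_chart_change:
  assumes c: "(U, x) \<in> \<A>" and d: "(V, y) \<in> \<A>" and u: "u \<in> x ` (U \<inter> V)"
  shows "nrm (f \<circ> inv_into U x) u = nrm (f \<circ> inv_into V y) ((y \<circ> inv_into U x) u)"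
proof -
  interpret Q: patch "y ` V" "f \<circ> inv_into V y" by (rule patch[OF d])
  have tu: "(y \<circ> inv_into U x) u \<in> y ` V" using chart_change_eq(2)[OF c d u] by auto
  show ?thesis
    unfolding df_chart_change[OF c d u]
    by (rule unit_normal_compose[OF Q.lin[OF tu] Q.inj[OF tu] linear_transition[OF c d u]
          transition(2)[OF c d u]])
qed

text \<open>The normals agree by the orientation of the atlas, so the two shape operators are
  conjugate by the derivative of the transition map, and the trace is a conjugation
  invariant.\<close>

lemma mean_curv_chart_change:
  assumes c: "(U, x) \<in> \<A>" and d: "(V, y) \<in> \<A>" and u: "u \<in> x ` (U \<inter> V)"
  shows "mean_curv (f \<circ> inv_into U x) u = mean_curv (f \<circ> inv_into V y) ((y \<circ> inv_into U x) u)"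
proof -
  interpret P: patch "x ` U" "f \<circ> inv_into U x" by (rule patch[OF c])
  interpret Q: patch "y ` V" "f \<circ> inv_into V y" by (rule patch[OF d])
  define \<tau> where "\<tau> = y \<circ> inv_into U x"
  let ?T = "Der \<tau> u"
  have tu: "\<tau> u \<in> y ` V" and uU: "u \<in> x ` U"
    using chart_change_eq(2)[OF c d u] u by (auto simp: \<tau>_def)
  have T: "linear ?T" "det (matrix ?T) > 0"
    using linear_transition[OF c d u] transition(2)[OF c d u] by (auto simp: \<tau>_def)
  then have "inj ?T" by (metis less_irrefl det_nz_iff_inj)
  then obtain T' where T': "linear T'" "\<And>v. T' (?T v) = v" "\<And>v. ?T (T' v) = v"
    using linear_injective_isomorphism[OF T(1)] by blast
  let ?By = "shape_operator (f \<circ> inv_into V y) (\<tau> u)"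
  note By = Q.shape_operator_props[OF tu]
  have dn: "P.dnormal u = Q.dnormal (\<tau> u) \<circ> ?T"
  proof -
    have "P.dnormal u = Der (\<lambda>w. nrm (f \<circ> inv_into V y) (\<tau> w)) u"
      unfolding \<tau>_def by (rule frechet_derivative_cong_open[OF open_overlap[OF c d] u]) (rule normal_chart_change[OF c d])
    also have "\<dots> = (\<lambda>v. Q.dnormal (\<tau> u) (?T v))"
      by (rule frechet_derivative_at[symmetric], rule has_derivative_compose)
        (unfold \<tau>_def, rule C1_on_has_derivative[OF transition(1)[OF c d] u],
          fold \<tau>_def, rule C1_on_has_derivative[OF Q.C1_normal tu])
    finally show ?thesis by (simp add: comp_def)
  qed
  have lB: "linear (T' \<circ> ?By \<circ> ?T)" using T(1) T'(1) By(2) by (intro linear_compose)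
  have "shape_operator (f \<circ> inv_into U x) u = T' \<circ> ?By \<circ> ?T"
  proof (rule P.shape_operator_eqI[OF uU lB])
    show "Der (f \<circ> inv_into U x) u ((T' \<circ> ?By \<circ> ?T) v) = - P.dnormal u v" for v
      unfolding df_chart_change[OF c d u, folded \<tau>_def] dn by (simp add: T' By(3))
  qed
  then have "mean_curv (f \<circ> inv_into U x) u = trace (matrix (T' \<circ> ?By \<circ> ?T))"
    by (simp add: mean_curv_def)
  also have "\<dots> = trace (matrix T' ** (matrix ?By ** matrix ?T))"
    using T(1) T'(1) By(2) by (simp add: matrix_compose linear_compose matrix_mul_assoc)
  also have "\<dots> = trace ((matrix ?By ** matrix ?T) ** matrix T')" by (rule trace_mul_sym)
  also have "\<dots> = trace (matrix ?By ** matrix (?T \<circ> T'))"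
    using T(1) T'(1) by (simp add: matrix_compose matrix_mul_assoc)
  also have "?T \<circ> T' = id" using T'(3) by auto
  finally show ?thesis by (simp only: mean_curv_def \<tau>_def matrix_id_mat_1 matrix_mul_rid)
qed

section \<open>Mean curvature and integrals read in a chart\<close>

lemma some_chart:
  assumes "p \<in> S"
  obtains V y where "(SOME c. c \<in> \<A> \<and> p \<in> fst c) = (V, y)" "(V, y) \<in> \<A>" "p \<in> V"
proof -
  obtain U x where "(U, x) \<in> \<A>" "p \<in> U" using charts_cover[OF assms] by blast
  then have "\<exists>c. c \<in> \<A> \<and> p \<in> fst c" by force
  note some = someI_ex[OF this]
  obtain V y where e: "(SOME c. c \<in> \<A> \<and> p \<in> fst c) = (V, y)" by (rule prod.exhaust)
  show ?thesis by (rule that[OF e]) (use some e in auto)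
qed

lemma mean_curvature_chart:
  assumes c: "(U, x) \<in> \<A>" and p: "p \<in> U"
  shows "mean_curvature \<A> f p = mean_curv (f \<circ> inv_into U x) (x p)"
proof -
  have "p \<in> S" using c p chart(1) by blast
  then obtain V y where s: "(SOME c. c \<in> \<A> \<and> p \<in> fst c) = (V, y)" and d: "(V, y) \<in> \<A>" "p \<in> V"
    by (rule some_chart)
  have "mean_curvature \<A> f p = mean_curv (f \<circ> inv_into V y) (y p)"
    by (simp add: mean_curvature_def s mean_curv_def)
  also have "\<dots> = mean_curv (f \<circ> inv_into V y) ((y \<circ> inv_into U x) (x p))"
    using chart(7)[OF c p] by simp
  also have "\<dots> = mean_curv (f \<circ> inv_into U x) (x p)"
    by (rule mean_curv_chart_change[OF c d(1), symmetric]) (use p d(2) in auto)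
  finally show ?thesis .
qed

text \<open>On \<open>U\<close> the area measure is the push-forward of \<open>chart_measure\<close>
  under the inverse chart. The support condition makes density times integrand, extended by zero,
  continuous with compact support and hence integrable.\<close>

lemma integral_chart:
  assumes c: "(U, x) \<in> \<A>" and F: "continuous_on UNIV F"
    and K: "compact K" "K \<subseteq> x ` U" "\<And>u. u \<notin> K \<Longrightarrow> F u = 0"
  defines "h \<equiv> \<lambda>p. if p \<in> U then F (x p) else 0"
  shows "integrable (area_measure S \<A> f) h"
    and "(\<integral>p. h p \<partial>area_measure S \<A> f) = (\<integral>u. chart_density (U, x) u * F u \<partial>lborel)"
proof -
  let ?M = "area_measure S \<A> f"
  note M = is_area_measureD[OF area_measure]
  interpret patch "x ` U" "f \<circ> inv_into U x" by (rule patch[OF c])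
  have sp: "space \<BB> = S" by (simp add: space_restrict_space)
  have dens: "chart_density (U, x) \<in> borel_measurable borel" "\<And>u. chart_density (U, x) u \<ge> 0"
    using chart_density_measurable[OF c] chart_density_nonneg[OF c] by auto
  have US: "U \<in> sets \<BB>" by (rule sets_chart[OF c])
  have hm: "h \<in> borel_measurable \<BB>"
  proof -
    have "(\<lambda>p. F (x p)) \<in> borel_measurable (restrict_space borel U)"
      by (intro borel_measurable_continuous_on_restrict continuous_on_compose2[OF F chart(4)[OF c]]) simp
    moreover have "S \<in> sets borel" using compact by (intro borel_closed compact_imp_closed)
    then have "U \<in> sets borel" "S \<in> sets borel"
      using US by (simp_all add: sets_restrict_space_iff)
    then have "restrict_space \<BB> {p. p \<in> U} = restrict_space borel U"
      using chart(1)[OF c] by (simp add: restrict_restrict_space Int_absorb1)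
    ultimately show ?thesis
      unfolding h_def using US chart(1)[OF c]
      by (subst measurable_If_restrict_space_iff) (auto simp: sp Int_def[symmetric] Int_absorb1)
  qed
  have int_dF: "integrable lborel (\<lambda>u. chart_density (U, x) u * F u)"
  proof (rule compact_support_integrable[OF _ K(1)])
    have "continuous_on (x ` U) (\<lambda>u. chart_density (U, x) u * F u)"
      using C1_on_imp_continuous_on[OF C1_area] continuous_on_subset[OF F]
      by (subst continuous_on_cong[OF refl, of _ _ "\<lambda>u. area_density (f \<circ> inv_into U x) u * F u"])
        (auto simp: chart_density_def intro!: continuous_on_mult)
    then show "continuous_on UNIV (\<lambda>u. chart_density (U, x) u * F u)"
      by (rule continuous_on_zero_extension[OF open_dom _ K(1,2)]) (simp add: K(3))
  qed (simp add: K(3))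
  have "integrable ?M h \<and> (\<integral>p. h p \<partial>?M) = (\<integral>u. chart_density (U, x) u * F u \<partial>lborel)"
  proof (cases "U = {}")
    case True
    then have "K = {}" using K(2) by auto
    then have "F = (\<lambda>_. 0)" using K(3) by auto
    then show ?thesis using True by (simp add: h_def)
  next
    case False
    then obtain q where q: "q \<in> U" by blast
    \<comment> \<open>A total version of the inverse chart. The default point \<open>q\<close> keeps
      its values in \<open>U\<close>, and the chart measure gives no mass to the points where the
      default is taken.\<close>
    define T where "T u = (if u \<in> x ` U then inv_into U x u else q)" for u
    have T: "T \<in> borel \<rightarrow>\<^sub>M \<BB>"
    proof -
      have "T \<in> borel_measurable borel"
        unfolding T_def using borel_measurable_continuous_on_restrict[OF chart(5)[OF c]] open_dom
        by (subst measurable_If_restrict_space_iff) auto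
      then show ?thesis
        using q chart(1)[OF c] chart(9)[OF c]
        by (intro measurable_restrict_space2) (auto simp: T_def)
    qed
    have eq: "density ?M (indicator U) = distr (chart_measure (U, x)) \<BB> T"
    proof (rule measure_eqI)
      show "sets (density ?M (indicator U)) = sets (distr (chart_measure (U, x)) \<BB> T)"
        by (simp add: M)
      fix E assume "E \<in> sets (density ?M (indicator U))"
      then have E: "E \<in> sets \<BB>" by (simp add: M)
      have UE: "U \<inter> E \<in> sets \<BB>" using US E by auto
      have "emeasure (density ?M (indicator U)) E = (\<integral>\<^sup>+p. indicator (U \<inter> E) p \<partial>?M)"
        using E US by (simp add: emeasure_density M(1) indicator_inter_arith measurable_cong_sets[OF M(1) refl])
      also have "\<dots> = emeasure ?M (U \<inter> E)" using UE by (intro nn_integral_indicator) (simp add: M)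
      also have "\<dots> = emeasure (chart_measure (U, x)) (x ` (U \<inter> E))" by (rule M(3)[OF c UE]) simp
      also have "\<dots> = emeasure (chart_measure (U, x)) (T -` E)"
      proof -
        have TE: "T -` E \<in> sets borel" using measurable_sets[OF T E] by simp
        have "chart_density (U, x) u * indicator (x ` (U \<inter> E)) u = chart_density (U, x) u * (indicator (T -` E) u :: real)" for u
          using chart(7)[OF c] by (auto simp: chart_density_def T_def indicator_def)
        then have "ennreal (chart_density (U, x) u) * indicator (x ` (U \<inter> E)) u
            = ennreal (chart_density (U, x) u) * indicator (T -` E) u" for u
          by (metis (no_types, lifting) ennreal_indicator ennreal_mult'' indicator_pos_le)
        then show ?thesis
          using sets_chart_image[OF c UE] TE dens(1)
          by (simp add: chart_measure_def emeasure_density)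
      qed
      also have "\<dots> = emeasure (distr (chart_measure (U, x)) \<BB> T) E"
        using T E by (subst emeasure_distr) (auto simp: chart_measure_def space_restrict_space)
      finally show "emeasure (density ?M (indicator U)) E = emeasure (distr (chart_measure (U, x)) \<BB> T) E" .
    qed
    have ind: "(indicator U :: 'a \<Rightarrow> real) \<in> borel_measurable ?M"
      by (intro borel_measurable_indicator) (simp only: M(1) US)
    have hM: "h \<in> borel_measurable ?M" using hm by (simp add: measurable_cong_sets[OF M(1) refl])
    have hT: "chart_density (U, x) u * h (T u) = chart_density (U, x) u * F u" for u
      using chart(8,9)[OF c] by (simp add: chart_density_def T_def h_def)
    have dU: "density ?M (\<lambda>p. ennreal (indicator U p)) = density ?M (indicator U)"
      by (simp add: ennreal_indicator)
    have hU: "indicator U p *\<^sub>R h p = h p" for p by (simp add: h_def)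
    have Tc: "T \<in> chart_measure (U, x) \<rightarrow>\<^sub>M \<BB>"
      using T by (simp add: chart_measure_def)
    have "integrable ?M h \<longleftrightarrow> integrable (density ?M (\<lambda>p. ennreal (indicator U p))) h"
      by (subst integrable_density[OF hM ind]) (simp_all only: hU, simp)
    also have "\<dots> \<longleftrightarrow> integrable (chart_measure (U, x)) (\<lambda>u. h (T u))"
      unfolding dU eq by (rule integrable_distr_eq[OF Tc hm])
    also have "\<dots> \<longleftrightarrow> integrable lborel (\<lambda>u. chart_density (U, x) u *\<^sub>R h (T u))"
      unfolding chart_measure_def
      by (rule integrable_density) (use measurable_compose[OF T hm] dens in auto)
    finally have 1: "integrable ?M h" using int_dF by (simp add: hT)
    have "(\<integral>p. h p \<partial>?M) = (\<integral>p. h p \<partial>density ?M (\<lambda>p. ennreal (indicator U p)))"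
      by (subst integral_density[OF hM ind]) (simp_all only: hU, simp)
    also have "\<dots> = (\<integral>u. h (T u) \<partial>chart_measure (U, x))"
      unfolding dU eq by (rule integral_distr[OF Tc hm])
    also have "\<dots> = (\<integral>u. chart_density (U, x) u *\<^sub>R h (T u) \<partial>lborel)"
      unfolding chart_measure_def
      by (rule integral_density) (use measurable_compose[OF T hm] dens in auto)
    finally show ?thesis using 1 by (simp add: hT)
  qed
  then show "integrable ?M h" "(\<integral>p. h p \<partial>?M) = (\<integral>u. chart_density (U, x) u * F u \<partial>lborel)" by auto
qed

end

section \<open>Partitions of unity\<close>

text \<open>The square of the positive part is C^1 because its derivative \<open>2 * max 0 v\<close>
  is continuous through \<open>0\<close>, and the squared norm inside is an inner product.\<close>

lemma C1_bump:
  fixes z :: "'e::euclidean_space"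
  shows "C1_on UNIV (\<lambda>u. (max 0 (r\<^sup>2 - (norm (u - z))\<^sup>2))\<^sup>2 :: real)"
proof -
  have q: "((\<lambda>v. (max 0 v)\<^sup>2) has_real_derivative 2 * max 0 v) (at v)" for v :: real
  proof (cases "v = 0")
    case True
    have "(\<lambda>h. ((max 0 (0 + h))\<^sup>2 - (max 0 0)\<^sup>2) / h) = (\<lambda>h :: real. max 0 h)"
      by (auto simp: fun_eq_iff max_def power2_eq_square)
    moreover have "((\<lambda>h :: real. max 0 h) \<longlongrightarrow> max 0 0) (at 0)"
      by (intro tendsto_intros)
    ultimately show ?thesis using True by (simp add: DERIV_def)
  next
    case False
    show ?thesis
    proof (cases "v > 0")
      case True
      have "((\<lambda>v. v\<^sup>2) has_real_derivative 2 * v) (at v)" by (auto intro!: derivative_eq_intros)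
      then have "((\<lambda>v. (max 0 v)\<^sup>2) has_real_derivative 2 * v) (at v)"
        by (rule has_field_derivative_transform_within_open[of _ _ _ "{0<..}"]) (use True in auto)
      then show ?thesis using True by simp
    next
      case v: False
      have "((\<lambda>v. 0) has_real_derivative 0) (at v)" by simp
      then have "((\<lambda>v. (max 0 v)\<^sup>2) has_real_derivative 0) (at v)"
        by (rule has_field_derivative_transform_within_open[of _ _ _ "{..<0}"]) (use v False in auto)
      then show ?thesis using v by simp
    qed
  qed
  have Q: "C1_on UNIV (\<lambda>v :: real. (max 0 v)\<^sup>2)"
  proof (rule C1_onI)
    show "((\<lambda>v. (max 0 v)\<^sup>2) has_derivative (*) (2 * max 0 v)) (at v)" for v :: real
      using q by (simp add: has_field_derivative_def)
    show "continuous_on UNIV (\<lambda>v :: real. 2 * max 0 v * w)" for w by (intro continuous_intros)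
  qed
  have id: "C1_on UNIV (\<lambda>u :: 'e. u)"
    by (rule C1_onI[where f' = "\<lambda>x v. v"]) auto
  have "C1_on UNIV (\<lambda>u. r\<^sup>2 - (norm (u - z))\<^sup>2)"
    unfolding power2_norm_eq_inner
    by (intro C1_on_diff C1_on_const C1_on_inner id)
  then show ?thesis by (rule C1_on_compose[OF _ Q]) simp
qed

context closed_manifold
begin

definition bump :: "('a, 'm) chart \<times> (real ^ 'm) \<times> real \<Rightarrow> 'a \<Rightarrow> real" where
  "bump b p = (case b of ((U, x), z, r) \<Rightarrow>
     if p \<in> U then (max 0 (r\<^sup>2 - (norm (x p - z))\<^sup>2))\<^sup>2 else 0)"

text \<open>Around a point of \<open>U\<close> the function is a C^1 bump composed with a transition
  map. Any other point has a neighbourhood where it vanishes, because the part of \<open>U\<close>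
  over the closed ball is compact and hence closed in a Hausdorff space.\<close>

lemma bump_C1:
  assumes c: "(U, x) \<in> \<A>" and d: "(V, y) \<in> \<A>" and r: "r > 0" "cball z r \<subseteq> x ` U"
  shows "C1_on (y ` V) (bump ((U, x), z, r) \<circ> inv_into V y)"
proof (rule Ck_on_local)
  let ?b = "bump ((U, x), z, r) \<circ> inv_into V y"
  fix w assume w: "w \<in> y ` V"
  show "\<exists>W. open W \<and> w \<in> W \<and> C1_on W ?b"
  proof (cases "inv_into V y w \<in> U")
    case True
    let ?W = "y ` (V \<inter> U)"
    have W: "open ?W" by (rule open_overlap[OF d c])
    have wW: "w \<in> ?W" using True chart(8,9)[OF d w] by (metis IntI imageI)
    have "C1_on ?W (\<lambda>w. (max 0 (r\<^sup>2 - (norm ((x \<circ> inv_into V y) w - z))\<^sup>2))\<^sup>2)"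
      by (rule C1_on_compose[OF transition(1)[OF d c] C1_bump]) simp
    moreover have "?b w = (max 0 (r\<^sup>2 - (norm ((x \<circ> inv_into V y) w - z))\<^sup>2))\<^sup>2" if "w \<in> ?W" for w
      using that chart(7)[OF d] by (auto simp: bump_def)
    ultimately have "C1_on ?W ?b" by (subst Ck_on_cong[OF W]) auto
    with W wW show ?thesis by blast
  next
    case False
    let ?L = "inv_into U x ` cball z r"
    have "compact ?L"
      using r(2) by (intro compact_continuous_image continuous_on_subset[OF chart(5)[OF c]]) auto
    then have "open (- ?L)" by (simp add: compact_imp_closed open_Compl)
    then have W: "open (y ` (V \<inter> - ?L))" by (rule open_chart_image[OF d])
    have "?L \<subseteq> U" using r(2) chart(9)[OF c] by blast
    then have wW: "w \<in> y ` (V \<inter> - ?L)"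
      using False chart(8,9)[OF d w] by (metis ComplI IntI imageI subsetD)
    have "?b w = 0" if w: "w \<in> y ` (V \<inter> - ?L)" for w
    proof -
      obtain p where p: "p \<in> V" "p \<notin> ?L" "w = y p" using w by blast
      have "norm (x p - z) > r" if "p \<in> U"
      proof (rule ccontr)
        assume "\<not> norm (x p - z) > r"
        then have "x p \<in> cball z r" by (simp add: dist_norm norm_minus_commute)
        then have "inv_into U x (x p) \<in> ?L" by (rule imageI)
        then show False using p(2) chart(7)[OF c that] by simp
      qed
      then have "p \<in> U \<Longrightarrow> r\<^sup>2 \<le> (norm (x p - z))\<^sup>2"
        using r(1) by (intro power_mono) auto
      then show ?thesis using p chart(7)[OF d] by (simp add: bump_def)
    qed
    then have "C1_on (y ` (V \<inter> - ?L)) ?b"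
      using C1_on_const[of _ 0] by (subst Ck_on_cong[OF W, of _ "\<lambda>_. 0"]) auto
    with W wW show ?thesis by blast
  qed
qed

text \<open>Bumps over closed balls inside chart images are divided by their sum, which is positive
  on \<open>S\<close> because finitely many of the open balls cover it.\<close>

theorem partition_of_unity:
  obtains n :: nat and c :: "nat \<Rightarrow> ('a, 'm) chart" and K :: "nat \<Rightarrow> (real ^ 'm) set"
    and \<rho> :: "nat \<Rightarrow> 'a \<Rightarrow> real"
  where "\<And>i. i < n \<Longrightarrow> c i \<in> \<A>" "\<And>i. i < n \<Longrightarrow> compact (K i)"
    "\<And>i. i < n \<Longrightarrow> K i \<subseteq> snd (c i) ` fst (c i)"
    "\<And>p. p \<in> S \<Longrightarrow> (\<Sum>i<n. \<rho> i p) = 1"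
    "\<And>i p. \<lbrakk>i < n; p \<in> S\<rbrakk> \<Longrightarrow> 0 \<le> \<rho> i p \<and> \<rho> i p \<le> 1"
    "\<And>i p. \<lbrakk>i < n; p \<notin> inv_into (fst (c i)) (snd (c i)) ` K i\<rbrakk> \<Longrightarrow> \<rho> i p = 0"
    "\<And>i V y. \<lbrakk>i < n; (V, y) \<in> \<A>\<rbrakk> \<Longrightarrow> C1_on (y ` V) (\<rho> i \<circ> inv_into V y)"
proof -
  define B where "B = {((U, x), z :: real ^ 'm, r :: real) |U x z r. (U, x) \<in> \<A> \<and> r > 0 \<and> cball z r \<subseteq> x ` U}"
  define N where "N b = (case b of ((U, x), z, r) \<Rightarrow> {p \<in> U. x p \<in> ball z r})" for b :: "('a, 'm) chart \<times> (real ^ 'm) \<times> real"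
  have "\<exists>T. open T \<and> N b = S \<inter> T" if "b \<in> B" for b
  proof -
    obtain U x z r where b: "b = ((U, x), z, r)" "(U, x) \<in> \<A>" using \<open>b \<in> B\<close> unfolding B_def by blast
    have "openin (top_of_set U) (U \<inter> x -` ball z r)"
      using chart(4)[OF b(2)] continuous_openin_preimage_gen open_ball by blast
    then have "openin (top_of_set S) (U \<inter> x -` ball z r)"
      using chart(2)[OF b(2)] openin_trans by blast
    moreover have "N b = U \<inter> x -` ball z r" by (auto simp: N_def b)
    ultimately show ?thesis unfolding openin_open by metis
  qed
  then obtain T where T: "\<And>b. b \<in> B \<Longrightarrow> open (T b) \<and> N b = S \<inter> T b" by metis
  have "S \<subseteq> (\<Union>b\<in>B. T b)"
  proof
    fix p assume p: "p \<in> S"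
    then obtain U x where c: "(U, x) \<in> \<A>" "p \<in> U" using charts_cover by blast
    then obtain r where "r > 0" "cball (x p) r \<subseteq> x ` U"
      using chart(3)[OF c(1)] open_contains_cball by blast
    then have "((U, x), x p, r) \<in> B" "p \<in> N ((U, x), x p, r)" using c by (auto simp: B_def N_def)
    then show "p \<in> (\<Union>b\<in>B. T b)" using T by blast
  qed
  then obtain F where F: "F \<subseteq> B" "finite F" "S \<subseteq> (\<Union>b\<in>F. T b)"
    using compactE_image[OF compact, of B T] T by metis
  obtain n :: nat and b where b: "F = b ` {..<n}"
    using finite_imp_nat_seg_image_inj_on[OF F(2)] by (metis lessThan_def)
  have bB: "b i \<in> B" if "i < n" for i using b F(1) that by blast
  define c where "c i = fst (b i)" for i
  define K where "K i = (case snd (b i) of (z, r) \<Rightarrow> cball z r)" for i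
  define \<sigma> where "\<sigma> p = (\<Sum>j<n. bump (b j) p)" for p
  define \<rho> where "\<rho> i p = bump (b i) p / \<sigma> p" for i p
  have bump0: "bump b p \<ge> 0" for b p by (auto simp: bump_def split: prod.split)
  have bi: "\<exists>U x z r. b i = ((U, x), z, r) \<and> (U, x) \<in> \<A> \<and> r > 0 \<and> cball z r \<subseteq> x ` U" if "i < n" for i
    using bB[OF that] unfolding B_def by blast
  have pos: "\<sigma> p > 0" if p: "p \<in> S" for p
  proof -
    obtain j where j: "j < n" "p \<in> N (b j)" using F(3) p T F(1) b by blast
    obtain U x z r where e: "b j = ((U, x), z, r)" "r > 0" using bi[OF j(1)] by blast
    then have pU: "p \<in> U" "norm (x p - z) < r" using j(2) by (auto simp: N_def dist_norm norm_minus_commute)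
    then have "(norm (x p - z))\<^sup>2 < r\<^sup>2" by (intro power_strict_mono) auto
    then have "bump (b j) p > 0" using pU by (simp add: e bump_def)
    then show ?thesis unfolding \<sigma>_def by (intro sum_pos2[where i = j]) (use j bump0 in auto)
  qed
  have le: "bump (b i) p \<le> \<sigma> p" if "i < n" for i p
    unfolding \<sigma>_def using that bump0 by (intro member_le_sum) auto
  show ?thesis
  proof (rule that[of n c K \<rho>])
    fix i assume i: "i < n"
    obtain U x z r where e: "b i = ((U, x), z, r)" "(U, x) \<in> \<A>" "r > 0" "cball z r \<subseteq> x ` U"
      using bi[OF i] by blast
    show "c i \<in> \<A>" "compact (K i)" "K i \<subseteq> snd (c i) ` fst (c i)"
      using e by (simp_all add: c_def K_def)
    show "0 \<le> \<rho> i p \<and> \<rho> i p \<le> 1" if "p \<in> S" for p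
      using pos[OF that] bump0 le[OF i] by (simp add: \<rho>_def)
    show "\<rho> i p = 0" if "p \<notin> inv_into (fst (c i)) (snd (c i)) ` K i" for p
    proof -
      have "r\<^sup>2 \<le> (norm (x p - z))\<^sup>2" if "p \<in> U"
      proof (rule ccontr)
        assume "\<not> ?thesis"
        then have "norm (x p - z) \<le> r" using e(3) power_mono[of r "norm (x p - z)" 2] by force
        then have "x p \<in> K i" by (simp add: K_def e dist_norm norm_minus_commute)
        then have "inv_into U x (x p) \<in> inv_into (fst (c i)) (snd (c i)) ` K i" by (simp add: c_def e)
        then show False using \<open>p \<notin> _\<close> chart(7)[OF e(2) that] by simp
      qed
      then show ?thesis by (simp add: \<rho>_def bump_def e)
    qed
    show "C1_on (y ` V) (\<rho> i \<circ> inv_into V y)" if d: "(V, y) \<in> \<A>" for V y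
    proof -
      have C: "C1_on (y ` V) (\<lambda>w. bump (b j) (inv_into V y w))" if "j < n" for j
        using bi[OF that] bump_C1[OF _ d] by (auto simp: comp_def)
      have "\<sigma> (inv_into V y w) \<noteq> 0" if "w \<in> y ` V" for w
      proof -
        have "inv_into V y w \<in> S" using chart(1,9)[OF d] that by blast
        from pos[OF this] show ?thesis by simp
      qed
      then have "C1_on (y ` V) (\<lambda>w. bump (b i) (inv_into V y w) / (\<Sum>j<n. bump (b j) (inv_into V y w)))"
        using C i unfolding \<sigma>_def by (intro C1_on_divide C1_on_sum) auto
      then show ?thesis by (simp add: \<rho>_def[abs_def] \<sigma>_def comp_def)
    qed
  next
    show "(\<Sum>i<n. \<rho> i p) = 1" if "p \<in> S" for p
      using pos[OF that] by (simp add: \<rho>_def sum_divide_distrib[symmetric] \<sigma>_def[symmetric])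
  qed
qed

end

section \<open>Uniform bounds in time\<close>

lemma continuous_on_det:
  fixes M :: "'e::topological_space \<Rightarrow> real ^ 'n::finite ^ 'n"
  assumes "\<And>i j. continuous_on W (\<lambda>x. M x $ i $ j)"
  shows "continuous_on W (\<lambda>x. det (M x))"
  unfolding det_def by (intro continuous_intros assms)

text \<open>The determinant with \<open>\<nu>\<close> as its normal column has the sign of the
  product of \<open>\<nu>\<close> with the normal at time \<open>t\<close>. It stands in for that
  product because it is polynomial in the first derivatives.\<close>

definition time_bound :: "(real \<Rightarrow> real ^ 'm::finite \<Rightarrow> real ^ 'm option) \<Rightarrow> (real ^ 'm \<Rightarrow> real ^ 'm option)
    \<Rightarrow> real \<Rightarrow> real \<Rightarrow> real \<Rightarrow> real ^ 'm \<Rightarrow> bool" where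
  "time_bound \<Phi> \<nu> s \<epsilon> C u \<longleftrightarrow> (\<forall>t\<in>{0..1}. \<bar>t - s\<bar> < \<epsilon> \<longrightarrow>
     (\<forall>i j. norm (pd i (pd j (\<Phi> t)) u) \<le> C) \<and>
     (\<forall>j. norm (pd j (\<Phi> t) u - pd j (\<Phi> s) u) \<le> C * \<bar>t - s\<bar>) \<and>
     det (frame (Der (\<Phi> t) u) (\<nu> u)) > 0)"

text \<open>The bounds come from a smooth extension \<open>g\<close> of the deformation near
  \<open>(s, u0)\<close>, so that time derivatives make sense at the ends of \<open>{0..1}\<close>
  as well. Space slices are open, hence the space derivatives of \<open>g\<close> and of the
  deformation agree at every time in \<open>{0..1}\<close>.\<close>

lemma time_bound_local:
  fixes \<Phi> :: "real \<Rightarrow> real ^ 'm::finite \<Rightarrow> real ^ 'm option"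
  assumes \<Omega>: "open \<Omega>" and sm: "smooth_on ({0..1} \<times> \<Omega>) (\<lambda>(t, u). \<Phi> t u)"
    and s: "s \<in> {0..1}" and u0: "u0 \<in> \<Omega>" and \<nu>: "continuous_on \<Omega> \<nu>"
    and pos: "det (frame (Der (\<Phi> s) u0) (\<nu> u0)) > 0"
  shows "\<exists>\<epsilon>>0. \<exists>C. \<forall>u\<in>ball u0 \<epsilon>. time_bound \<Phi> \<nu> s \<epsilon> C u"
proof -
  obtain W g where W: "open W" "(s, u0) \<in> W" and g: "\<And>k. Ck_on k W g"
    and eq: "\<And>z. z \<in> ({0..1} \<times> \<Omega>) \<inter> W \<Longrightarrow> g z = (\<lambda>(t, u). \<Phi> t u) z"
    using sm s u0 unfolding smooth_on_def by (metis mem_Sigma_iff)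
  define gv where "gv v z = Der g z (0, v)" for v :: "real ^ 'm" and z :: "real \<times> (real ^ 'm)"
  define W' where "W' = W \<inter> UNIV \<times> \<Omega>"
  have W': "open W'" "(s, u0) \<in> W'" using W \<Omega> u0 by (auto simp: W'_def intro!: open_Int open_Times)
  have gC: "C1_on W' g" "C1_on W' (gv v)" for v
    using C2_onD[OF Ck_on_subset[OF g, of W']] unfolding gv_def[abs_def] W'_def by auto
  have d1: "Der (\<Phi> t) u v = gv v (t, u)"
    if t: "t \<in> {0..1}" and tu: "(t, u) \<in> W'" for t u v
  proof -
    let ?V = "(\<lambda>u. (t, u)) -` W'"
    have V: "open ?V" using W'(1) by (intro open_vimage continuous_intros)
    have "Der (\<Phi> t) u = Der (\<lambda>u. g (t, u)) u"
      by (rule frechet_derivative_cong_open[OF V]) (use tu t eq in \<open>auto simp: W'_def\<close>)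
    also have "\<dots> = (\<lambda>v. Der g (t, u) (0, v))"
      by (rule frechet_derivative_at[symmetric],
          rule has_derivative_compose[where f = "\<lambda>u. (t, u)"])
        (auto intro!: derivative_eq_intros C1_on_has_derivative[OF gC(1) tu])
    finally show ?thesis by (simp add: gv_def)
  qed
  have d2: "pd i (\<lambda>y. Der (\<Phi> t) y v) u = Der (gv v) (t, u) (0, axis i 1)"
    if t: "t \<in> {0..1}" and tu: "(t, u) \<in> W'" for t u v i
  proof -
    let ?V = "(\<lambda>u. (t, u)) -` W'"
    have V: "open ?V" using W'(1) by (intro open_vimage continuous_intros)
    have "Der (\<lambda>y. Der (\<Phi> t) y v) u
        = Der (\<lambda>u. gv v (t, u)) u"
      by (rule frechet_derivative_cong_open[OF V]) (use tu t d1 in auto)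
    also have "\<dots> = (\<lambda>w. Der (gv v) (t, u) (0, w))"
      by (rule frechet_derivative_at[symmetric],
          rule has_derivative_compose[where f = "\<lambda>u. (t, u)"])
        (auto intro!: derivative_eq_intros C1_on_has_derivative[OF gC(2) tu])
    finally show ?thesis by simp
  qed
  define \<Delta> where "\<Delta> z = det (\<chi> r c. (case c of None \<Rightarrow> \<nu> (snd z) | Some j \<Rightarrow> gv (axis j 1) z) $ r)"
    for z :: "real \<times> (real ^ 'm)"
  have fr: "det (frame (Der (\<Phi> t) u) (\<nu> u)) = \<Delta> (t, u)"
    if "t \<in> {0..1}" "(t, u) \<in> W'" for t u
    unfolding frame_def \<Delta>_def
    by (rule arg_cong[where f = det]) (simp add: vec_eq_iff d1[OF that] split: option.split)
  have "continuous_on W' \<Delta>"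
    unfolding \<Delta>_def
  proof (rule continuous_on_det)
    fix r c :: "'m option"
    have n: "continuous_on W' (\<lambda>z. \<nu> (snd z))"
      by (rule continuous_on_compose2[OF \<nu>]) (auto intro!: continuous_intros simp: W'_def)
    have "continuous_on W' (\<lambda>z. (case c of None \<Rightarrow> \<nu> (snd z) | Some j \<Rightarrow> gv (axis j 1) z) $ r)"
      by (cases c) (auto intro!: continuous_on_component n C1_on_imp_continuous_on[OF gC(2)])
    then show "continuous_on W' (\<lambda>z. (\<chi> r c. (case c of None \<Rightarrow> \<nu> (snd z) | Some j \<Rightarrow> gv (axis j 1) z) $ r) $ r $ c)"
      by simp
  qed
  then have "open (\<Delta> -` {0<..} \<inter> W')"
    using W'(1) by (simp add: continuous_on_open_vimage)
  moreover have "(s, u0) \<in> \<Delta> -` {0<..} \<inter> W'" using W'(2) pos fr[OF s W'(2)] by simp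
  ultimately obtain A B where AB: "open A" "open B" "s \<in> A" "u0 \<in> B" "A \<times> B \<subseteq> \<Delta> -` {0<..} \<inter> W'"
    by (metis open_prod_elim mem_Sigma_iff)
  obtain a where a: "a > 0" "cball s a \<subseteq> A" using AB open_contains_cball by blast
  obtain b where b: "b > 0" "cball u0 b \<subseteq> B" using AB open_contains_cball by blast
  define \<epsilon> where "\<epsilon> = min a b"
  let ?R = "cball s \<epsilon> \<times> cball u0 \<epsilon>"
  have e: "\<epsilon> > 0" using a b by (simp add: \<epsilon>_def)
  have R: "?R \<subseteq> W'" "\<And>z. z \<in> ?R \<Longrightarrow> \<Delta> z > 0"
  proof -
    have "?R \<subseteq> A \<times> B" using a b by (intro Sigma_mono) (auto simp: \<epsilon>_def)
    then show "?R \<subseteq> W'" "\<And>z. z \<in> ?R \<Longrightarrow> \<Delta> z > 0" using AB(5) by auto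
  qed
  \<comment> \<open>One continuous function that dominates all derivatives to be bounded, so that a
    single compactness argument serves every index.\<close>
  define q where "q z = (\<Sum>j\<in>UNIV. \<Sum>i\<in>UNIV. norm (Der (gv (axis j 1)) z (0, axis i 1)))
      + (\<Sum>j\<in>UNIV. norm (Der (gv (axis j 1)) z (1, 0)))" for z :: "real \<times> (real ^ 'm)"
  have "continuous_on ?R q"
    unfolding q_def
    by (intro continuous_intros continuous_on_subset[OF C1_on_continuous_derivative[OF gC(2)] R(1)])
  moreover have "compact ?R" by (intro compact_Times compact_cball)
  ultimately have "bounded (q ` ?R)" by (intro compact_imp_bounded compact_continuous_image)
  then obtain C where C: "\<And>z. z \<in> ?R \<Longrightarrow> \<bar>q z\<bar> \<le> C"
    unfolding bounded_iff by (metis imageI real_norm_def)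
  have qi: "norm (Der (gv (axis j 1)) z (0, axis i 1)) \<le> q z"
    "norm (Der (gv (axis j 1)) z (1, 0)) \<le> q z" for i j z
  proof -
    have "norm (Der (gv (axis j 1)) z (0, axis i 1))
        \<le> (\<Sum>i\<in>UNIV. norm (Der (gv (axis j 1)) z (0, axis i 1)))"
      by (rule member_le_sum) auto
    also have "\<dots> \<le> (\<Sum>j\<in>UNIV. \<Sum>i\<in>UNIV. norm (Der (gv (axis j 1)) z (0, axis i 1)))"
      by (rule member_le_sum[where f = "\<lambda>j. \<Sum>i\<in>UNIV. norm (Der (gv (axis j 1)) z (0, axis i 1))"])
        (auto intro: sum_nonneg)
    also have "\<dots> \<le> q z" unfolding q_def by (simp add: sum_nonneg)
    finally show "norm (Der (gv (axis j 1)) z (0, axis i 1)) \<le> q z" .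
    have "norm (Der (gv (axis j 1)) z (1, 0))
        \<le> (\<Sum>j\<in>UNIV. norm (Der (gv (axis j 1)) z (1, 0)))"
      by (rule member_le_sum) auto
    also have "\<dots> \<le> q z" unfolding q_def by (simp add: sum_nonneg)
    finally show "norm (Der (gv (axis j 1)) z (1, 0)) \<le> q z" .
  qed
  have "time_bound \<Phi> \<nu> s \<epsilon> C u" if u: "u \<in> ball u0 \<epsilon>" for u
    unfolding time_bound_def
  proof (intro ballI impI conjI allI)
    fix t assume t: "t \<in> {0..1}" and ts: "\<bar>t - s\<bar> < \<epsilon>"
    have tR: "(\<tau>, u) \<in> ?R" if "\<tau> \<in> cball s \<epsilon>" for \<tau> using that u by auto
    have tc: "t \<in> cball s \<epsilon>" "s \<in> cball s \<epsilon>" using ts e by (auto simp: dist_real_def)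
    have tW: "(t, u) \<in> W'" "(s, u) \<in> W'" using tR tc R(1) by auto
    show "norm (pd i (pd j (\<Phi> t)) u) \<le> C" for i j
      unfolding d2[OF t tW(1)] using qi(1)[of j "(t, u)" i] C[OF tR[OF tc(1)]] by linarith
    show "det (frame (Der (\<Phi> t) u) (\<nu> u)) > 0"
      unfolding fr[OF t tW(1)] by (rule R(2)[OF tR[OF tc(1)]])
    show "norm (pd j (\<Phi> t) u - pd j (\<Phi> s) u) \<le> C * \<bar>t - s\<bar>" for j
    proof -
      let ?h = "\<lambda>\<tau>. gv (axis j 1) (\<tau>, u)"
      let ?h' = "\<lambda>\<tau> r. Der (gv (axis j 1)) (\<tau>, u) (r, 0)"
      \<comment> \<open>The mean value inequality runs over the whole of
        \<open>cball s \<epsilon>\<close>, possibly beyond \<open>{0..1}\<close>; only the extension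
        is evaluated there.\<close>
      have "norm (?h t - ?h s) \<le> C * norm (t - s)"
      proof (rule differentiable_bound[of "cball s \<epsilon>" ?h ?h' C t s])
        fix \<tau> assume \<tau>: "\<tau> \<in> cball s \<epsilon>"
        then have d: "(gv (axis j 1) has_derivative Der (gv (axis j 1)) (\<tau>, u)) (at (\<tau>, u))"
          using tR R(1) by (intro C1_on_has_derivative[OF gC(2)]) auto
        have "((\<lambda>\<tau>. (\<tau>, u)) has_derivative (\<lambda>r. (r, 0))) (at \<tau>)"
          by (auto intro!: derivative_eq_intros)
        from has_derivative_compose[OF this d]
        show "(?h has_derivative ?h' \<tau>) (at \<tau> within cball s \<epsilon>)" by (rule has_derivative_at_withinI)
        show "onorm (?h' \<tau>) \<le> C"
        proof (rule onorm_le)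
          fix r :: real
          have "?h' \<tau> r = r *\<^sub>R ?h' \<tau> 1"
            using linear_cmul[OF has_derivative_linear[OF d], of r "(1, 0)"] by simp
          moreover have "norm (?h' \<tau> 1) \<le> C" using qi(2)[of j "(\<tau>, u)"] C[OF tR[OF \<tau>]] by linarith
          ultimately show "norm (?h' \<tau> r) \<le> C * norm r"
            using mult_right_mono[of "norm (?h' \<tau> 1)" C "\<bar>r\<bar>"] by (simp add: mult.commute)
        qed
      qed (use tc in auto)
      then show ?thesis by (simp add: d1[OF t tW(1)] d1[OF s tW(2)])
    qed
  qed
  then show ?thesis using e by blast
qed

lemma time_bound_mono:
  assumes "time_bound \<Phi> \<nu> s \<epsilon> C u" "\<epsilon>' \<le> \<epsilon>" "C \<le> C'"
  shows "time_bound \<Phi> \<nu> s \<epsilon>' C' u"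
  unfolding time_bound_def
proof (intro ballI impI)
  fix t :: real assume t: "t \<in> {0..1}" "\<bar>t - s\<bar> < \<epsilon>'"
  then have b: "(\<forall>i j. norm (pd i (pd j (\<Phi> t)) u) \<le> C) \<and>
     (\<forall>j. norm (pd j (\<Phi> t) u - pd j (\<Phi> s) u) \<le> C * \<bar>t - s\<bar>) \<and>
     det (frame (Der (\<Phi> t) u) (\<nu> u)) > 0"
    using assms(1,2) unfolding time_bound_def by force
  have "C * \<bar>t - s\<bar> \<le> C' * \<bar>t - s\<bar>" using assms(3) by (intro mult_right_mono) auto
  with b assms(3) show "(\<forall>i j. norm (pd i (pd j (\<Phi> t)) u) \<le> C') \<and>
     (\<forall>j. norm (pd j (\<Phi> t) u - pd j (\<Phi> s) u) \<le> C' * \<bar>t - s\<bar>) \<and>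
     det (frame (Der (\<Phi> t) u) (\<nu> u)) > 0"
    by (meson order_trans)
qed

lemma time_bound_compact:
  fixes \<Phi> :: "real \<Rightarrow> real ^ 'm::finite \<Rightarrow> real ^ 'm option"
  assumes \<Omega>: "open \<Omega>" and sm: "smooth_on ({0..1} \<times> \<Omega>) (\<lambda>(t, u). \<Phi> t u)"
    and s: "s \<in> {0..1}" and K: "compact K" "K \<subseteq> \<Omega>" and \<nu>: "continuous_on \<Omega> \<nu>"
    and pos: "\<And>u. u \<in> \<Omega> \<Longrightarrow> det (frame (Der (\<Phi> s) u) (\<nu> u)) > 0"
  obtains \<epsilon> C where "\<epsilon> > 0" "C \<ge> 0" "\<And>u. u \<in> K \<Longrightarrow> time_bound \<Phi> \<nu> s \<epsilon> C u"
proof -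
  have "\<forall>u0\<in>K. \<exists>\<epsilon> C. \<epsilon> > 0 \<and> (\<forall>u\<in>ball u0 \<epsilon>. time_bound \<Phi> \<nu> s \<epsilon> C u)"
    using time_bound_local[OF \<Omega> sm s _ \<nu> pos] K(2) by (metis subsetD)
  then obtain e C where eC: "\<And>u0. u0 \<in> K \<Longrightarrow> e u0 > 0 \<and> (\<forall>u\<in>ball u0 (e u0). time_bound \<Phi> \<nu> s (e u0) (C u0) u)"
    by metis
  have "K \<subseteq> (\<Union>u0\<in>K. ball u0 (e u0))" using eC by fastforce
  then obtain F where F: "F \<subseteq> K" "finite F" "K \<subseteq> (\<Union>u0\<in>F. ball u0 (e u0))"
    using compactE_image[OF K(1), of K "\<lambda>u0. ball u0 (e u0)"] by auto
  \<comment> \<open>The inserted \<open>1\<close> and \<open>0\<close> keep minimum and maximum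
    meaningful when \<open>K\<close> is empty; the \<open>0\<close> also yields
    \<open>D \<ge> 0\<close>.\<close>
  define \<epsilon> where "\<epsilon> = Min (insert 1 (e ` F))"
  define D where "D = Max (insert 0 (C ` F))"
  have "\<epsilon> > 0" unfolding \<epsilon>_def using F eC by (subst Min_gr_iff) auto
  moreover have "D \<ge> 0" unfolding D_def using F by (intro Max_ge) auto
  moreover have "time_bound \<Phi> \<nu> s \<epsilon> D u" if u: "u \<in> K" for u
  proof -
    obtain u0 where u0: "u0 \<in> F" "u \<in> ball u0 (e u0)" using F(3) u by blast
    then have "time_bound \<Phi> \<nu> s (e u0) (C u0) u" using eC F(1) by blast
    then show ?thesis
      by (rule time_bound_mono) (use u0 F in \<open>auto simp: \<epsilon>_def D_def intro: Min_le Max_ge\<close>)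
  qed
  ultimately show ?thesis by (rule that)
qed

section \<open>Isometric deformations\<close>

locale immersed_pair = immersed_manifold S \<A> f + G: immersed_manifold S \<A> f'
  for S :: "'a::t2_space set" and \<A> :: "('a, 'm::finite) chart set" and f f' :: "'a \<Rightarrow> real ^ 'm option" +
  assumes isometric: "\<And>U x u. \<lbrakk>(U, x) \<in> \<A>; u \<in> x ` U\<rbrakk> \<Longrightarrow>
    metric (f' \<circ> inv_into U x) u = metric (f \<circ> inv_into U x) u"
begin

lemma pair: "(U, x) \<in> \<A> \<Longrightarrow> isometric_pair (x ` U) (f \<circ> inv_into U x) (f' \<circ> inv_into U x)"
  by (intro isometric_pair.intro patch G.patch isometric_pair_axioms.intro isometric)

text \<open>The inner product of the covectors \<open>d\<chi> \<bullet> n\<close> and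
  \<open>d\<rho>\<close> in the inverse metric, with \<open>\<chi> = f' - f\<close>. Written as a
  matrix acting on component vectors, it has the shape to which
  \<open>cramer_inverse_congruence\<close> applies.\<close>

definition pairing :: "('a, 'm) chart \<Rightarrow> ('a \<Rightarrow> real) \<Rightarrow> real ^ 'm \<Rightarrow> real" where
  "pairing c \<rho> u = (let \<psi> = f \<circ> inv_into (fst c) (snd c); \<psi>' = f' \<circ> inv_into (fst c) (snd c) in
     (inv_metric \<psi> u *v (\<chi> j. (pd j \<psi>' u - pd j \<psi> u) \<bullet> nrm \<psi> u))
       \<bullet> (\<chi> i. pd i (\<rho> \<circ> inv_into (fst c) (snd c)) u))"

lemma pairing_sum:
  "pairing (U, x) \<rho> u = (\<Sum>i\<in>UNIV. (\<Sum>j\<in>UNIV. inv_metric (f \<circ> inv_into U x) u $ i $ j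
      * ((pd j (f' \<circ> inv_into U x) u - pd j (f \<circ> inv_into U x) u) \<bullet> nrm (f \<circ> inv_into U x) u))
    * pd i (\<rho> \<circ> inv_into U x) u)"
  unfolding pairing_def Let_def fst_conv snd_conv inner_vec_def[of "_ *v _"]
  by (simp add: matrix_vector_mult_def)

lemma pairing_chart_change:
  assumes c: "(U, x) \<in> \<A>" and d: "(V, y) \<in> \<A>" and u: "u \<in> x ` (U \<inter> V)"
    and \<rho>: "(\<rho> \<circ> inv_into V y) differentiable (at ((y \<circ> inv_into U x) u))"
  shows "pairing (U, x) \<rho> u = pairing (V, y) \<rho> ((y \<circ> inv_into U x) u)"
proof -
  interpret Q: patch "y ` V" "f \<circ> inv_into V y" by (rule patch[OF d])
  interpret Q': patch "y ` V" "f' \<circ> inv_into V y" by (rule G.patch[OF d])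
  define \<tau> where "\<tau> = y \<circ> inv_into U x"
  have tu: "\<tau> u \<in> y ` V" using chart_change_eq(2)[OF c d u] by (auto simp: \<tau>_def)
  let ?T = "Der \<tau> u"
  let ?l = "\<lambda>v. (Der (f' \<circ> inv_into V y) (\<tau> u) v
      - Der (f \<circ> inv_into V y) (\<tau> u) v) \<bullet> nrm (f \<circ> inv_into V y) (\<tau> u)"
  have l: "linear ?l"
    using Q.lin[OF tu] Q'.lin[OF tu]
    by (intro linearI) (simp_all add: linear_add linear_cmul inner_diff_left inner_add_left right_diff_distrib)
  have r: "linear (Der (\<rho> \<circ> inv_into V y) (\<tau> u))"
    using \<rho> by (simp add: \<tau>_def linear_frechet_derivative)
  have T: "det (matrix ?T) \<noteq> 0" using transition(2)[OF c d u] by (simp add: \<tau>_def)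
  have w: "(\<chi> j. (pd j (f' \<circ> inv_into U x) u - pd j (f \<circ> inv_into U x) u) \<bullet> nrm (f \<circ> inv_into U x) u)
      = transpose (matrix ?T) *v (\<chi> j. ?l (axis j 1))"
    unfolding gradient_compose[OF l, symmetric]
    unfolding \<tau>_def normal_chart_change[OF c d u]
    unfolding df_chart_change[OF c d u] G.df_chart_change[OF c d u]
    by (simp only: o_apply)
  have g: "(\<chi> i. pd i (\<rho> \<circ> inv_into U x) u)
      = transpose (matrix ?T) *v (\<chi> i. pd i (\<rho> \<circ> inv_into V y) (\<tau> u))"
    unfolding gradient_compose[OF r, symmetric]
    unfolding \<tau>_def
    by (simp only: chart_change_derivative[OF c d u \<rho>] o_apply)
  show ?thesis
    unfolding pairing_def Let_def fst_conv snd_conv w g metric_chart_change[OF c d u, folded \<tau>_def]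
    using cramer_inverse_congruence[OF less_imp_neq[OF Q.det_pos[OF tu], symmetric] T]
    by (simp only: \<tau>_def)
qed

text \<open>\<open>pairing\<close> is linear in the differential of its second argument, and the
  differentials of a partition of unity add up to that of a constant.\<close>

lemma sum_pairing_eq_0:
  assumes d: "(V, y) \<in> \<A>" and w: "w \<in> y ` V"
    and \<rho>: "\<And>i. i \<in> I \<Longrightarrow> C1_on (y ` V) (\<rho> i \<circ> inv_into V y)"
    and one: "\<And>p. p \<in> S \<Longrightarrow> (\<Sum>i\<in>I. \<rho> i p) = (1 :: real)"
  shows "(\<Sum>i\<in>I. pairing (V, y) (\<rho> i) w) = 0"
proof -
  have "(\<Sum>i\<in>I. pd k (\<rho> i \<circ> inv_into V y) w) = 0" for k
  proof -
    have hd: "((\<lambda>w. \<Sum>i\<in>I. (\<rho> i \<circ> inv_into V y) w) has_derivative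
        (\<lambda>v. \<Sum>i\<in>I. Der (\<rho> i \<circ> inv_into V y) w v)) (at w)"
      by (intro has_derivative_sum C1_on_has_derivative[OF \<rho> w])
    have c1: "(\<Sum>i\<in>I. (\<rho> i \<circ> inv_into V y) w') = 1" if "w' \<in> y ` V" for w'
      using one[of "inv_into V y w'"] chart(1)[OF d] chart(9)[OF d that] by auto
    show ?thesis
      by (rule patch.has_derivative_const_on[OF patch[OF d] w _ hd]) (rule c1)
  qed
  then have "(\<Sum>i\<in>I. (\<chi> k. pd k (\<rho> i \<circ> inv_into V y) w)) = 0"
    by (simp add: vec_eq_iff)
  then show ?thesis
    by (simp add: pairing_def Let_def inner_sum_right[symmetric])
qed

lemma pairing_flux:
  assumes c: "(U, x) \<in> \<A>"
  shows "area_density (f \<circ> inv_into U x) u * pairing (U, x) \<rho> u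
    = (\<Sum>i\<in>UNIV. pd i (\<rho> \<circ> inv_into U x) u
        * (isometric_pair.flux_shift (f \<circ> inv_into U x) (f' \<circ> inv_into U x) i u \<bullet> nrm (f \<circ> inv_into U x) u))"
proof -
  interpret isometric_pair "x ` U" "f \<circ> inv_into U x" "f' \<circ> inv_into U x" by (rule pair[OF c])
  show ?thesis
    by (simp add: pairing_sum flux_shift_eq shift_def inner_sum_left sum_distrib_left
        sum_distrib_right mult_ac)
qed

text \<open>The area density is a function of the metric, so both measures meet the same defining
  condition, which by \<open>ex1_area_measure\<close> has one solution.\<close>

lemma area_measure_eq: "area_measure S \<A> f' = area_measure S \<A> f"
proof -
  have "is_area_measure M \<longleftrightarrow> G.is_area_measure M" for M
  proof -
    have "(\<integral>\<^sup>+u\<in>x ` E. ennreal (area_density (f \<circ> inv_into U x) u) \<partial>lborel)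
        = (\<integral>\<^sup>+u\<in>x ` E. ennreal (area_density (f' \<circ> inv_into U x) u) \<partial>lborel)"
      if "(U, x) \<in> \<A>" "E \<subseteq> U" for U x E
      using isometric[OF that(1)] that(2)
      by (intro nn_integral_cong) (auto simp: indicator_def area_density_eq)
    note eq = this
    show ?thesis
      unfolding is_area_measure_def G.is_area_measure_def
    proof (intro conj_cong[OF refl] ball_cong[OF refl])
      fix c assume c: "c \<in> \<A>"
      obtain U x where e: "c = (U, x)" by (rule prod.exhaust)
      show "(case c of (U, x) \<Rightarrow> \<forall>E\<in>sets M. E \<subseteq> U \<longrightarrow> emeasure M E
            = (\<integral>\<^sup>+u\<in>x ` E. ennreal (area_density (f \<circ> inv_into U x) u) \<partial>lborel))
        \<longleftrightarrow> (case c of (U, x) \<Rightarrow> \<forall>E\<in>sets M. E \<subseteq> U \<longrightarrow> emeasure M E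
            = (\<integral>\<^sup>+u\<in>x ` E. ennreal (area_density (f' \<circ> inv_into U x) u) \<partial>lborel))"
        using eq[of U x] c by (simp add: e)
    qed
  qed
  then show ?thesis using area_measure G.area_measure ex1_area_measure by blast
qed

text \<open>Integrates \<open>mean_curv_variation\<close> over one chart. The divergence term has
  integral \<open>0\<close>; the pairing term need not vanish by itself and stays on the left, to be
  cancelled in the sum over all charts. The remainder is bounded pointwise on \<open>K\<close>,
  whence the factor \<open>measure lborel K\<close>.\<close>

lemma localized_variation:
  fixes C D G :: real
  assumes c: "(U, x) \<in> \<A>" and K: "compact K" "K \<subseteq> x ` U"
    and \<rho>: "C1_on (x ` U) (\<rho> \<circ> inv_into U x)" "\<And>p. p \<in> U \<Longrightarrow> 0 \<le> \<rho> p \<and> \<rho> p \<le> (1 :: real)"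
    and supp: "\<And>p. p \<notin> inv_into U x ` K \<Longrightarrow> \<rho> p = 0"
    and G: "\<And>u i j. u \<in> K \<Longrightarrow> area_density (f \<circ> inv_into U x) u \<le> G
      \<and> \<bar>inv_metric (f \<circ> inv_into U x) u $ i $ j\<bar> \<le> G
      \<and> \<bar>patch.raised_form (f \<circ> inv_into U x) u $ i $ j\<bar> \<le> G"
    and C: "\<And>u i j. u \<in> K \<Longrightarrow> norm (pd i (pd j (f' \<circ> inv_into U x)) u) \<le> C"
    and D: "\<And>u j. u \<in> K \<Longrightarrow> norm (pd j (f' \<circ> inv_into U x) u - pd j (f \<circ> inv_into U x) u) \<le> D"
    and pos: "\<And>u. u \<in> K \<Longrightarrow> nrm (f' \<circ> inv_into U x) u \<bullet> nrm (f \<circ> inv_into U x) u \<ge> 0"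
  defines "h \<equiv> \<lambda>f p. if p \<in> U then \<rho> p * mean_curvature \<A> f p else 0"
    and "k \<equiv> \<lambda>p. if p \<in> U then pairing (U, x) \<rho> (x p) else 0"
  shows "integrable (area_measure S \<A> f) (h f)" "integrable (area_measure S \<A> f) (h f')"
    "integrable (area_measure S \<A> f) k"
    "\<bar>(\<integral>p. h f' p \<partial>area_measure S \<A> f) - (\<integral>p. h f p \<partial>area_measure S \<A> f)
        + (\<integral>p. k p \<partial>area_measure S \<A> f)\<bar>
     \<le> measure lborel K * ((G * (CARD('m) * (CARD('m) * (G * C))) * (CARD('m) * (CARD('m) * G))
         + CARD('m) * (CARD('m) * G)) * D\<^sup>2)"
proof -
  let ?\<psi> = "f \<circ> inv_into U x" and ?\<psi>' = "f' \<circ> inv_into U x" and ?r = "\<rho> \<circ> inv_into U x"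
  let ?M = "area_measure S \<A> f" and ?W = "x ` U"
  interpret isometric_pair "x ` U" ?\<psi> ?\<psi>' by (rule pair[OF c])
  have r0: "\<rho> (inv_into U x u) = 0" if "u \<in> ?W" "u \<notin> K" for u
  proof -
    have "inv_into U x u \<notin> inv_into U x ` K"
      using chart(8)[OF c] that K(2) by (metis imageE subsetD)
    then show ?thesis using supp by simp
  qed
  have WK: "open (?W - K)" using open_dom K(1) by (intro open_Diff compact_imp_closed)
  have dr0: "Der ?r u v = 0" if u: "u \<in> ?W" "u \<notin> K" for u v
    by (rule frechet_derivative_zero_open[OF WK]) (use u r0 in auto)
  have zext: "continuous_on UNIV (\<lambda>u. if u \<in> ?W then g u else 0)"
    if "continuous_on ?W g" "\<And>u. \<lbrakk>u \<in> ?W; u \<notin> K\<rbrakk> \<Longrightarrow> g u = 0" for g :: "real ^ 'm \<Rightarrow> real"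
    by (rule continuous_on_zero_extension[OF open_dom _ K]) (use that K in \<open>auto cong: continuous_on_cong\<close>)
  have Hc: "continuous_on ?W (mean_curv ?\<psi>)" "continuous_on ?W (mean_curv ?\<psi>')"
  proof -
    have "continuous_on W (mean_curv \<psi>)" if "patch W \<psi>" for W and \<psi> :: "real ^ 'm \<Rightarrow> real ^ 'm option"
    proof -
      interpret X: patch W \<psi> by (rule that)
      have "continuous_on W (\<lambda>u. - (\<Sum>i\<in>UNIV. \<Sum>j\<in>UNIV. inv_metric \<psi> u $ i $ j * (pd j \<psi> u \<bullet> X.dnormal u (axis i 1))))"
        by (intro continuous_intros C1_on_imp_continuous_on[OF X.C1_inv_metric]
            C1_on_imp_continuous_on[OF X.C1_dpsi] C1_on_continuous_derivative[OF X.C1_normal])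
      then show ?thesis by (subst continuous_on_cong[OF refl X.mean_curv_dnormal]) auto
    qed
    then show "continuous_on ?W (mean_curv ?\<psi>)" "continuous_on ?W (mean_curv ?\<psi>')"
      using patch_axioms Q.patch_axioms by auto
  qed
  note rc = C1_on_imp_continuous_on[OF \<rho>(1)]
  define F where "F g u = (if u \<in> ?W then ?r u * mean_curv (g \<circ> inv_into U x) u else 0)"
    for g :: "'a \<Rightarrow> real ^ 'm option" and u
  define P where "P u = (if u \<in> ?W then pairing (U, x) \<rho> u else 0)" for u
  have Fc: "continuous_on UNIV (F f)" "continuous_on UNIV (F f')"
    unfolding F_def by (rule zext, intro continuous_on_mult rc Hc, simp add: r0)+
  have F0: "F g u = 0" if "u \<notin> K" for g u using r0[OF _ that] by (simp add: F_def)
  have Pc: "continuous_on UNIV P"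
    unfolding P_def pairing_sum
    by (rule zext, intro continuous_intros C1_on_imp_continuous_on[OF C1_inv_metric]
        C1_on_imp_continuous_on[OF C1_dpsi] C1_on_imp_continuous_on[OF Q.C1_dpsi]
        C1_on_imp_continuous_on[OF C1_normal] C1_on_continuous_derivative[OF \<rho>(1)])
      (simp add: dr0)
  have P0: "P u = 0" if "u \<notin> K" for u using dr0[OF _ that] by (simp add: P_def pairing_sum)
  have hF: "h g p = (if p \<in> U then F g (x p) else 0)" if "immersed_manifold S \<A> g" for g p
    using immersed_manifold.mean_curvature_chart[OF that c] chart(7)[OF c] by (simp add: h_def F_def)
  have hf: "h f = (\<lambda>p. if p \<in> U then F f (x p) else 0)" "h f' = (\<lambda>p. if p \<in> U then F f' (x p) else 0)"
    by (rule ext, rule hF, unfold_locales)+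
  have kP: "k = (\<lambda>p. if p \<in> U then P (x p) else 0)" by (auto simp: k_def P_def)
  note I1 = integral_chart[OF c Fc(1) K F0] and I2 = integral_chart[OF c Fc(2) K F0]
    and I3 = integral_chart[OF c Pc K P0]
  show "integrable ?M (h f)" unfolding hf by (rule I1(1))
  show "integrable ?M (h f')" unfolding hf by (rule I2(1))
  show "integrable ?M k" unfolding kP by (rule I3(1))
  define X where "X i u = (if u \<in> ?W then ?r u * (flux_shift i u \<bullet> nrm ?\<psi> u) else 0)" for i u
  define R where "R u = (if u \<in> ?W then ?r u * remainder u else 0)" for u
  have XW: "C1_on ?W (\<lambda>u. ?r u * (flux_shift i u \<bullet> nrm ?\<psi> u))" for i
    by (intro C1_on_mult C1_on_inner \<rho>(1) C1_flux_shift C1_normal)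
  have X1: "C1_on UNIV (X i)" for i
  proof (rule Ck_on_local)
    fix u
    show "\<exists>W. open W \<and> u \<in> W \<and> C1_on W (X i)"
    proof (cases "u \<in> ?W")
      case True
      have "C1_on ?W (X i)" using XW[of i] by (subst Ck_on_cong[OF open_dom]) (auto simp: X_def)
      with True open_dom show ?thesis by blast
    next
      case False
      have o: "open (- K)" using K(1) by (simp add: compact_imp_closed open_Compl)
      have "C1_on (- K) (X i)"
        using C1_on_const[of "- K" 0] by (subst Ck_on_cong[OF o, of _ "\<lambda>_. 0"]) (auto simp: X_def r0)
      moreover have "u \<in> - K" using False K(2) by auto
      ultimately show ?thesis using o by blast
    qed
  qed
  have X0: "X i u = 0" if "u \<notin> K" for i u using r0[OF _ that] by (simp add: X_def)
  note dX = integral_derivative_eq_0[OF X1 K(1) X0]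
  let ?d = "chart_density (U, x)"
  \<comment> \<open>Valid on the whole coordinate space, since off the chart image every term is
    zero; so all integrals can be taken over that space.\<close>
  have main: "?d u * F f' u = ?d u * F f u + ((\<Sum>i\<in>UNIV. pd i (X i) u) - ?d u * P u + R u)" for u
  proof (cases "u \<in> ?W")
    case True
    have "pd i (X i) u = pd i (\<lambda>y. ?r y * (flux_shift i y \<bullet> nrm ?\<psi> y)) u" for i
      using frechet_derivative_cong_open[OF open_dom True, of "X i"] by (simp add: X_def)
    moreover have "?r differentiable (at u)"
      using C1_on_has_derivative[OF \<rho>(1) True] by (auto simp: differentiable_def)
    ultimately show ?thesis
      using mean_curv_variation[OF True, of ?r] pairing_flux[OF c, of u \<rho>] True
      by (simp add: F_def P_def R_def chart_density_def algebra_simps)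
  next
    case False
    then have "u \<notin> K" using K(2) by auto
    moreover have "pd i (X i) u = 0" for i
      using K(1) \<open>u \<notin> K\<close> X0
      by (intro frechet_derivative_zero_open[of "- K"]) (auto simp: compact_imp_closed open_Compl)
    ultimately show ?thesis using False by (simp add: F0 P0 R_def)
  qed
  let ?B = "(G * (CARD('m) * (CARD('m) * (G * C))) * (CARD('m) * (CARD('m) * G)) + CARD('m) * (CARD('m) * G)) * D\<^sup>2"
  have intd: "integrable lborel (\<lambda>u. ?d u * g u)" if "continuous_on UNIV g" "\<And>u. u \<notin> K \<Longrightarrow> g u = 0" for g
  proof (rule compact_support_integrable[OF _ K(1)])
    have "continuous_on ?W (\<lambda>u. area_density ?\<psi> u * g u)"
      using C1_on_imp_continuous_on[OF C1_area] continuous_on_subset[OF that(1)] by (intro continuous_on_mult) auto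
    then have "continuous_on UNIV (\<lambda>u. if u \<in> ?W then area_density ?\<psi> u * g u else 0)"
      by (rule zext) (simp add: that(2))
    moreover have "(\<lambda>u. if u \<in> ?W then area_density ?\<psi> u * g u else 0) = (\<lambda>u. ?d u * g u)"
      by (auto simp: chart_density_def)
    ultimately show "continuous_on UNIV (\<lambda>u. ?d u * g u)"
      by (rule back_subst[of "continuous_on UNIV"])
  qed (simp add: that(2))
  have i1: "integrable lborel (\<lambda>u. ?d u * F f u)" and i2: "integrable lborel (\<lambda>u. ?d u * F f' u)"
    and i3: "integrable lborel (\<lambda>u. ?d u * P u)"
    by (auto intro!: intd Fc Pc F0 P0)
  \<comment> \<open>This makes \<open>R\<close> integrable as a combination of integrable terms,
    without any regularity of the remainder itself.\<close>
  have Req: "R = (\<lambda>u. ?d u * F f' u - ?d u * F f u - (\<Sum>i\<in>UNIV. pd i (X i) u) + ?d u * P u)"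
    using main by (auto simp: fun_eq_iff)
  have iX: "integrable lborel (\<lambda>u. \<Sum>i\<in>UNIV. pd i (X i) u)" "(\<integral>u. (\<Sum>i\<in>UNIV. pd i (X i) u) \<partial>lborel) = 0"
    using dX by (simp_all add: Bochner_Integration.integral_sum)
  have iR: "integrable lborel R" unfolding Req by (intro Bochner_Integration.integrable_add Bochner_Integration.integrable_diff i1 i2 i3 iX)
  have "(\<integral>u. R u \<partial>lborel) = (\<integral>u. ?d u * F f' u \<partial>lborel) - (\<integral>u. ?d u * F f u \<partial>lborel) + (\<integral>u. ?d u * P u \<partial>lborel)"
    unfolding Req using i1 i2 i3 iX
    by (simp add: Bochner_Integration.integral_add Bochner_Integration.integral_diff)
  also have "\<dots> = (\<integral>p. h f' p \<partial>?M) - (\<integral>p. h f p \<partial>?M) + (\<integral>p. k p \<partial>?M)"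
  proof -
    have "(\<integral>p. h f p \<partial>?M) = (\<integral>u. ?d u * F f u \<partial>lborel)" unfolding hf by (rule I1(2))
    moreover have "(\<integral>p. h f' p \<partial>?M) = (\<integral>u. ?d u * F f' u \<partial>lborel)" unfolding hf by (rule I2(2))
    moreover have "(\<integral>p. k p \<partial>?M) = (\<integral>u. ?d u * P u \<partial>lborel)" unfolding kP by (rule I3(2))
    ultimately show ?thesis by simp
  qed
  finally have eq: "(\<integral>p. h f' p \<partial>?M) - (\<integral>p. h f p \<partial>?M) + (\<integral>p. k p \<partial>?M) = (\<integral>u. R u \<partial>lborel)" ..
  have Rb: "\<bar>R u\<bar> \<le> indicator K u * ?B" for u
  proof (cases "u \<in> K")
    case True
    then have u: "u \<in> ?W" using K(2) by auto
    have "\<bar>remainder u\<bar> \<le> ?B"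
      by (rule remainder_bound[OF u]) (use G C D pos True in \<open>auto simp: shift_def\<close>)
    moreover have "0 \<le> ?r u" "?r u \<le> 1" using \<rho>(2) chart(9)[OF c u] by auto
    ultimately have "\<bar>?r u\<bar> * \<bar>remainder u\<bar> \<le> 1 * ?B" by (intro mult_mono) auto
    then show ?thesis using u True by (simp add: R_def abs_mult)
  next
    case False
    then show ?thesis using r0[of u] by (simp add: R_def)
  qed
  have "\<bar>\<integral>u. R u \<partial>lborel\<bar> \<le> (\<integral>u. \<bar>R u\<bar> \<partial>lborel)" by (rule integral_abs_bound)
  also have "\<dots> \<le> (\<integral>u. indicator K u * ?B \<partial>lborel)"
    by (intro Bochner_Integration.integral_mono Rb Bochner_Integration.integrable_abs iR) (use borel_integrable_compact[OF K(1), of "\<lambda>_. ?B"] in simp)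
  also have "\<dots> = measure lborel K * ?B" by simp
  finally show "\<bar>(\<integral>p. h f' p \<partial>?M) - (\<integral>p. h f p \<partial>?M) + (\<integral>p. k p \<partial>?M)\<bar> \<le> measure lborel K * ?B"
    unfolding eq .
qed

end

context patch
begin

lemma coefficient_bound:
  assumes K: "compact K" "K \<subseteq> \<Omega>"
  obtains G where "\<And>u i j. u \<in> K \<Longrightarrow> area_density \<psi> u \<le> G
    \<and> \<bar>inv_metric \<psi> u $ i $ j\<bar> \<le> G \<and> \<bar>raised_form u $ i $ j\<bar> \<le> G"
proof -
  define q where "q u = area_density \<psi> u + (\<Sum>i\<in>UNIV. \<Sum>j\<in>UNIV. \<bar>inv_metric \<psi> u $ i $ j\<bar>)
      + (\<Sum>i\<in>UNIV. \<Sum>j\<in>UNIV. \<bar>raised_form u $ i $ j\<bar>)" for u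
  have "continuous_on \<Omega> q"
    unfolding q_def
    by (intro continuous_intros C1_on_imp_continuous_on[OF C1_area]
        C1_on_imp_continuous_on[OF C1_inv_metric] continuous_raised_form)
  then have "bounded (q ` K)"
    using K by (intro compact_imp_bounded compact_continuous_image) (auto intro: continuous_on_subset)
  then obtain G where G: "\<And>u. u \<in> K \<Longrightarrow> \<bar>q u\<bar> \<le> G"
    unfolding bounded_iff by (metis imageI real_norm_def)
  have le: "\<bar>f i j\<bar> \<le> (\<Sum>i\<in>UNIV. \<Sum>j\<in>UNIV. \<bar>f i j\<bar>)" for f :: "'m \<Rightarrow> 'm \<Rightarrow> real" and i j
  proof -
    have "\<bar>f i j\<bar> \<le> (\<Sum>j\<in>UNIV. \<bar>f i j\<bar>)" by (rule member_le_sum) auto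
    also have "\<dots> \<le> (\<Sum>i\<in>UNIV. \<Sum>j\<in>UNIV. \<bar>f i j\<bar>)"
      by (rule member_le_sum[where f = "\<lambda>i. \<Sum>j\<in>UNIV. \<bar>f i j\<bar>"]) (auto intro: sum_nonneg)
    finally show ?thesis .
  qed
  show ?thesis
  proof (rule that[of G])
    fix u i j assume u: "u \<in> K"
    have nn: "0 \<le> (\<Sum>i\<in>UNIV. \<Sum>j\<in>UNIV. \<bar>f i j\<bar>)" for f :: "'m \<Rightarrow> 'm \<Rightarrow> real"
      by (intro sum_nonneg abs_ge_zero)
    have "area_density \<psi> u > 0" using area_pos u K(2) by blast
    then show "area_density \<psi> u \<le> G \<and> \<bar>inv_metric \<psi> u $ i $ j\<bar> \<le> G \<and> \<bar>raised_form u $ i $ j\<bar> \<le> G"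
      using G[OF u] le[of "\<lambda>i j. inv_metric \<psi> u $ i $ j" i j] le[of "\<lambda>i j. raised_form u $ i $ j" i j]
        nn[of "\<lambda>i j. inv_metric \<psi> u $ i $ j"] nn[of "\<lambda>i j. raised_form u $ i $ j"]
      unfolding q_def by linarith
  qed
qed

end

text \<open>Inside \<open>U\<close> this is coordinate independence. Outside, \<open>p\<close> has a
  neighbourhood on which \<open>\<rho>\<close> vanishes, since its compact support is closed, so the
  differential of \<open>\<rho>\<close> is zero at \<open>p\<close>.\<close>

lemma (in immersed_pair) pairing_global:
  assumes c: "(U, x) \<in> \<A>" and K: "compact K" "K \<subseteq> x ` U"
    and \<rho>: "C1_on (y ` V) (\<rho> \<circ> inv_into V y)"
    and supp: "\<And>p. p \<notin> inv_into U x ` K \<Longrightarrow> \<rho> p = 0"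
    and d: "(V, y) \<in> \<A>" "p \<in> V"
  shows "(if p \<in> U then pairing (U, x) \<rho> (x p) else 0) = pairing (V, y) \<rho> (y p)"
proof (cases "p \<in> U")
  case True
  have yp: "(y \<circ> inv_into U x) (x p) = y p" using chart(7)[OF c True] by simp
  have "(\<rho> \<circ> inv_into V y) differentiable (at (y p))"
    using C1_on_has_derivative[OF \<rho>, of "y p"] d(2) by (auto simp: differentiable_def)
  then have "pairing (U, x) \<rho> (x p) = pairing (V, y) \<rho> ((y \<circ> inv_into U x) (x p))"
    using True d(2) by (intro pairing_chart_change[OF c d(1)]) (simp_all only: yp, auto)
  then show ?thesis using True yp by simp
next
  case False
  let ?L = "inv_into U x ` K"
  have "compact ?L"
    using K by (intro compact_continuous_image continuous_on_subset[OF chart(5)[OF c]]) auto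
  then have "open (- ?L)" by (simp add: compact_imp_closed open_Compl)
  then have W: "open (y ` (V \<inter> - ?L))" by (rule open_chart_image[OF d(1)])
  have "?L \<subseteq> U" using K(2) chart(9)[OF c] by blast
  then have pW: "y p \<in> y ` (V \<inter> - ?L)" using False d(2) by blast
  have "(\<rho> \<circ> inv_into V y) w = 0" if "w \<in> y ` (V \<inter> - ?L)" for w
    using that chart(7)[OF d(1)] supp by auto
  then have "Der (\<rho> \<circ> inv_into V y) (y p) v = 0" for v
    by (rule frechet_derivative_zero_open[OF W pW])
  then show ?thesis using False by (simp add: pairing_sum)
qed

section \<open>From quadratic estimates to constancy\<close>

lemma quadratic_estimate_imp_constant:
  fixes I :: "real \<Rightarrow> real"
  assumes "\<And>s. s \<in> {0..1} \<Longrightarrow> \<exists>\<epsilon>>0. \<exists>C. \<forall>t\<in>{0..1}. \<bar>t - s\<bar> < \<epsilon> \<longrightarrow> \<bar>I t - I s\<bar> \<le> C * (t - s)\<^sup>2"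
    and st: "s \<in> {0..1}" "t \<in> {0..1}"
  shows "I s = I t"
proof (rule has_derivative_zero_unique[of "{0..1}" I s t])
  fix s :: real assume s: "s \<in> {0..1}"
  obtain \<epsilon> C where e: "\<epsilon> > 0"
    and C: "\<And>t. \<lbrakk>t \<in> {0..1}; \<bar>t - s\<bar> < \<epsilon>\<rbrakk> \<Longrightarrow> \<bar>I t - I s\<bar> \<le> C * (t - s)\<^sup>2"
    using assms(1)[OF s] by blast
  show "(I has_derivative (\<lambda>h. 0)) (at s within {0..1})"
    unfolding has_derivative_within_alt
  proof (intro conjI allI impI)
    show "bounded_linear (\<lambda>h :: real. 0 :: real)" by (rule bounded_linear_zero)
    fix d :: real assume d: "d > 0"
    \<comment> \<open>Chosen so that \<open>(\<bar>C\<bar> + 1) * \<bar>t - s\<bar> \<le> d\<close>,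
      which turns the quadratic bound into a linear one with arbitrarily small slope; the
      \<open>+ 1\<close> excludes division by zero.\<close>
    define \<delta> where "\<delta> = min \<epsilon> (d / (\<bar>C\<bar> + 1))"
    have "\<delta> > 0" using e d by (simp add: \<delta>_def)
    moreover have "norm (I t - I s - 0) \<le> d * norm (t - s)" if t: "t \<in> {0..1}" "norm (t - s) < \<delta>" for t
    proof -
      have "\<bar>I t - I s\<bar> \<le> C * (t - s)\<^sup>2" using t by (intro C) (auto simp: \<delta>_def)
      also have "\<dots> \<le> (\<bar>C\<bar> + 1) * (t - s)\<^sup>2" by (intro mult_right_mono) auto
      also have "\<dots> = ((\<bar>C\<bar> + 1) * \<bar>t - s\<bar>) * \<bar>t - s\<bar>"
        by (simp add: power2_eq_square abs_mult_self_eq mult.assoc)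
      also have "(\<bar>C\<bar> + 1) * \<bar>t - s\<bar> \<le> d"
        using t(2) by (simp add: \<delta>_def pos_less_divide_eq mult.commute)
      then have "((\<bar>C\<bar> + 1) * \<bar>t - s\<bar>) * \<bar>t - s\<bar> \<le> d * \<bar>t - s\<bar>" by (rule mult_right_mono) auto
      finally show ?thesis by simp
    qed
    ultimately show "\<exists>\<delta>>0. \<forall>t\<in>{0..1}. norm (t - s) < \<delta> \<longrightarrow> norm (I t - I s - 0) \<le> d * norm (t - s)"
      by blast
  qed
qed (use st in auto)

locale deformation = closed_manifold S \<A>
  for S :: "'a::t2_space set" and \<A> :: "('a, 'm::finite) chart set" +
  fixes \<phi> :: "real \<Rightarrow> 'a \<Rightarrow> real ^ 'm option"
  assumes deformation: "isometric_deformation \<A> \<phi>"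
begin

lemma immersed: "t \<in> {0..1} \<Longrightarrow> immersed_manifold S \<A> (\<phi> t)"
  using deformation closed_manifold_axioms
  by (auto simp: isometric_deformation_def immersed_manifold_def immersed_manifold_axioms_def)

lemma pair:
  assumes "s \<in> {0..1}" "t \<in> {0..1}"
  shows "immersed_pair S \<A> (\<phi> s) (\<phi> t)"
proof (intro immersed_pair.intro immersed assms immersed_pair_axioms.intro)
  fix U x u assume a: "(U, x) \<in> \<A>" "u \<in> x ` U"
  have "\<forall>s\<in>{0..1}. \<forall>t\<in>{0..1}. \<forall>(U, x)\<in>\<A>. \<forall>u\<in>x ` U.
      first_form (\<phi> s \<circ> inv_into U x) u = first_form (\<phi> t \<circ> inv_into U x) u"
    using deformation unfolding isometric_deformation_def by (elim conjE)
  then have "first_form (\<phi> t \<circ> inv_into U x) u = first_form (\<phi> s \<circ> inv_into U x) u"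
    using assms a by fast
  then have "first_form (\<phi> t \<circ> inv_into U x) u v w = first_form (\<phi> s \<circ> inv_into U x) u v w" for v w
    by simp
  then show "metric (\<phi> t \<circ> inv_into U x) u = metric (\<phi> s \<circ> inv_into U x) u"
    by (simp add: gram_def first_form_def)
qed

lemma smooth_chart:
  assumes "(U, x) \<in> \<A>"
  shows "smooth_on ({0..1} \<times> x ` U) (\<lambda>(t, u). (\<phi> t \<circ> inv_into U x) u)"
proof -
  have "\<forall>(U, x)\<in>\<A>. smooth_on ({0..1} \<times> x ` U) (\<lambda>(t, u). \<phi> t (inv_into U x u))"
    using deformation unfolding isometric_deformation_def by (elim conjE)
  from bspec[OF this assms] show ?thesis by (simp add: comp_def)
qed

text \<open>The chart estimates are summed over a partition of unity that depends on the atlas but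
  not on \<open>t\<close>. Isometry lets all integrals refer to the area measure at time
  \<open>s\<close>.\<close>

theorem total_mean_curvature_estimate:
  assumes s: "s \<in> {0..1}"
  defines "I \<equiv> \<lambda>t. \<integral>p. mean_curvature \<A> (\<phi> t) p \<partial>area_measure S \<A> (\<phi> t)"
  shows "\<exists>\<epsilon>>0. \<exists>C. \<forall>t\<in>{0..1}. \<bar>t - s\<bar> < \<epsilon> \<longrightarrow> \<bar>I t - I s\<bar> \<le> C * (t - s)\<^sup>2"
proof -
  interpret F: immersed_manifold S \<A> "\<phi> s" by (rule immersed[OF s])
  obtain n :: nat and c K and \<rho> :: "nat \<Rightarrow> 'a \<Rightarrow> real"
    where c: "\<And>i. i < n \<Longrightarrow> c i \<in> \<A>" and K: "\<And>i. i < n \<Longrightarrow> compact (K i)"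
      "\<And>i. i < n \<Longrightarrow> K i \<subseteq> snd (c i) ` fst (c i)"
    and one: "\<And>p. p \<in> S \<Longrightarrow> (\<Sum>i<n. \<rho> i p) = 1"
    and r01: "\<And>i p. \<lbrakk>i < n; p \<in> S\<rbrakk> \<Longrightarrow> 0 \<le> \<rho> i p \<and> \<rho> i p \<le> 1"
    and supp: "\<And>i p. \<lbrakk>i < n; p \<notin> inv_into (fst (c i)) (snd (c i)) ` K i\<rbrakk> \<Longrightarrow> \<rho> i p = 0"
    and C1: "\<And>i V y. \<lbrakk>i < n; (V, y) \<in> \<A>\<rbrakk> \<Longrightarrow> C1_on (y ` V) (\<rho> i \<circ> inv_into V y)"
    using partition_of_unity by blast
  define U where "U i = fst (c i)" for i
  define x where "x i = snd (c i)" for i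
  have cU: "(U i, x i) \<in> \<A>" if "i < n" for i using c[OF that] by (simp add: U_def x_def)
  note K' = K(1) K(2)[folded U_def x_def] and supp' = supp[folded U_def x_def]
  define \<psi> where "\<psi> i t = \<phi> t \<circ> inv_into (U i) (x i)" for i t
  have "\<exists>\<epsilon> C G. \<epsilon> > 0 \<and> (\<forall>u\<in>K i. time_bound (\<psi> i) (nrm (\<psi> i s)) s \<epsilon> C u
      \<and> (\<forall>j l. area_density (\<psi> i s) u \<le> G \<and> \<bar>inv_metric (\<psi> i s) u $ j $ l\<bar> \<le> G
          \<and> \<bar>patch.raised_form (\<psi> i s) u $ j $ l\<bar> \<le> G))" if i: "i < n" for i
  proof -
    interpret P: patch "x i ` U i" "\<psi> i s" unfolding \<psi>_def by (rule F.patch[OF cU[OF i]])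
    have pos: "det (frame (Der (\<psi> i s) u) (nrm (\<psi> i s) u)) > 0" if "u \<in> x i ` U i" for u
      by (rule P.normal(5)[OF that that])
    obtain \<epsilon> C where e: "\<epsilon> > 0" "\<And>u. u \<in> K i \<Longrightarrow> time_bound (\<psi> i) (nrm (\<psi> i s)) s \<epsilon> C u"
      using time_bound_compact[OF P.open_dom smooth_chart[OF cU[OF i], folded \<psi>_def] s K'[OF i]
          C1_on_imp_continuous_on[OF P.C1_normal] pos] by metis
    obtain G where "\<And>u j l. u \<in> K i \<Longrightarrow> area_density (\<psi> i s) u \<le> G
      \<and> \<bar>inv_metric (\<psi> i s) u $ j $ l\<bar> \<le> G \<and> \<bar>P.raised_form u $ j $ l\<bar> \<le> G"
      using P.coefficient_bound[OF K'[OF i]] by blast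
    with e show ?thesis by blast
  qed
  then obtain e C G where e: "\<And>i. i < n \<Longrightarrow> e i > 0"
    and C: "\<And>i u. \<lbrakk>i < n; u \<in> K i\<rbrakk> \<Longrightarrow> time_bound (\<psi> i) (nrm (\<psi> i s)) s (e i) (C i) u"
    and G: "\<And>i u j l. \<lbrakk>i < n; u \<in> K i\<rbrakk> \<Longrightarrow> area_density (\<psi> i s) u \<le> G i
      \<and> \<bar>inv_metric (\<psi> i s) u $ j $ l\<bar> \<le> G i \<and> \<bar>patch.raised_form (\<psi> i s) u $ j $ l\<bar> \<le> G i"
    by metis
  \<comment> \<open>The inserted \<open>1\<close> covers \<open>n = 0\<close>, which is possible
    only for empty \<open>S\<close>.\<close>
  define \<epsilon> where "\<epsilon> = Min (insert 1 (e ` {..<n}))"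
  have e0: "\<epsilon> > 0" unfolding \<epsilon>_def using e by (subst Min_gr_iff) auto
  have ei: "\<epsilon> \<le> e i" if "i < n" for i unfolding \<epsilon>_def using that by (intro Min_le) auto
  let ?m = "real CARD('m)"
  \<comment> \<open>The constant of \<open>localized_variation\<close> for
    \<open>D = C i * \<bar>t - s\<bar>\<close>, with the square of the time difference split
    off.\<close>
  define B where "B i = measure lborel (K i) * ((G i * (?m * (?m * (G i * C i))) * (?m * (?m * G i)) + ?m * (?m * G i)) * (C i)\<^sup>2)" for i
  have "\<bar>I t - I s\<bar> \<le> (\<Sum>i<n. B i) * (t - s)\<^sup>2" if t: "t \<in> {0..1}" "\<bar>t - s\<bar> < \<epsilon>" for t
  proof -
    interpret P: immersed_pair S \<A> "\<phi> s" "\<phi> t" by (rule pair[OF s t(1)])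
    let ?M = "area_measure S \<A> (\<phi> s)"
    have space: "space ?M = S" by (rule F.is_area_measureD(2)[OF F.area_measure])
    define h where "h i f p = (if p \<in> U i then \<rho> i p * mean_curvature \<A> f p else 0)" for i f p
    define k where "k i p = (if p \<in> U i then P.pairing (U i, x i) (\<rho> i) (x i p) else 0)" for i p
    have loc: "integrable ?M (h i (\<phi> s)) \<and> integrable ?M (h i (\<phi> t)) \<and> integrable ?M (k i) \<and>
        \<bar>(\<integral>p. h i (\<phi> t) p \<partial>?M) - (\<integral>p. h i (\<phi> s) p \<partial>?M) + (\<integral>p. k i p \<partial>?M)\<bar> \<le> B i * (t - s)\<^sup>2"
      if i: "i < n" for i
    proof -
      have tb: "norm (pd j (pd l (\<psi> i t)) u) \<le> C i" "norm (pd j (\<psi> i t) u - pd j (\<psi> i s) u) \<le> C i * \<bar>t - s\<bar>"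
        "det (frame (Der (\<psi> i t) u) (nrm (\<psi> i s) u)) > 0" if "u \<in> K i" for u j l
        using C[OF i that] t ei[OF i] unfolding time_bound_def by force+
      \<comment> \<open>The frame determinant is \<open>normal_vec\<close> of the moving frame
        paired with the normal at time \<open>s\<close>, hence a positive multiple of the product of
        the two unit normals.\<close>
      have pos: "nrm (\<psi> i t) u \<bullet> nrm (\<psi> i s) u \<ge> 0" if "u \<in> K i" for u
        using tb(3)[OF that] by (simp add: det_frame unit_normal_def[of "Der (\<psi> i t) u"])
      have r01': "0 \<le> \<rho> i p \<and> \<rho> i p \<le> 1" if "p \<in> U i" for p
        using r01[OF i] chart(1)[OF cU[OF i]] that by blast
      note L = P.localized_variation[OF cU[OF i] K'[OF i] C1[OF i cU[OF i]] r01' supp'[OF i]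
          G[OF i, unfolded \<psi>_def] tb(1)[unfolded \<psi>_def] tb(2)[unfolded \<psi>_def] pos[unfolded \<psi>_def]]
      have "measure lborel (K i) * ((G i * (?m * (?m * (G i * C i))) * (?m * (?m * G i)) + ?m * (?m * G i)) * (C i * \<bar>t - s\<bar>)\<^sup>2)
          = B i * (t - s)\<^sup>2"
        by (simp add: B_def power_mult_distrib mult_ac)
      then show ?thesis using L by (simp add: h_def[abs_def] k_def[abs_def])
    qed
    have mc: "(\<integral>p. mean_curvature \<A> f p \<partial>?M) = (\<Sum>i<n. \<integral>p. h i f p \<partial>?M)"
      if "\<And>i. i < n \<Longrightarrow> integrable ?M (h i f)" for f
    proof -
      have "mean_curvature \<A> f p = (\<Sum>i<n. h i f p)" if p: "p \<in> S" for p
      proof -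
        \<comment> \<open>Off \<open>U i\<close> both sides are zero, because the support of
          \<open>\<rho> i\<close> lies inside \<open>U i\<close>.\<close>
        have "h i f p = \<rho> i p * mean_curvature \<A> f p" if i: "i < n" for i
        proof -
          have "inv_into (U i) (x i) ` K i \<subseteq> U i" using K'(2)[OF i] chart(9)[OF cU[OF i]] by blast
          then show ?thesis using supp'[OF i, of p] by (auto simp: h_def)
        qed
        then have "(\<Sum>i<n. h i f p) = (\<Sum>i<n. \<rho> i p) * mean_curvature \<A> f p"
          by (simp add: sum_distrib_right)
        then show ?thesis by (simp add: one[OF p])
      qed
      then have "(\<integral>p. mean_curvature \<A> f p \<partial>?M) = (\<integral>p. (\<Sum>i<n. h i f p) \<partial>?M)"
        by (intro Bochner_Integration.integral_cong refl) (simp add: space)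
      also have "\<dots> = (\<Sum>i<n. \<integral>p. h i f p \<partial>?M)"
        using that by (intro Bochner_Integration.integral_sum) auto
      finally show ?thesis .
    qed
    have k0: "(\<Sum>i<n. \<integral>p. k i p \<partial>?M) = 0"
    proof -
      have "(\<Sum>i<n. \<integral>p. k i p \<partial>?M) = (\<integral>p. (\<Sum>i<n. k i p) \<partial>?M)"
        using loc by (intro Bochner_Integration.integral_sum[symmetric]) auto
      also have "\<dots> = (\<integral>p. 0 \<partial>?M)"
      proof (intro Bochner_Integration.integral_cong refl)
        fix p assume "p \<in> space ?M"
        then have "p \<in> S" by (simp add: space)
        then obtain V y where d: "(V, y) \<in> \<A>" "p \<in> V" using charts_cover by blast
        have "k i p = P.pairing (V, y) (\<rho> i) (y p)" if i: "i < n" for i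
          unfolding k_def by (rule P.pairing_global[OF cU[OF i] K'[OF i] C1[OF i d(1)] supp'[OF i] d])
        then have "(\<Sum>i<n. k i p) = (\<Sum>i<n. P.pairing (V, y) (\<rho> i) (y p))" by simp
        also have "\<dots> = 0"
          by (rule P.sum_pairing_eq_0[OF d(1) _ C1[OF _ d(1)] one]) (use d(2) in auto)
        finally show "(\<Sum>i<n. k i p) = 0" .
      qed
      finally show ?thesis by simp
    qed
    \<comment> \<open>The third sum is zero. It is inserted because only together with its own
      pairing term is the variation in a single chart known to be quadratically small.\<close>
    have "I t - I s = (\<Sum>i<n. \<integral>p. h i (\<phi> t) p \<partial>?M) - (\<Sum>i<n. \<integral>p. h i (\<phi> s) p \<partial>?M) + (\<Sum>i<n. \<integral>p. k i p \<partial>?M)"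
      unfolding I_def P.area_measure_eq k0 using mc loc by simp
    also have "\<dots> = (\<Sum>i<n. (\<integral>p. h i (\<phi> t) p \<partial>?M) - (\<integral>p. h i (\<phi> s) p \<partial>?M) + (\<integral>p. k i p \<partial>?M))"
      by (simp add: sum.distrib sum_subtractf)
    finally have "\<bar>I t - I s\<bar> \<le> (\<Sum>i<n. \<bar>(\<integral>p. h i (\<phi> t) p \<partial>?M) - (\<integral>p. h i (\<phi> s) p \<partial>?M) + (\<integral>p. k i p \<partial>?M)\<bar>)"
      by (simp only: sum_abs)
    also have "\<dots> \<le> (\<Sum>i<n. B i * (t - s)\<^sup>2)" using loc by (intro sum_mono) auto
    finally show ?thesis by (simp add: sum_distrib_right)
  qed
  then show ?thesis using e0 by blast
qed

end

theorem theorem5: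
  fixes S :: "'a::t2_space set"
    and \<A> :: "('a, 'm::finite) chart set"
    and \<phi> :: "real \<Rightarrow> 'a \<Rightarrow> real ^ 'm option"
  assumes "CARD('m) + 1 \<ge> 3"
    and "compact S"
    and "oriented_smooth_atlas S \<A>"
    and "isometric_deformation \<A> \<phi>"
  shows "\<forall>s\<in>{0..1}. \<forall>t\<in>{0..1}.
    (\<integral>p. mean_curvature \<A> (\<phi> s) p \<partial>area_measure S \<A> (\<phi> s)) =
    (\<integral>p. mean_curvature \<A> (\<phi> t) p \<partial>area_measure S \<A> (\<phi> t))"
proof -
  interpret deformation S \<A> \<phi> by unfold_locales (rule assms)+
  show ?thesis
    using quadratic_estimate_imp_constant[OF total_mean_curvature_estimate] by blast
qed

end
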